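(* Let $\Gamma$ be a countably infinite group with Kazhdan Property (T), generated by a finite set, and let $\{G_n\}_{n=1}^{\infty}$ be a sequence of finite graphs of bounded degree that locally converges to a Cayley graph of $\Gamma$. Then there exist $\gamma>0$, an integer $d$, and a sequence of finite $d$-regular graphs $\{G'_n\}_{n=1}^{\infty}$ such that: (1) $V(G_n)=V(G'_n)$ for every $n$; (2) $\lim_{n\to\infty} \frac{|E(G_n)\,\Delta\, E(G'_n)|}{|V(G_n)|}=0$; (3) for every $n$ the graph $G'_n$ is a vertex-disjoint union of $\gamma$-expander graphs.
   Context: A sequence of finite (possibly edge-labeled) graphs $\{G_n\}$ locally converges to the (labeled) Cayley graph $\mathrm{Cay}(\Gamma,S)$ of a group $\Gamma$ with finite generating set $S$ if for every integer $r\ge 0$ the proportion of vertices $v\in V(G_n)$ such that the rooted ball of radius $r$ around $v$ in $G_n$ is isomorphic (as a rooted, labeled graph) to the rooted ball of radius $r$ in the Cayley graph tends to $1$ as $n\to\infty$. A finite $d$-regular graph $H$ is a $\gamma$-expander if for every $S\subseteq V(H)$ with $|S|\le |V(H)|/2$ the number of edges between $S$ and $V(H)\setminus S$ is at least $\gamma d|S|$. $\Delta$ denotes symmetric difference.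
   Formalization: Graphs here may have parallel edges and loops, a loop adding one to the degree, and edge differences are counted with multiplicity; with simple graphs the claim fails, since d is forced to be the Cayley graph's degree, possibly odd, while |V(G_n)| may be odd or too small. *)

theory Defs
  imports Complex_Main "HOL-Library.Countable_Set" "HOL-Library.Disjoint_Sets"
    "HOL-Algebra.Module" "HOL-Algebra.Group_Action" "HOL-Algebra.Generated_Groups"
begin

section \<open>Kazhdan's Property (T) for discrete groups\<close>

definition complex_ring :: "complex ring" where
  "complex_ring = \<lparr>carrier = UNIV, mult = (*), one = 1, zero = 0, add = (+)\<rparr>"

lemma complex_ring_cring: "cring complex_ring"
proof (intro cringI abelian_groupI comm_monoidI)
  fix x assume "x \<in> carrier complex_ring"
  show "\<exists>y\<in>carrier complex_ring. y \<oplus>\<^bsub>complex_ring\<^esub> x = \<zero>\<^bsub>complex_ring\<^esub>"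
    by (intro bexI[of _ "- x"]) (simp_all add: complex_ring_def)
qed (simp_all add: complex_ring_def algebra_simps)

definition hnorm :: "('h \<Rightarrow> 'h \<Rightarrow> complex) \<Rightarrow> 'h \<Rightarrow> real" where
  "hnorm ip x = sqrt (Re (ip x x))"

locale complex_hilbert_space = module complex_ring H
  for H :: "(complex, 'h) module" (structure) +
  fixes ip :: "'h \<Rightarrow> 'h \<Rightarrow> complex"
  assumes ip_add: "\<lbrakk>x \<in> carrier H; y \<in> carrier H; z \<in> carrier H\<rbrakk>
      \<Longrightarrow> ip (x \<oplus>\<^bsub>H\<^esub> y) z = ip x z + ip y z"
    and ip_smult: "\<lbrakk>x \<in> carrier H; y \<in> carrier H\<rbrakk> \<Longrightarrow> ip (c \<odot>\<^bsub>H\<^esub> x) y = c * ip x y"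
    and ip_cnj: "\<lbrakk>x \<in> carrier H; y \<in> carrier H\<rbrakk> \<Longrightarrow> ip y x = cnj (ip x y)"
    and ip_pos: "\<lbrakk>x \<in> carrier H; x \<noteq> \<zero>\<^bsub>H\<^esub>\<rbrakk> \<Longrightarrow> 0 < Re (ip x x)"
    and complete: "\<lbrakk>\<And>n. X n \<in> carrier H;
        \<And>e. 0 < e \<Longrightarrow> \<exists>N. \<forall>m\<ge>N. \<forall>n\<ge>N. hnorm ip (X m \<ominus>\<^bsub>H\<^esub> X n) < e\<rbrakk>
      \<Longrightarrow> \<exists>x\<in>carrier H. (\<lambda>n. hnorm ip (X n \<ominus>\<^bsub>H\<^esub> x)) \<longlonglongrightarrow> 0"

text \<open>A group action gives a homomorphism into the bijections of the carrier; the remaining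
  axioms make every such bijection a unitary operator.\<close>

locale unitary_rep = complex_hilbert_space H ip + group_action \<Gamma> "carrier H" \<pi>
  for \<Gamma> :: "('g, 'm) monoid_scheme" and H :: "(complex, 'h) module" and ip and \<pi> +
  assumes rep_add: "\<lbrakk>g \<in> carrier \<Gamma>; x \<in> carrier H; y \<in> carrier H\<rbrakk>
      \<Longrightarrow> \<pi> g (x \<oplus>\<^bsub>H\<^esub> y) = \<pi> g x \<oplus>\<^bsub>H\<^esub> \<pi> g y"
    and rep_smult: "\<lbrakk>g \<in> carrier \<Gamma>; x \<in> carrier H\<rbrakk> \<Longrightarrow> \<pi> g (c \<odot>\<^bsub>H\<^esub> x) = c \<odot>\<^bsub>H\<^esub> \<pi> g x"
    and rep_ip: "\<lbrakk>g \<in> carrier \<Gamma>; x \<in> carrier H; y \<in> carrier H\<rbrakk>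
      \<Longrightarrow> ip (\<pi> g x) (\<pi> g y) = ip x y"

text \<open>The definition asks for a Kazhdan pair \<open>(Q, \<epsilon>)\<close>, that is, a finite (= compact) set \<open>Q\<close> and
  \<open>\<epsilon> > 0\<close> such that every unitary representation with a \<open>(Q, \<epsilon>)\<close>-invariant vector has a nonzero
  invariant vector.

  HOL cannot quantify over types inside a formula, so the underlying sets of the Hilbert spaces range
  over all subsets of the one type \<^typ>\<open>'g \<Rightarrow> complex\<close>. This loses nothing: if a representation
  on a Hilbert space of any size has a \<open>(Q, \<epsilon>)\<close>-invariant vector \<open>v\<close> but no nonzero invariant
  vector, so does the closed linear span of the orbit of \<open>v\<close>. That span has a spanning set of size at
  most \<open>|\<Gamma>|\<close>, so (for finite and for infinite \<open>\<Gamma>\<close>) it has at most as many points as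
  \<^typ>\<open>'g \<Rightarrow> complex\<close> and is isomorphic to a Hilbert space on a subset of that type.\<close>

definition property_T :: "('g, 'm) monoid_scheme \<Rightarrow> bool" where
  "property_T \<Gamma> \<longleftrightarrow>
     (\<exists>Q \<epsilon>. finite Q \<and> Q \<subseteq> carrier \<Gamma> \<and> 0 < \<epsilon> \<and>
       (\<forall>(H :: (complex, 'g \<Rightarrow> complex) module) ip \<pi>.
          unitary_rep \<Gamma> H ip \<pi> \<longrightarrow>
          (\<exists>v\<in>carrier H. v \<noteq> \<zero>\<^bsub>H\<^esub> \<and> (\<forall>g\<in>Q. hnorm ip (\<pi> g v \<ominus>\<^bsub>H\<^esub> v) < \<epsilon> * hnorm ip v)) \<longrightarrow>
          (\<exists>w\<in>carrier H. w \<noteq> \<zero>\<^bsub>H\<^esub> \<and> (\<forall>g\<in>carrier \<Gamma>. \<pi> g w = w))))"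

section \<open>Graphs\<close>

text \<open>An undirected graph, possibly with loops and parallel edges: \<open>emult G {u, v}\<close> is the number
  of edges joining \<open>u\<close> and \<open>v\<close>, and \<open>emult G {v}\<close> the number of loops at \<open>v\<close>. A simple graph is
  one with \<open>emult\<close> at most 1 and no loops. Loops have to be allowed, and to count once in the
  degree, for the phrase ``finite \<open>d\<close>-regular graph on a given vertex set'' to be satisfiable: for
  instance there is no other \<open>d\<close>-regular graph with \<open>d\<close> and the number of vertices both odd.\<close>

record 'v graph =
  verts :: "'v set"
  emult :: "'v set \<Rightarrow> nat"

definition wf_graph :: "'v graph \<Rightarrow> bool" where
  "wf_graph G \<longleftrightarrow> (\<forall>e. emult G e > 0 \<longrightarrow> (\<exists>u\<in>verts G. \<exists>v\<in>verts G. e = {u, v}))"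

definition finite_graph :: "'v graph \<Rightarrow> bool" where
  "finite_graph G \<longleftrightarrow> wf_graph G \<and> finite (verts G)"

definition vertex_degree :: "'v graph \<Rightarrow> 'v \<Rightarrow> nat" where
  "vertex_degree G v = (\<Sum>u\<in>verts G. emult G {v, u})"

definition regular_graph :: "nat \<Rightarrow> 'v graph \<Rightarrow> bool" where
  "regular_graph d G \<longleftrightarrow> (\<forall>v\<in>verts G. vertex_degree G v = d)"

definition bounded_degree :: "(nat \<Rightarrow> 'v graph) \<Rightarrow> bool" where
  "bounded_degree G \<longleftrightarrow> (\<exists>D. \<forall>n. \<forall>v\<in>verts (G n). vertex_degree (G n) v \<le> D)"

definition edges_between :: "'v graph \<Rightarrow> 'v set \<Rightarrow> 'v set \<Rightarrow> nat" where
  "edges_between G A B = (\<Sum>u\<in>A. \<Sum>v\<in>B. emult G {u, v})"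

definition expander :: "real \<Rightarrow> nat \<Rightarrow> 'v graph \<Rightarrow> bool" where
  "expander \<gamma> d H \<longleftrightarrow> finite_graph H \<and> regular_graph d H \<and>
     (\<forall>A\<subseteq>verts H. real (card A) \<le> real (card (verts H)) / 2 \<longrightarrow>
        real (edges_between H A (verts H - A)) \<ge> \<gamma> * real d * real (card A))"

definition vertex_disjoint_union :: "'v graph \<Rightarrow> 'v graph set \<Rightarrow> bool" where
  "vertex_disjoint_union G \<H> \<longleftrightarrow>
     finite \<H> \<and> disjoint_family_on verts \<H> \<and>
     verts G = (\<Union>H\<in>\<H>. verts H) \<and> (\<forall>e. emult G e = (\<Sum>H\<in>\<H>. emult H e))"

text \<open>The size of the symmetric difference of the edge multisets of two graphs on the same finite
  vertex set; subtraction of multiplicities is truncated.\<close>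

definition card_edge_sym_diff :: "'v graph \<Rightarrow> 'v graph \<Rightarrow> nat" where
  "card_edge_sym_diff G H =
     (\<Sum>e\<in>Pow (verts G \<union> verts H). (emult G e - emult H e) + (emult H e - emult G e))"

section \<open>Cayley graphs and local convergence\<close>

definition cayley_graph :: "('g, 'm) monoid_scheme \<Rightarrow> 'g set \<Rightarrow> 'g graph" where
  "cayley_graph \<Gamma> S =
     \<lparr>verts = carrier \<Gamma>,
      emult = (\<lambda>e. if \<exists>g\<in>carrier \<Gamma>. \<exists>s\<in>S. e = {g, g \<otimes>\<^bsub>\<Gamma>\<^esub> s} then 1 else 0)\<rparr>"

text \<open>The vertices at graph distance at most \<open>r\<close> from \<open>v\<close>.\<close>

primrec ball_verts :: "'v graph \<Rightarrow> 'v \<Rightarrow> nat \<Rightarrow> 'v set" where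
  "ball_verts G v 0 = {v}"
| "ball_verts G v (Suc r) =
     ball_verts G v r \<union> {w \<in> verts G. \<exists>u\<in>ball_verts G v r. emult G {u, w} > 0}"

definition induced_subgraph :: "'v graph \<Rightarrow> 'v set \<Rightarrow> 'v graph" where
  "induced_subgraph G A = \<lparr>verts = A, emult = (\<lambda>e. if e \<subseteq> A then emult G e else 0)\<rparr>"

definition ball_graph :: "'v graph \<Rightarrow> 'v \<Rightarrow> nat \<Rightarrow> 'v graph" where
  "ball_graph G v r = induced_subgraph G (ball_verts G v r)"

definition rooted_iso :: "('v \<Rightarrow> 'w) \<Rightarrow> 'v graph \<Rightarrow> 'v \<Rightarrow> 'w graph \<Rightarrow> 'w \<Rightarrow> bool" where
  "rooted_iso f G x H y \<longleftrightarrow> bij_betw f (verts G) (verts H) \<and> f x = y \<and>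
     (\<forall>u\<in>verts G. \<forall>v\<in>verts G. emult H {f u, f v} = emult G {u, v})"

definition locally_converges_to_cayley ::
    "(nat \<Rightarrow> 'v graph) \<Rightarrow> ('g, 'm) monoid_scheme \<Rightarrow> 'g set \<Rightarrow> bool" where
  "locally_converges_to_cayley G \<Gamma> S \<longleftrightarrow>
     (\<forall>r. (\<lambda>n. real (card {v \<in> verts (G n).
                 \<exists>f. rooted_iso f (ball_graph (G n) v r) v
                       (ball_graph (cayley_graph \<Gamma> S) \<one>\<^bsub>\<Gamma>\<^esub> r) \<one>\<^bsub>\<Gamma>\<^esub>})
               / real (card (verts (G n)))) \<longlonglongrightarrow> 1)"

text \<open>The edge-labeled variant. An edge label depends on the direction in which the edge is
  traversed: in the Cayley graph, the step from \<open>g\<close> to \<open>g s\<close> is labeled \<open>s\<close>. Convergence of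
  labeled graphs implies convergence of the underlying graphs, so results about the latter cover
  both.\<close>

definition locally_converges_to_labeled_cayley ::
    "(nat \<Rightarrow> 'v graph) \<Rightarrow> (nat \<Rightarrow> 'v \<Rightarrow> 'v \<Rightarrow> 'g) \<Rightarrow> ('g, 'm) monoid_scheme \<Rightarrow> 'g set \<Rightarrow> bool" where
  "locally_converges_to_labeled_cayley G lab \<Gamma> S \<longleftrightarrow>
     (\<forall>r. (\<lambda>n. real (card {v \<in> verts (G n).
                 \<exists>f. rooted_iso f (ball_graph (G n) v r) v
                       (ball_graph (cayley_graph \<Gamma> S) \<one>\<^bsub>\<Gamma>\<^esub> r) \<one>\<^bsub>\<Gamma>\<^esub> \<and>
                     (\<forall>u\<in>ball_verts (G n) v r. \<forall>w\<in>ball_verts (G n) v r.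
                        emult (G n) {u, w} > 0 \<longrightarrow> lab n u w = inv\<^bsub>\<Gamma>\<^esub> (f u) \<otimes>\<^bsub>\<Gamma>\<^esub> f w)})
               / real (card (verts (G n)))) \<longlonglongrightarrow> 1)"

lemma locally_converges_forget_labels:
  assumes fin: "\<And>n. finite (verts (G n))"
    and conv: "locally_converges_to_labeled_cayley G lab \<Gamma> S"
  shows "locally_converges_to_cayley G \<Gamma> S"
  unfolding locally_converges_to_cayley_def
proof
  fix r
  define P where "P n v f \<longleftrightarrow> rooted_iso f (ball_graph (G n) v r) v
      (ball_graph (cayley_graph \<Gamma> S) \<one>\<^bsub>\<Gamma>\<^esub> r) \<one>\<^bsub>\<Gamma>\<^esub>" for n v f
  define L where "L n v f \<longleftrightarrow> (\<forall>u\<in>ball_verts (G n) v r. \<forall>w\<in>ball_verts (G n) v r.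
      emult (G n) {u, w} > 0 \<longrightarrow> lab n u w = inv\<^bsub>\<Gamma>\<^esub> (f u) \<otimes>\<^bsub>\<Gamma>\<^esub> f w)" for n v f
  have lim: "(\<lambda>n. real (card {v \<in> verts (G n). \<exists>f. P n v f \<and> L n v f})
               / real (card (verts (G n)))) \<longlonglongrightarrow> 1"
    using conv unfolding locally_converges_to_labeled_cayley_def P_def L_def by blast
  have lower: "real (card {v \<in> verts (G n). \<exists>f. P n v f \<and> L n v f}) / real (card (verts (G n)))
      \<le> real (card {v \<in> verts (G n). \<exists>f. P n v f}) / real (card (verts (G n)))" for n
    using fin[of n] by (intro divide_right_mono of_nat_mono card_mono) auto
  have upper: "real (card {v \<in> verts (G n). \<exists>f. P n v f}) / real (card (verts (G n))) \<le> 1" for n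
  proof -
    have "card {v \<in> verts (G n). \<exists>f. P n v f} \<le> card (verts (G n))"
      using fin[of n] by (intro card_mono) auto
    then show ?thesis
      by (cases "card (verts (G n)) = 0") (simp_all add: divide_le_eq_1)
  qed
  have "(\<lambda>n. real (card {v \<in> verts (G n). \<exists>f. P n v f}) / real (card (verts (G n)))) \<longlonglongrightarrow> 1"
    by (rule tendsto_sandwich[OF _ _ lim tendsto_const]) (use lower upper in simp_all)
  then show "(\<lambda>n. real (card {v \<in> verts (G n).
                 \<exists>f. rooted_iso f (ball_graph (G n) v r) v
                       (ball_graph (cayley_graph \<Gamma> S) \<one>\<^bsub>\<Gamma>\<^esub> r) \<one>\<^bsub>\<Gamma>\<^esub>})
               / real (card (verts (G n)))) \<longlonglongrightarrow> 1"
    unfolding P_def .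
qed

end

theory Submission
  imports Defs "HOL-Analysis.Function_Topology" "HOL-Library.Function_Algebras"
    "HOL-Combinatorics.Permutations"
begin

text \<open>
  For a positive definite function \<open>\<psi>\<close> on \<open>\<Gamma>\<close>, Property (T) gives the lazy random walk \<open>P\<close> a spectral
  gap in the associated representation, hence \<open>\<parallel>v - P\<^sup>k v\<parallel>\<^sup>2 \<le> C \<langle>(1 - P) v, v\<rangle>\<close> with \<open>C\<close> independent of
  \<open>k\<close>, while \<open>\<langle>(1 - P) P\<^sup>k v, P\<^sup>k v\<rangle>\<close> decays exponentially. Both are inequalities between finitely many
  moments of \<open>\<psi>\<close>, so by compactness they hold up to a small error when \<open>\<psi>\<close> is positive definite on a large
  ball only. A function on the vertices of a graph that looks like the Cayley graph around its support
  yields such a \<open>\<psi>\<close>, by averaging over all local isomorphisms; no consistent edge labels are needed.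
  Applied to the indicator function of a set \<open>A\<close> with small boundary, a level set of \<open>P\<^sup>k 1\<^sub>A\<close> is close to
  \<open>A\<close> and has a much smaller boundary.

  Now split off, again and again, a set of minimum size that has few edges to what is left. If a
  part \<open>B\<close> had a subset \<open>A\<close> of at most half its size with few edges leaving it, smoothing
  \<open>A\<close> and intersecting with what was left when \<open>B\<close> was chosen would contradict minimality. So every
  sparse cut inside a part is paid for by edges between parts or by bad vertices, and removing few vertices makes
  all the parts expanders. The removed vertices become isolated, and loops restore the degrees.
\<close>

section \<open>Finitely supported functions and positive definite forms\<close>

text \<open>The quantifiers carry the argument: the boundary density up to which a set can be
  smoothed depends only on the group and its generators and becomes the expansion constant, while
  the density reached by smoothing is arbitrary and becomes the density of changed edges. A smaller
  target only asks for larger good neighborhoods.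

  Property (T) gives no gap on invariant vectors, and the representation attached to
  \<open>\<psi>\<close> may contain some. Instead of projecting them away, only combinations of
  translates of \<open>v\<close> with coefficient sum zero are completed. Every invariant vector is
  orthogonal to these, so this completion has none, and it contains \<open>v - P v\<close>, from
  which both moment inequalities follow.

  The kernel obtained from local isomorphisms is automatically positive, being a sum of squares; the
  difficulty is that it depend on \<open>inv x \<otimes> y\<close> only. The Cayley graph may have
  more automorphisms than translations, and those of a finite ball need not extend. Comparing them
  at different radii works once the orbits of the relevant elements have stopped shrinking as the
  radius grows.\<close>

lemma psd_cauchy_schwarz:
  fixes p q r :: real
  assumes "\<And>t. 0 \<le> p + 2 * t * q + t\<^sup>2 * r" and "0 \<le> p" and "0 \<le> r"
  shows "q\<^sup>2 \<le> p * r"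
proof (cases "r = 0")
  case True
  have "q = 0"
  proof (rule ccontr)
    assume "q \<noteq> 0"
    \<comment> \<open>This \<open>t\<close> makes the affine function \<open>p + 2 * t * q\<close>
      equal to -1.\<close>
    with assms(1)[of "- (p + 1) / (2 * q)"] True show False by (simp add: field_simps)
  qed
  then show ?thesis using True by simp
next
  case False
  with assms(3) have r: "r > 0" by simp
  have "0 \<le> p + 2 * (- q / r) * q + (- q / r)\<^sup>2 * r" by (rule assms(1))
  also have "\<dots> = p - q\<^sup>2 / r"
    using r by (simp add: field_simps power2_eq_square)
  finally show ?thesis using r by (simp add: field_simps)
qed

definition scl :: "complex \<Rightarrow> ('x \<Rightarrow> complex) \<Rightarrow> 'x \<Rightarrow> complex" where
  "scl c a = (\<lambda>x. c * a x)"

definition dirac :: "'x \<Rightarrow> 'x \<Rightarrow> complex" where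
  "dirac x = (\<lambda>y. if y = x then 1 else 0)"

text \<open>Real values and symmetry make real coefficients sufficient in the positivity axiom: for
  complex coefficients the real and the imaginary parts contribute separately
  (\<open>B_pos\<close>).\<close>

locale pos_def_function = group \<Gamma> for \<Gamma> :: "('g, 'm) monoid_scheme" (structure) +
  fixes \<psi> :: "'g \<Rightarrow> real"
  assumes psi_inv: "x \<in> carrier \<Gamma> \<Longrightarrow> \<psi> (inv x) = \<psi> x"
    and psi_pd: "\<lbrakk>finite A; A \<subseteq> carrier \<Gamma>\<rbrakk> \<Longrightarrow>
      0 \<le> (\<Sum>x\<in>A. \<Sum>y\<in>A. (c :: 'g \<Rightarrow> real) x * c y * \<psi> (inv x \<otimes> y))"
begin

definition fs :: "('g \<Rightarrow> complex) set" where
  "fs = {a. finite {x. a x \<noteq> 0} \<and> {x. a x \<noteq> 0} \<subseteq> carrier \<Gamma>}"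

text \<open>The form of the GNS construction on the group algebra: \<open>B a b\<close> is the inner
  product of the combinations of translates of one cyclic vector with coefficients \<open>a\<close>
  and \<open>b\<close>. It may be degenerate.\<close>

definition B :: "('g \<Rightarrow> complex) \<Rightarrow> ('g \<Rightarrow> complex) \<Rightarrow> complex" where
  "B a b = (\<Sum>x | a x \<noteq> 0. \<Sum>y | b y \<noteq> 0. a x * cnj (b y) * of_real (\<psi> (inv x \<otimes> y)))"

lemma B_on:
  assumes "finite A" "{x. a x \<noteq> 0} \<subseteq> A" "{x. b x \<noteq> 0} \<subseteq> A"
  shows "B a b = (\<Sum>x\<in>A. \<Sum>y\<in>A. a x * cnj (b y) * of_real (\<psi> (inv x \<otimes> y)))"
proof -
  have "B a b = (\<Sum>x | a x \<noteq> 0. \<Sum>y\<in>A. a x * cnj (b y) * of_real (\<psi> (inv x \<otimes> y)))"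
    unfolding B_def by (intro sum.cong refl sum.mono_neutral_left) (use assms in auto)
  also have "\<dots> = (\<Sum>x\<in>A. \<Sum>y\<in>A. a x * cnj (b y) * of_real (\<psi> (inv x \<otimes> y)))"
    by (intro sum.mono_neutral_left) (use assms in auto)
  finally show ?thesis .
qed

lemma fs_finite_support: "a \<in> fs \<Longrightarrow> finite {x. a x \<noteq> 0}"
  and fs_support: "a \<in> fs \<Longrightarrow> {x. a x \<noteq> 0} \<subseteq> carrier \<Gamma>"
  by (auto simp: fs_def)

lemma fs_zero [simp, intro]: "0 \<in> fs"
  by (simp add: fs_def)

lemma fs_add [simp, intro]: "a \<in> fs \<Longrightarrow> b \<in> fs \<Longrightarrow> a + b \<in> fs"
proof -
  assume "a \<in> fs" "b \<in> fs"
  moreover have "{x. (a + b) x \<noteq> 0} \<subseteq> {x. a x \<noteq> 0} \<union> {x. b x \<noteq> 0}" by auto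
  ultimately show ?thesis unfolding fs_def by (auto intro: finite_subset)
qed

lemma fs_scl [simp, intro]: "a \<in> fs \<Longrightarrow> scl c a \<in> fs"
  unfolding fs_def scl_def by (auto intro: finite_subset[of _ "{x. a x \<noteq> 0}"])

lemma scl_minus_one: "scl (- 1) a = - a"
  by (simp add: scl_def fun_eq_iff)

lemma fs_minus [simp, intro]: "a \<in> fs \<Longrightarrow> - a \<in> fs"
  using fs_scl[of a "- 1"] by (simp add: scl_minus_one)

lemma fs_diff [simp, intro]: "a \<in> fs \<Longrightarrow> b \<in> fs \<Longrightarrow> a - b \<in> fs"
  using fs_add[of a "- b"] by simp

lemma fs_dirac [simp, intro]: "x \<in> carrier \<Gamma> \<Longrightarrow> dirac x \<in> fs"
  unfolding fs_def dirac_def by auto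

lemma B_add_left: 
  assumes "a \<in> fs" "b \<in> fs" "e \<in> fs" shows "B (a + b) e = B a e + B b e"
proof -
  define A where "A = {x. a x \<noteq> 0} \<union> {x. b x \<noteq> 0} \<union> {x. e x \<noteq> 0}"
  have A: "finite A" using assms by (auto simp: A_def fs_def)
  show ?thesis
    by (subst (1 2 3) B_on[OF A]) (auto simp: A_def sum.distrib[symmetric] algebra_simps)
qed

lemma B_scl_left: 
  assumes "a \<in> fs" "e \<in> fs" shows "B (scl c a) e = c * B a e"
proof -
  define A where "A = {x. a x \<noteq> 0} \<union> {x. e x \<noteq> 0}"
  have A: "finite A" using assms by (auto simp: A_def fs_def)
  show ?thesis
    by (subst (1 2) B_on[OF A]) (auto simp: A_def scl_def sum_distrib_left algebra_simps)
qed

lemma psi_swap: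
  assumes "x \<in> carrier \<Gamma>" "y \<in> carrier \<Gamma>" shows "\<psi> (inv y \<otimes> x) = \<psi> (inv x \<otimes> y)"
  using psi_inv[of "inv x \<otimes> y"] assms by (simp add: inv_mult_group)

lemma B_cnj: 
  assumes "a \<in> fs" "e \<in> fs" shows "B e a = cnj (B a e)"
proof -
  define A where "A = {x. a x \<noteq> 0} \<union> {x. e x \<noteq> 0}"
  have A: "finite A" "A \<subseteq> carrier \<Gamma>" using assms by (auto simp: A_def fs_def)
  have "B e a = (\<Sum>x\<in>A. \<Sum>y\<in>A. e x * cnj (a y) * of_real (\<psi> (inv x \<otimes> y)))"
    by (rule B_on[OF A(1)]) (auto simp: A_def)
  also have "\<dots> = (\<Sum>x\<in>A. \<Sum>y\<in>A. e y * cnj (a x) * of_real (\<psi> (inv y \<otimes> x)))"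
    by (rule sum.swap)
  also have "\<dots> = (\<Sum>x\<in>A. \<Sum>y\<in>A. cnj (a x * cnj (e y) * of_real (\<psi> (inv x \<otimes> y))))"
    using A by (intro sum.cong refl) (auto simp: psi_swap subset_iff algebra_simps)
  also have "\<dots> = cnj (B a e)"
    by (subst B_on[OF A(1)]) (auto simp: A_def)
  finally show ?thesis .
qed

lemma B_pos: 
  assumes "a \<in> fs" shows "0 \<le> Re (B a a)"
proof -
  define A where "A = {x. a x \<noteq> 0}"
  have A: "finite A" "A \<subseteq> carrier \<Gamma>" using assms by (auto simp: A_def fs_def)
  have "Re (B a a) = (\<Sum>x\<in>A. \<Sum>y\<in>A. Re (a x) * Re (a y) * \<psi> (inv x \<otimes> y))
     + (\<Sum>x\<in>A. \<Sum>y\<in>A. Im (a x) * Im (a y) * \<psi> (inv x \<otimes> y))"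
    unfolding sum.distrib[symmetric]
    by (subst B_on[OF A(1)]) (simp_all add: A_def distrib_right)
  with psi_pd[OF A, of "\<lambda>x. Re (a x)"] psi_pd[OF A, of "\<lambda>x. Im (a x)"] show ?thesis
    by simp
qed

lemma B_add_right: "\<lbrakk>a \<in> fs; b \<in> fs; e \<in> fs\<rbrakk> \<Longrightarrow> B e (a + b) = B e a + B e b"
  using B_add_left[of a b e] B_cnj[of a e] B_cnj[of b e] B_cnj[of "a + b" e] by simp

lemma B_scl_right: "\<lbrakk>a \<in> fs; e \<in> fs\<rbrakk> \<Longrightarrow> B e (scl c a) = cnj c * B e a"
  using B_scl_left[of a e c] B_cnj[of a e] B_cnj[of "scl c a" e] by simp

lemma B_minus_left: "\<lbrakk>a \<in> fs; e \<in> fs\<rbrakk> \<Longrightarrow> B (- a) e = - B a e"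
  using B_scl_left[of a e "- 1"] by (simp add: scl_minus_one)

lemma B_minus_right: "\<lbrakk>a \<in> fs; e \<in> fs\<rbrakk> \<Longrightarrow> B e (- a) = - B e a"
  using B_scl_right[of a e "- 1"] by (simp add: scl_minus_one)

lemma B_diff_left: "\<lbrakk>a \<in> fs; b \<in> fs; e \<in> fs\<rbrakk> \<Longrightarrow> B (a - b) e = B a e - B b e"
  using B_add_left[of a "- b" e] by (simp add: B_minus_left)

lemma B_diff_right: "\<lbrakk>a \<in> fs; b \<in> fs; e \<in> fs\<rbrakk> \<Longrightarrow> B e (a - b) = B e a - B e b"
  using B_add_right[of a "- b" e] by (simp add: B_minus_right)

section \<open>The seminorm and its inequalities\<close>

definition N :: "('g \<Rightarrow> complex) \<Rightarrow> real" where "N a = sqrt (Re (B a a))"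

lemma N_nonneg [simp]: "a \<in> fs \<Longrightarrow> 0 \<le> N a"
  by (simp add: N_def B_pos)

lemma N_sq: "a \<in> fs \<Longrightarrow> (N a)\<^sup>2 = Re (B a a)"
  by (simp add: N_def B_pos)

lemma B_self: "a \<in> fs \<Longrightarrow> B a a = of_real ((N a)\<^sup>2)"
proof -
  assume a: "a \<in> fs"
  have "cnj (B a a) = B a a" using B_cnj[OF a a] by simp
  then have "Im (B a a) = 0" by (simp add: complex_eq_iff)
  then show ?thesis using N_sq[OF a] by (simp add: complex_eq_iff)
qed

lemma Re_B_sym: "a \<in> fs \<Longrightarrow> b \<in> fs \<Longrightarrow> Re (B b a) = Re (B a b)"
  by (simp add: B_cnj[of a b])

lemma N_add_sq: "a \<in> fs \<Longrightarrow> b \<in> fs \<Longrightarrow> (N (a + b))\<^sup>2 = (N a)\<^sup>2 + 2 * Re (B a b) + (N b)\<^sup>2"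
  by (simp add: N_sq B_add_left B_add_right Re_B_sym[of a b])

lemma N_diff_sq: "a \<in> fs \<Longrightarrow> b \<in> fs \<Longrightarrow> (N (a - b))\<^sup>2 = (N a)\<^sup>2 - 2 * Re (B a b) + (N b)\<^sup>2"
  by (simp add: N_sq B_diff_left B_diff_right Re_B_sym[of a b])

lemma N_scl:
  assumes a: "a \<in> fs" shows "N (scl c a) = cmod c * N a"
proof (rule power2_eq_imp_eq)
  have "B (scl c a) (scl c a) = (c * cnj c) * B a a"
    using a by (simp add: B_scl_left B_scl_right mult.assoc)
  also have "\<dots> = of_real ((cmod c)\<^sup>2) * of_real ((N a)\<^sup>2)"
    by (simp only: B_self[OF a] complex_norm_square)
  finally have "Re (B (scl c a) (scl c a)) = (cmod c)\<^sup>2 * (N a)\<^sup>2"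
    by (simp only: of_real_mult[symmetric] Re_complex_of_real)
  then show "(N (scl c a))\<^sup>2 = (cmod c * N a)\<^sup>2"
    using a by (simp add: N_sq power_mult_distrib)
qed (use a in auto)

lemma Re_B_sq_le: 
  assumes "a \<in> fs" "b \<in> fs" shows "(Re (B a b))\<^sup>2 \<le> (N a)\<^sup>2 * (N b)\<^sup>2"
proof (rule psd_cauchy_schwarz)
  fix t :: real
  have "0 \<le> (N (a + scl (of_real t) b))\<^sup>2" by simp
  also have "\<dots> = (N a)\<^sup>2 + 2 * t * Re (B a b) + t\<^sup>2 * (N b)\<^sup>2"
    using assms N_add_sq[of a "scl (of_real t) b"] N_scl[of b "of_real t"] B_scl_right[of b a "of_real t"]
    by (simp add: power_mult_distrib)
  finally show "0 \<le> (N a)\<^sup>2 + 2 * t * Re (B a b) + t\<^sup>2 * (N b)\<^sup>2" .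
qed auto

lemma Re_B_le:
  assumes "a \<in> fs" "b \<in> fs" shows "\<bar>Re (B a b)\<bar> \<le> N a * N b"
  by (rule power2_le_imp_le) (use Re_B_sq_le[OF assms] assms in \<open>auto simp: power_mult_distrib\<close>)

lemma cmod_B_le: 
  assumes "a \<in> fs" "b \<in> fs" shows "cmod (B a b) \<le> N a * N b"
proof (cases "B a b = 0")
  case True then show ?thesis using assms by simp
next
  case False
  \<comment> \<open>The phase \<open>u\<close> makes \<open>B (scl u a) b\<close> real and
    nonnegative, which reduces the claim to real parts.\<close>
  define u where "u = cnj (B a b) / cmod (B a b)"
  have "u * B a b = cmod (B a b)"
    using False complex_norm_square[of "B a b"]
    by (simp add: u_def mult.commute power2_eq_square nonzero_divide_eq_eq)
  then have "cmod (B a b) = Re (B (scl u a) b)" using assms by (simp add: B_scl_left)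
  also have "\<dots> \<le> N (scl u a) * N b" using Re_B_le[of "scl u a" b] assms by simp
  also have "\<dots> = N a * N b" using assms False by (simp add: N_scl u_def norm_divide)
  finally show ?thesis .
qed

lemma N_triangle:
  assumes "a \<in> fs" "b \<in> fs" shows "N (a + b) \<le> N a + N b"
  by (rule power2_le_imp_le) (use Re_B_le[OF assms] assms in \<open>auto simp: N_add_sq power2_sum\<close>)

lemma N_minus: "a \<in> fs \<Longrightarrow> N (- a) = N a"
  using N_scl[of a "- 1"] by (simp add: scl_minus_one)

lemma N_diff_commute: "a \<in> fs \<Longrightarrow> b \<in> fs \<Longrightarrow> N (a - b) = N (b - a)"
  using N_minus[of "a - b"] by simp

lemma N_triangle3: "\<lbrakk>a \<in> fs; b \<in> fs; e \<in> fs\<rbrakk> \<Longrightarrow> N (a - e) \<le> N (a - b) + N (b - e)"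
  using N_triangle[of "a - b" "b - e"] by simp


lemma N_diff_abs:
  assumes "a \<in> fs" "b \<in> fs" shows "\<bar>N a - N b\<bar> \<le> N (a - b)"
  using N_triangle[of "a - b" b] N_triangle[of "b - a" a] N_diff_commute[of a b] assms by auto

section \<open>Coefficient sums and left translations\<close>

definition total :: "('g \<Rightarrow> complex) \<Rightarrow> complex" where
  "total a = (\<Sum>x | a x \<noteq> 0. a x)"

lemma total_on: "finite A \<Longrightarrow> {x. a x \<noteq> 0} \<subseteq> A \<Longrightarrow> total a = (\<Sum>x\<in>A. a x)"
  unfolding total_def by (intro sum.mono_neutral_left) auto

lemma total_add:
  assumes "a \<in> fs" "b \<in> fs" shows "total (a + b) = total a + total b"
proof -
  define A where "A = {x. a x \<noteq> 0} \<union> {x. b x \<noteq> 0}"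
  have A: "finite A" using assms by (auto simp: A_def fs_def)
  show ?thesis
    by (subst (1 2 3) total_on[OF A]) (auto simp: A_def sum.distrib)
qed

lemma total_scl:
  assumes "a \<in> fs" shows "total (scl c a) = c * total a"
  using assms by (subst (1 2) total_on[of "{x. a x \<noteq> 0}"]) (auto simp: fs_def scl_def sum_distrib_left)

lemma total_dirac [simp]: "total (dirac x) = 1"
  by (subst total_on[of "{x}"]) (auto simp: dirac_def)

text \<open>The augmentation ideal. An invariant vector pairs with every translate of the cyclic
  vector in the same way, hence trivially with combinations of total 0; this excludes invariant
  vectors from the completion of \<open>E0\<close>.\<close>

definition E0 :: "('g \<Rightarrow> complex) set" where
  "E0 = {a \<in> fs. total a = 0}"

lemma E0_fs: "a \<in> E0 \<Longrightarrow> a \<in> fs" by (simp add: E0_def)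

lemma E0_zero [simp, intro]: "0 \<in> E0" by (simp add: E0_def total_def)

lemma E0_add [simp, intro]: "a \<in> E0 \<Longrightarrow> b \<in> E0 \<Longrightarrow> a + b \<in> E0"
  by (simp add: E0_def total_add)

lemma E0_scl [simp, intro]: "a \<in> E0 \<Longrightarrow> scl c a \<in> E0"
  by (simp add: E0_def total_scl)

lemma E0_minus [simp, intro]: "a \<in> E0 \<Longrightarrow> - a \<in> E0"
  using E0_scl[of a "- 1"] by (simp add: scl_minus_one)

lemma E0_diff [simp, intro]: "a \<in> E0 \<Longrightarrow> b \<in> E0 \<Longrightarrow> a - b \<in> E0"
  using E0_add[of a "- b"] by simp

definition shift :: "'g \<Rightarrow> ('g \<Rightarrow> complex) \<Rightarrow> 'g \<Rightarrow> complex" where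
  "shift g a = (\<lambda>x. if x \<in> carrier \<Gamma> then a (inv g \<otimes> x) else 0)"

lemma shift_support:
  assumes "g \<in> carrier \<Gamma>" "a \<in> fs"
  shows "{x. shift g a x \<noteq> 0} = (\<lambda>x. g \<otimes> x) ` {x. a x \<noteq> 0}"
proof (intro equalityI subsetI)
  fix x assume "x \<in> {x. shift g a x \<noteq> 0}"
  then have "x \<in> carrier \<Gamma>" "a (inv g \<otimes> x) \<noteq> 0" by (auto simp: shift_def split: if_splits)
  moreover have "x = g \<otimes> (inv g \<otimes> x)"
    using assms calculation by (simp add: m_assoc[symmetric])
  ultimately show "x \<in> (\<lambda>x. g \<otimes> x) ` {x. a x \<noteq> 0}" by blast
next
  fix x assume "x \<in> (\<lambda>x. g \<otimes> x) ` {x. a x \<noteq> 0}"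
  then obtain y where y: "x = g \<otimes> y" "a y \<noteq> 0" by blast
  with assms have "y \<in> carrier \<Gamma>" by (auto simp: fs_def)
  with y assms show "x \<in> {x. shift g a x \<noteq> 0}"
    by (simp add: shift_def m_assoc[symmetric])
qed

lemma inj_on_translate: "g \<in> carrier \<Gamma> \<Longrightarrow> A \<subseteq> carrier \<Gamma> \<Longrightarrow> inj_on (\<lambda>x. g \<otimes> x) A"
  using inj_on_cmult inj_on_subset by blast

lemma shift_fs [simp, intro]: "g \<in> carrier \<Gamma> \<Longrightarrow> a \<in> fs \<Longrightarrow> shift g a \<in> fs"
  using fs_finite_support[of a] fs_support[of a] by (subst fs_def) (auto simp: shift_support)

lemma shift_apply: "\<lbrakk>g \<in> carrier \<Gamma>; x \<in> carrier \<Gamma>\<rbrakk> \<Longrightarrow> shift g a (g \<otimes> x) = a x"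
  by (simp add: shift_def m_assoc[symmetric])

lemma B_shift:
  assumes "g \<in> carrier \<Gamma>" "a \<in> fs" "b \<in> fs"
  shows "B (shift g a) (shift g b) = B a b"
proof -
  have *: "inv (g \<otimes> x) \<otimes> (g \<otimes> y) = inv x \<otimes> y" if "x \<in> carrier \<Gamma>" "y \<in> carrier \<Gamma>" for x y
    using assms(1) that by (simp add: inv_mult_group m_assoc) (simp add: m_assoc[symmetric])
  have c: "x \<in> carrier \<Gamma>" if "a x \<noteq> 0 \<or> b x \<noteq> 0" for x using that assms by (auto simp: fs_def)
  show ?thesis
    unfolding B_def shift_support[OF assms(1,2)] shift_support[OF assms(1,3)]
    by (subst (1 2) sum.reindex) (auto intro!: inj_on_translate sum.cong simp: assms c * shift_apply)
qed

lemma N_shift: "g \<in> carrier \<Gamma> \<Longrightarrow> a \<in> fs \<Longrightarrow> N (shift g a) = N a"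
  by (simp add: N_def B_shift)

lemma total_shift:
  assumes "g \<in> carrier \<Gamma>" "a \<in> fs" shows "total (shift g a) = total a"
proof -
  have c: "x \<in> carrier \<Gamma>" if "a x \<noteq> 0" for x using that assms by (auto simp: fs_def)
  show ?thesis
    unfolding total_def shift_support[OF assms]
    by (subst sum.reindex) (auto intro!: inj_on_translate sum.cong simp: assms c shift_apply)
qed

lemma shift_E0 [simp, intro]: "g \<in> carrier \<Gamma> \<Longrightarrow> a \<in> E0 \<Longrightarrow> shift g a \<in> E0"
  by (simp add: E0_def total_shift)

lemma shift_add: "shift g (a + b) = shift g a + shift g b"
  by (auto simp: shift_def)

lemma shift_diff: "shift g (a - b) = shift g a - shift g b"
  by (auto simp: shift_def)

lemma shift_scl: "shift g (scl c a) = scl c (shift g a)"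
  by (auto simp: shift_def scl_def)

lemma shift_one: "a \<in> fs \<Longrightarrow> shift \<one> a = a"
  using fs_support[of a] by (auto simp: shift_def fun_eq_iff)

lemma shift_mult: "\<lbrakk>g \<in> carrier \<Gamma>; h \<in> carrier \<Gamma>\<rbrakk> \<Longrightarrow> shift g (shift h a) = shift (g \<otimes> h) a"
  by (auto simp: shift_def inv_mult_group m_assoc)

lemma shift_dirac:
  assumes "g \<in> carrier \<Gamma>" "x \<in> carrier \<Gamma>" shows "shift g (dirac x) = dirac (g \<otimes> x)"
proof -
  have "inv g \<otimes> y = x \<longleftrightarrow> y = g \<otimes> x" if "y \<in> carrier \<Gamma>" for y
    using inv_solve_left[of x g y] assms that by metis
  then show ?thesis using assms by (auto simp: shift_def dirac_def fun_eq_iff)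
qed

text \<open>The point masses span \<open>fs\<close>, so the pairings of a vector with them determine
  all its pairings. This is what makes the encoding \<open>J\<close> below faithful.\<close>

lemma B_expand:
  assumes "a \<in> fs" "e \<in> fs"
  shows "B a e = (\<Sum>y | e y \<noteq> 0. cnj (e y) * B a (dirac y))"
proof -
  have "B a (dirac y) = (\<Sum>x | a x \<noteq> 0. a x * of_real (\<psi> (inv x \<otimes> y)))" for y
  proof -
    have "{z. dirac y z \<noteq> 0} = {y}" by (auto simp: dirac_def)
    then show ?thesis by (simp add: B_def dirac_def)
  qed
  then show ?thesis
    unfolding B_def by (subst sum.swap) (simp add: sum_distrib_left algebra_simps)
qed

end

section \<open>The Hilbert space of a positive definite function\<close>

context pos_def_function
begin

text \<open>The parameter \<open>V\<close> serves two spaces: the vectors to be completed come from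
  \<open>E0\<close>, while the point masses they are tested against have total 1 and lie only in
  \<open>fs\<close>.\<close>

definition cauchy_in :: "('g \<Rightarrow> complex) set \<Rightarrow> (nat \<Rightarrow> 'g \<Rightarrow> complex) set" where
  "cauchy_in V = {a. (\<forall>n. a n \<in> V) \<and> (\<forall>e>0. \<exists>M. \<forall>m\<ge>M. \<forall>n\<ge>M. N (a m - a n) < e)}"

lemma cauchy_in_E0: "a \<in> cauchy_in E0 \<Longrightarrow> a \<in> cauchy_in fs"
  by (auto simp: cauchy_in_def E0_fs)

lemma cauchy_in_mem: "a \<in> cauchy_in V \<Longrightarrow> a n \<in> V"
  by (auto simp: cauchy_in_def)

lemma cauchy_inD: "a \<in> cauchy_in V \<Longrightarrow> 0 < e \<Longrightarrow> \<exists>M. \<forall>m\<ge>M. \<forall>n\<ge>M. N (a m - a n) < e"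
  by (auto simp: cauchy_in_def)

lemma N_zero [simp]: "N 0 = 0"
  by (simp add: N_def B_def)

lemma N_zero_fun [simp]: "N (\<lambda>_. 0) = 0"
  by (simp add: N_def B_def)

lemma cauchy_const: "e \<in> V \<Longrightarrow> (\<lambda>_. e) \<in> cauchy_in V"
  by (simp add: cauchy_in_def)

lemma cauchy_add:
  assumes a: "a \<in> cauchy_in E0" and b: "b \<in> cauchy_in E0"
  shows "(\<lambda>n. a n + b n) \<in> cauchy_in E0"
  unfolding cauchy_in_def
proof (intro CollectI conjI allI impI)
  fix e :: real assume e: "0 < e"
  obtain M1 where M1: "\<forall>m\<ge>M1. \<forall>n\<ge>M1. N (a m - a n) < e / 2" using cauchy_inD[OF a, of "e / 2"] e by auto
  obtain M2 where M2: "\<forall>m\<ge>M2. \<forall>n\<ge>M2. N (b m - b n) < e / 2" using cauchy_inD[OF b, of "e / 2"] e by auto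
  have mem: "a m \<in> fs" "b m \<in> fs" for m
    using a b by (auto intro: cauchy_in_mem E0_fs)
  show "\<exists>M. \<forall>m\<ge>M. \<forall>n\<ge>M. N (a m + b m - (a n + b n)) < e"
  proof (intro exI[of _ "max M1 M2"] allI impI)
    fix m n assume "max M1 M2 \<le> m" "max M1 M2 \<le> n"
    then have "N (a m - a n) < e / 2" "N (b m - b n) < e / 2" using M1 M2 by auto
    moreover have "N ((a m - a n) + (b m - b n)) \<le> N (a m - a n) + N (b m - b n)"
      using mem by (intro N_triangle) auto
    moreover have "(a m - a n) + (b m - b n) = a m + b m - (a n + b n)" by simp
    ultimately show "N (a m + b m - (a n + b n)) < e" by simp
  qed
qed (use a b in \<open>auto intro: cauchy_in_mem\<close>)

lemma scl_diff: "scl c (a - b) = scl c a - scl c b"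
  by (auto simp: scl_def algebra_simps)

lemma cauchy_scl:
  assumes a: "a \<in> cauchy_in E0"
  shows "(\<lambda>n. scl c (a n)) \<in> cauchy_in E0"
  unfolding cauchy_in_def
proof (intro CollectI conjI allI impI)
  fix e :: real assume e: "0 < e"
  have p: "0 < cmod c + 1" by (simp add: add_nonneg_pos)
  obtain M1 where M1: "\<forall>m\<ge>M1. \<forall>n\<ge>M1. N (a m - a n) < e / (cmod c + 1)"
    using cauchy_inD[OF a, of "e / (cmod c + 1)"] e p by auto
  have mem: "a m \<in> fs" for m
    using a by (auto intro: cauchy_in_mem E0_fs)
  show "\<exists>M. \<forall>m\<ge>M. \<forall>n\<ge>M. N (scl c (a m) - scl c (a n)) < e"
  proof (intro exI[of _ M1] allI impI)
    fix m n assume "M1 \<le> m" "M1 \<le> n"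
    then have "(cmod c + 1) * N (a m - a n) < e" using M1 p by (auto simp: field_simps)
    moreover have "cmod c * N (a m - a n) \<le> (cmod c + 1) * N (a m - a n)"
      using mem by (intro mult_right_mono) auto
    ultimately show "N (scl c (a m) - scl c (a n)) < e"
      using mem by (simp add: scl_diff[symmetric] N_scl)
  qed
qed (use a in \<open>auto intro: cauchy_in_mem\<close>)

lemma cauchy_minus: "a \<in> cauchy_in E0 \<Longrightarrow> (\<lambda>n. - a n) \<in> cauchy_in E0"
  using cauchy_scl[of a "- 1"] by (simp add: scl_minus_one)

lemma cauchy_diff: "a \<in> cauchy_in E0 \<Longrightarrow> b \<in> cauchy_in E0 \<Longrightarrow> (\<lambda>n. a n - b n) \<in> cauchy_in E0"
  using cauchy_add[of a "\<lambda>n. - b n"] by (simp add: cauchy_minus)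

lemma cauchy_shift: "g \<in> carrier \<Gamma> \<Longrightarrow> a \<in> cauchy_in E0 \<Longrightarrow> (\<lambda>n. shift g (a n)) \<in> cauchy_in E0"
  by (auto simp: cauchy_in_def shift_diff[symmetric] N_shift E0_fs)

lemma cauchy_bounded:
  assumes "a \<in> cauchy_in fs" shows "\<exists>K>0. \<forall>n. N (a n) \<le> K"
proof -
  have mem: "a m \<in> fs" for m using assms by (auto intro: cauchy_in_mem)
  have "Cauchy (\<lambda>n. N (a n))"
    unfolding Cauchy_def
  proof (intro allI impI)
    fix e :: real assume "0 < e"
    then obtain M where M: "\<forall>m\<ge>M. \<forall>n\<ge>M. N (a m - a n) < e" using cauchy_inD[OF assms] by blast
    show "\<exists>M. \<forall>m\<ge>M. \<forall>n\<ge>M. dist (N (a m)) (N (a n)) < e"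
    proof (intro exI[of _ M] allI impI)
      fix m n assume "M \<le> m" "M \<le> n"
      then have "N (a m - a n) < e" using M by blast
      then show "dist (N (a m)) (N (a n)) < e"
        using N_diff_abs[OF mem mem, of m n] by (simp add: dist_real_def)
    qed
  qed
  then have "Bseq (\<lambda>n. N (a n))" by (rule Cauchy_Bseq)
  then obtain K where "K > 0" "\<forall>n. norm (N (a n)) \<le> K" by (auto simp: Bseq_def)
  then show ?thesis by (auto simp: abs_le_iff intro!: exI[of _ K])
qed

section \<open>Limits of the form along Cauchy sequences\<close>

definition L :: "(nat \<Rightarrow> 'g \<Rightarrow> complex) \<Rightarrow> (nat \<Rightarrow> 'g \<Rightarrow> complex) \<Rightarrow> complex" where
  "L a b = lim (\<lambda>n. B (a n) (b n))"

lemma L_lim: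
  assumes a: "a \<in> cauchy_in fs" and b: "b \<in> cauchy_in fs"
  shows "(\<lambda>n. B (a n) (b n)) \<longlonglongrightarrow> L a b"
proof -
  have mem: "a m \<in> fs" "b m \<in> fs" for m using assms by (auto intro: cauchy_in_mem)
  obtain K1 where K1: "K1 > 0" "\<forall>n. N (a n) \<le> K1" using cauchy_bounded[OF a] by blast
  obtain K2 where K2: "K2 > 0" "\<forall>n. N (b n) \<le> K2" using cauchy_bounded[OF b] by blast
  have "Cauchy (\<lambda>n. B (a n) (b n))"
    unfolding Cauchy_def
  proof (intro allI impI)
    fix e :: real assume e: "0 < e"
    obtain M1 where M1: "\<forall>m\<ge>M1. \<forall>n\<ge>M1. N (a m - a n) < e / (2 * K2)"
      using cauchy_inD[OF a, of "e / (2 * K2)"] e K2 by auto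
    obtain M2 where M2: "\<forall>m\<ge>M2. \<forall>n\<ge>M2. N (b m - b n) < e / (2 * K1)"
      using cauchy_inD[OF b, of "e / (2 * K1)"] e K1 by auto
    show "\<exists>M. \<forall>m\<ge>M. \<forall>n\<ge>M. dist (B (a m) (b m)) (B (a n) (b n)) < e"
    proof (intro exI[of _ "max M1 M2"] allI impI)
      fix m n assume mn: "max M1 M2 \<le> m" "max M1 M2 \<le> n"
      have "B (a m) (b m) - B (a n) (b n) = B (a m - a n) (b m) + B (a n) (b m - b n)"
        using mem by (simp add: B_diff_left B_diff_right)
      then have "dist (B (a m) (b m)) (B (a n) (b n)) \<le> cmod (B (a m - a n) (b m)) + cmod (B (a n) (b m - b n))"
        by (simp add: dist_norm norm_triangle_ineq)
      also have "\<dots> \<le> N (a m - a n) * N (b m) + N (a n) * N (b m - b n)"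
        using mem by (intro add_mono cmod_B_le) auto
      also have "\<dots> \<le> N (a m - a n) * K2 + K1 * N (b m - b n)"
        using mem K1 K2 by (intro add_mono mult_left_mono mult_right_mono) auto
      also have "\<dots> < e / 2 + e / 2"
      proof (rule add_strict_mono)
        show "N (a m - a n) * K2 < e / 2" using M1 mn K2 by (auto simp: field_simps)
        show "K1 * N (b m - b n) < e / 2" using M2 mn K1 by (auto simp: field_simps)
      qed
      finally show "dist (B (a m) (b m)) (B (a n) (b n)) < e" by simp
    qed
  qed
  then have "convergent (\<lambda>n. B (a n) (b n))" by (rule Cauchy_convergent)
  then show ?thesis unfolding L_def by (simp add: convergent_LIMSEQ_iff)
qed

lemma L_eqI: "\<lbrakk>a \<in> cauchy_in fs; b \<in> cauchy_in fs; (\<lambda>n. B (a n) (b n)) \<longlonglongrightarrow> l\<rbrakk> \<Longrightarrow> L a b = l"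
  using L_lim LIMSEQ_unique by blast

lemmas E0_seq = cauchy_in_mem[THEN E0_fs]

lemma L_add_left:
  assumes "a \<in> cauchy_in E0" "b \<in> cauchy_in E0" "e \<in> cauchy_in fs"
  shows "L (\<lambda>n. a n + b n) e = L a e + L b e"
proof (rule L_eqI)
  have "(\<lambda>n. B (a n) (e n) + B (b n) (e n)) \<longlonglongrightarrow> L a e + L b e"
    using assms by (intro tendsto_add L_lim) (auto intro: cauchy_in_E0)
  then show "(\<lambda>n. B (a n + b n) (e n)) \<longlonglongrightarrow> L a e + L b e"
    using assms by (simp add: B_add_left E0_seq cauchy_in_mem)
qed (use assms in \<open>auto intro: cauchy_in_E0 cauchy_add\<close>)

lemma L_scl_left:
  assumes "a \<in> cauchy_in E0" "e \<in> cauchy_in fs"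
  shows "L (\<lambda>n. scl c (a n)) e = c * L a e"
proof (rule L_eqI)
  have "(\<lambda>n. c * B (a n) (e n)) \<longlonglongrightarrow> c * L a e"
    using assms by (intro tendsto_mult tendsto_const L_lim) (auto intro: cauchy_in_E0)
  then show "(\<lambda>n. B (scl c (a n)) (e n)) \<longlonglongrightarrow> c * L a e"
    using assms by (simp add: B_scl_left E0_seq cauchy_in_mem)
qed (use assms in \<open>auto intro: cauchy_in_E0 cauchy_scl\<close>)

lemma L_cnj:
  assumes "a \<in> cauchy_in fs" "e \<in> cauchy_in fs"
  shows "L e a = cnj (L a e)"
proof (rule L_eqI)
  have "(\<lambda>n. cnj (B (a n) (e n))) \<longlonglongrightarrow> cnj (L a e)"
    using assms by (intro tendsto_cnj L_lim)
  then show "(\<lambda>n. B (e n) (a n)) \<longlonglongrightarrow> cnj (L a e)"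
    using B_cnj[OF cauchy_in_mem[OF assms(1)] cauchy_in_mem[OF assms(2)]] by simp
qed (use assms in auto)

lemma N_lim: "a \<in> cauchy_in fs \<Longrightarrow> (\<lambda>n. N (a n)) \<longlonglongrightarrow> sqrt (Re (L a a))"
  unfolding N_def by (intro tendsto_intros L_lim)

lemma L_expand:
  assumes "a \<in> cauchy_in E0" "e \<in> fs"
  shows "L a (\<lambda>_. e) = (\<Sum>y | e y \<noteq> 0. cnj (e y) * L a (\<lambda>_. dirac y))"
proof (rule L_eqI)
  have "(\<lambda>n. \<Sum>y | e y \<noteq> 0. cnj (e y) * B (a n) (dirac y)) \<longlonglongrightarrow> (\<Sum>y | e y \<noteq> 0. cnj (e y) * L a (\<lambda>_. dirac y))"
    using assms fs_support[of e]
    by (intro tendsto_sum tendsto_mult tendsto_const L_lim cauchy_const) (auto intro: cauchy_in_E0)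
  then show "(\<lambda>n. B (a n) e) \<longlonglongrightarrow> (\<Sum>y | e y \<noteq> 0. cnj (e y) * L a (\<lambda>_. dirac y))"
    using B_expand[OF E0_seq[OF assms(1)] assms(2)] by simp
qed (use assms in \<open>auto intro: cauchy_in_E0 cauchy_const\<close>)

text \<open>The sequence is tested against its own late terms: if \<open>K\<close> bounds the norms
  and \<open>a n\<close> is within \<open>d / K\<close> of \<open>a M\<close>, then
  \<open>Re (B (a n) (a n))\<close> exceeds \<open>Re (B (a n) (a M))\<close> by at most
  \<open>d\<close>, and the latter tends to 0.\<close>

lemma null_seq:
  assumes a: "a \<in> cauchy_in E0" and z: "\<And>e. e \<in> E0 \<Longrightarrow> L a (\<lambda>_. e) = 0"
  shows "(\<lambda>n. N (a n)) \<longlonglongrightarrow> 0"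
proof -
  have af: "a \<in> cauchy_in fs" using a by (rule cauchy_in_E0)
  have mem: "a m \<in> fs" for m using a by (rule E0_seq)
  obtain K where K: "K > 0" "\<forall>n. N (a n) \<le> K" using cauchy_bounded[OF af] by blast
  have "Re (L a a) \<le> 0 + d" if d: "d > 0" for d
  proof -
    obtain M where M: "\<forall>m\<ge>M. \<forall>n\<ge>M. N (a m - a n) < d / K"
      using cauchy_inD[OF a, of "d / K"] d K by auto
    have "(\<lambda>n. Re (B (a n) (a M)) + d) \<longlonglongrightarrow> Re (L a (\<lambda>_. a M)) + d"
      using af mem by (intro tendsto_intros L_lim cauchy_const) auto
    moreover have "L a (\<lambda>_. a M) = 0" using z a cauchy_in_mem by blast
    moreover have "(\<lambda>n. Re (B (a n) (a n))) \<longlonglongrightarrow> Re (L a a)"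
      using af by (intro tendsto_intros L_lim)
    moreover have "\<exists>M'. \<forall>n\<ge>M'. Re (B (a n) (a n)) \<le> Re (B (a n) (a M)) + d"
    proof (intro exI[of _ M] allI impI)
      fix n assume n: "M \<le> n"
      have "Re (B (a n) (a n)) - Re (B (a n) (a M)) = Re (B (a n) (a n - a M))"
        using mem by (simp add: B_diff_right)
      also have "\<dots> \<le> N (a n) * N (a n - a M)"
        using Re_B_le[of "a n" "a n - a M"] mem by auto
      also have "\<dots> \<le> K * (d / K)"
        using K M n mem by (intro mult_mono) (auto intro: less_imp_le)
      finally show "Re (B (a n) (a n)) \<le> Re (B (a n) (a M)) + d" using K by simp
    qed
    ultimately show ?thesis by (intro LIMSEQ_le) auto
  qed
  then have "Re (L a a) \<le> 0" by (rule field_le_epsilon)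
  moreover have "0 \<le> sqrt (Re (L a a))"
    using N_lim[OF af] mem by (intro LIMSEQ_le_const) auto
  ultimately have "sqrt (Re (L a a)) = 0" by simp
  then show ?thesis using N_lim[OF af] by simp
qed

text \<open>Evaluating a vector against the point masses turns it into a function on the group, so the
  completion can be carried by a subset of \<^typ>\<open>'g \<Rightarrow> complex\<close>.\<close>

definition J :: "(nat \<Rightarrow> 'g \<Rightarrow> complex) \<Rightarrow> 'g \<Rightarrow> complex" where
  "J a = (\<lambda>x. if x \<in> carrier \<Gamma> then L a (\<lambda>_. dirac x) else 0)"

lemma J_add: "a \<in> cauchy_in E0 \<Longrightarrow> b \<in> cauchy_in E0 \<Longrightarrow> J (\<lambda>n. a n + b n) = J a + J b"
  by (auto simp: J_def L_add_left cauchy_const)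

lemma J_scl: "a \<in> cauchy_in E0 \<Longrightarrow> J (\<lambda>n. scl c (a n)) = scl c (J a)"
  by (auto simp: J_def L_scl_left cauchy_const scl_def[of c "\<lambda>x. if x \<in> carrier \<Gamma> then L a (\<lambda>_. dirac x) else 0"])

lemma J_minus: "a \<in> cauchy_in E0 \<Longrightarrow> J (\<lambda>n. - a n) = - J a"
  using J_scl[of a "- 1"] by (simp add: scl_minus_one)

lemma J_diff: "a \<in> cauchy_in E0 \<Longrightarrow> b \<in> cauchy_in E0 \<Longrightarrow> J (\<lambda>n. a n - b n) = J a - J b"
  using J_add[of a "\<lambda>n. - b n"] by (simp add: cauchy_minus J_minus)

lemma J_shift:
  assumes g: "g \<in> carrier \<Gamma>" and a: "a \<in> cauchy_in E0"
  shows "J (\<lambda>n. shift g (a n)) = shift g (J a)"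
proof
  fix x
  show "J (\<lambda>n. shift g (a n)) x = shift g (J a) x"
  proof (cases "x \<in> carrier \<Gamma>")
    case x: True
    have "B (shift g (a n)) (dirac x) = B (a n) (dirac (inv g \<otimes> x))" for n
    proof -
      have "shift g (dirac (inv g \<otimes> x)) = dirac x"
        using g x by (simp add: shift_dirac m_assoc[symmetric])
      then show ?thesis using B_shift[OF g E0_seq[OF a], of "dirac (inv g \<otimes> x)"] g x by simp
    qed
    then have "L (\<lambda>n. shift g (a n)) (\<lambda>_. dirac x) = L a (\<lambda>_. dirac (inv g \<otimes> x))"
      by (simp add: L_def)
    then show ?thesis using g x by (simp add: J_def shift_def)
  qed (simp add: J_def shift_def)
qed

text \<open>Injectivity of \<open>J\<close> up to null sequences: vanishing against point masses
  means vanishing against all of \<open>E0\<close>, because point masses span.\<close>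

lemma J_null:
  assumes a: "a \<in> cauchy_in E0" and z: "J a = 0"
  shows "(\<lambda>n. N (a n)) \<longlonglongrightarrow> 0"
proof (rule null_seq[OF a])
  fix e assume e: "e \<in> E0"
  have "L a (\<lambda>_. dirac y) = 0" if "y \<in> carrier \<Gamma>" for y
    using fun_cong[OF z, of y] that by (simp add: J_def)
  then show "L a (\<lambda>_. e) = 0"
    using L_expand[OF a E0_fs[OF e]] fs_support[OF E0_fs[OF e]] by (auto intro!: sum.neutral)
qed

lemma L_null:
  assumes "a \<in> cauchy_in fs" "b \<in> cauchy_in fs" and z: "(\<lambda>n. N (a n)) \<longlonglongrightarrow> 0"
  shows "L a b = 0"
proof (rule L_eqI)
  obtain K where K: "K > 0" "\<forall>n. N (b n) \<le> K" using cauchy_bounded[OF assms(2)] by blast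
  have "(\<lambda>n. N (a n) * K) \<longlonglongrightarrow> 0" using tendsto_mult_right_zero[OF z, of K] by (simp add: mult.commute)
  moreover have "norm (B (a n) (b n)) \<le> N (a n) * K" for n
  proof -
    have "norm (B (a n) (b n)) \<le> N (a n) * N (b n)"
      using assms by (intro cmod_B_le) (auto intro: cauchy_in_mem)
    also have "\<dots> \<le> N (a n) * K" using K N_nonneg[OF cauchy_in_mem[OF assms(1)]] by (intro mult_left_mono) auto
    finally show ?thesis .
  qed
  ultimately have "(\<lambda>n. norm (B (a n) (b n))) \<longlonglongrightarrow> 0"
    by (auto intro: tendsto_sandwich[OF _ _ tendsto_const, of _ _ sequentially "\<lambda>n. N (a n) * K"])
  then show "(\<lambda>n. B (a n) (b n)) \<longlonglongrightarrow> 0" by (rule tendsto_norm_zero_cancel)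
qed (use assms in auto)

lemma L_diff_left:
  assumes "a \<in> cauchy_in E0" "b \<in> cauchy_in E0" "e \<in> cauchy_in fs"
  shows "L (\<lambda>n. a n - b n) e = L a e - L b e"
proof -
  have "L (\<lambda>n. - b n) e = - L b e"
    using L_scl_left[OF assms(2,3), of "- 1"] by (simp add: scl_minus_one)
  then show ?thesis using L_add_left[OF assms(1) cauchy_minus[OF assms(2)] assms(3)] by simp
qed

lemma L_cong:
  assumes "a \<in> cauchy_in E0" "a' \<in> cauchy_in E0" "b \<in> cauchy_in fs" "J a = J a'"
  shows "L a b = L a' b"
proof -
  have "L (\<lambda>n. a n - a' n) b = 0"
    using assms by (intro L_null J_null) (auto simp: J_diff intro: cauchy_diff cauchy_in_E0)
  then show ?thesis using L_diff_left[OF assms(1-3)] by simp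
qed

section \<open>The inner product on the completed space\<close>

definition HS :: "('g \<Rightarrow> complex) set" where "HS = J ` cauchy_in E0"

definition lift :: "('g \<Rightarrow> complex) \<Rightarrow> nat \<Rightarrow> 'g \<Rightarrow> complex" where
  "lift F = (SOME a. a \<in> cauchy_in E0 \<and> J a = F)"

definition ip :: "('g \<Rightarrow> complex) \<Rightarrow> ('g \<Rightarrow> complex) \<Rightarrow> complex" where
  "ip F F' = L (lift F) (lift F')"

lemma lift:
  assumes "F \<in> HS" shows "lift F \<in> cauchy_in E0" "J (lift F) = F"
proof -
  have "\<exists>a. a \<in> cauchy_in E0 \<and> J a = F" using assms by (auto simp: HS_def)
  from someI_ex[OF this] show "lift F \<in> cauchy_in E0" "J (lift F) = F" by (auto simp: lift_def)
qed

lemma J_HS [simp, intro]: "a \<in> cauchy_in E0 \<Longrightarrow> J a \<in> HS"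
  by (simp add: HS_def)

text \<open>Independence of the representatives chosen by \<open>lift\<close>: \<open>L_cong\<close>
  exchanges the left one, and conjugate symmetry brings the right one to the left.\<close>

lemma ip_J:
  assumes a: "a \<in> cauchy_in E0" and b: "b \<in> cauchy_in E0"
  shows "ip (J a) (J b) = L a b"
proof -
  note l = lift[OF J_HS[OF a]] lift[OF J_HS[OF b]]
  have "ip (J a) (J b) = L a (lift (J b))"
    unfolding ip_def using l a by (intro L_cong) (auto intro: cauchy_in_E0)
  also have "\<dots> = cnj (L (lift (J b)) a)" using l a by (intro L_cnj) (auto intro: cauchy_in_E0)
  also have "L (lift (J b)) a = L b a" using l a b by (intro L_cong) (auto intro: cauchy_in_E0)
  also have "cnj (L b a) = L a b" using L_cnj[of b a] a b by (simp add: cauchy_in_E0)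
  finally show ?thesis .
qed

lemma hnorm_J: "a \<in> cauchy_in E0 \<Longrightarrow> hnorm ip (J a) = sqrt (Re (L a a))"
  by (simp add: hnorm_def ip_J)

lemma hnorm_lim: "a \<in> cauchy_in E0 \<Longrightarrow> (\<lambda>n. N (a n)) \<longlonglongrightarrow> hnorm ip (J a)"
  by (simp add: hnorm_J N_lim cauchy_in_E0)

lemma hnorm_const: "e \<in> E0 \<Longrightarrow> hnorm ip (J (\<lambda>_. e)) = N e"
  using hnorm_lim[OF cauchy_const[of e E0]] LIMSEQ_unique tendsto_const by blast

lemma HS_zero [simp, intro]: "0 \<in> HS"
proof -
  have "J (\<lambda>_. 0) = 0"
    using J_diff[of "\<lambda>_. 0" "\<lambda>_. 0"] cauchy_const[of 0 E0] by simp
  then show ?thesis using J_HS[OF cauchy_const[of 0 E0]] by simp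
qed

lemma HS_add [simp, intro]: "F \<in> HS \<Longrightarrow> F' \<in> HS \<Longrightarrow> F + F' \<in> HS"
  using J_HS[OF cauchy_add[of "lift F" "lift F'"]] by (simp add: J_add lift)

lemma HS_scl [simp, intro]: "F \<in> HS \<Longrightarrow> scl c F \<in> HS"
  using J_HS[OF cauchy_scl[of "lift F" c]] by (simp add: J_scl lift)

lemma HS_minus [simp, intro]: "F \<in> HS \<Longrightarrow> - F \<in> HS"
  using HS_scl[of F "- 1"] by (simp add: scl_minus_one)

lemma HS_diff [simp, intro]: "F \<in> HS \<Longrightarrow> F' \<in> HS \<Longrightarrow> F - F' \<in> HS"
  using HS_add[of F "- F'"] by simp

lemma HS_shift [simp, intro]: "g \<in> carrier \<Gamma> \<Longrightarrow> F \<in> HS \<Longrightarrow> shift g F \<in> HS"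
  using J_HS[OF cauchy_shift[of g "lift F"]] by (simp add: J_shift lift)

lemma ip_add_HS: "\<lbrakk>F \<in> HS; F' \<in> HS; E \<in> HS\<rbrakk> \<Longrightarrow> ip (F + F') E = ip F E + ip F' E"
  unfolding HS_def by (auto simp: J_add[symmetric] ip_J cauchy_add L_add_left cauchy_in_E0)

lemma ip_scl_HS: "\<lbrakk>F \<in> HS; E \<in> HS\<rbrakk> \<Longrightarrow> ip (scl c F) E = c * ip F E"
  unfolding HS_def by (auto simp: J_scl[symmetric] ip_J cauchy_scl L_scl_left cauchy_in_E0)

lemma ip_cnj_HS:
  assumes "F \<in> HS" "E \<in> HS" shows "ip E F = cnj (ip F E)"
proof -
  obtain a b where ab: "a \<in> cauchy_in E0" "b \<in> cauchy_in E0" "F = J a" "E = J b"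
    using assms by (auto simp: HS_def)
  have "L b a = cnj (L a b)" using ab by (intro L_cnj cauchy_in_E0)
  then show ?thesis using ab by (simp add: ip_J)
qed

lemma ip_shift_HS: 
  assumes "g \<in> carrier \<Gamma>" "F \<in> HS" "E \<in> HS"
  shows "ip (shift g F) (shift g E) = ip F E"
proof -
  obtain a b where ab: "a \<in> cauchy_in E0" "b \<in> cauchy_in E0" "F = J a" "E = J b"
    using assms by (auto simp: HS_def)
  have "L (\<lambda>n. shift g (a n)) (\<lambda>n. shift g (b n)) = L a b"
    unfolding L_def using ab assms(1) by (simp add: B_shift E0_seq)
  then show ?thesis using ab assms(1) by (simp add: J_shift[symmetric] ip_J cauchy_shift)
qed

lemma ip_pos_HS:
  assumes "F \<in> HS" "F \<noteq> 0" shows "0 < Re (ip F F)"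
proof (rule ccontr)
  assume neg: "\<not> 0 < Re (ip F F)"
  obtain a where a: "a \<in> cauchy_in E0" "F = J a" using assms by (auto simp: HS_def)
  have "0 \<le> hnorm ip F"
    using hnorm_lim[OF a(1)] a N_nonneg[OF E0_seq[OF a(1)]] by (intro LIMSEQ_le_const) auto
  moreover have "hnorm ip F \<le> 0" using neg by (simp add: hnorm_def)
  ultimately have "(\<lambda>n. N (a n)) \<longlonglongrightarrow> 0" using hnorm_lim[OF a(1)] a(2) by simp
  then have "J a = 0"
    using L_null[OF cauchy_in_E0[OF a(1)]] by (auto simp: J_def cauchy_const)
  then show False using assms a by simp
qed


text \<open>A diagonal argument: \<open>e n\<close> is a term of a representative of
  \<open>F n\<close> beyond which that representative varies by less than
  \<open>1 / real (Suc n)\<close>. Distances between the \<open>e n\<close> are those between the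
  \<open>F n\<close> up to these errors, so \<open>e\<close> is Cauchy and represents the
  limit.\<close>

lemma HS_complete:
  assumes F: "\<And>n. F n \<in> HS"
    and C: "\<And>e. 0 < e \<Longrightarrow> \<exists>M. \<forall>m\<ge>M. \<forall>n\<ge>M. hnorm ip (F m - F n) < e"
  shows "\<exists>E\<in>HS. (\<lambda>n. hnorm ip (F n - E)) \<longlonglongrightarrow> 0"
proof -
  define A where "A n = lift (F n)" for n
  have A: "A n \<in> cauchy_in E0" "J (A n) = F n" for n
    using lift[OF F] by (auto simp: A_def)
  have fs: "A n k \<in> fs" for n k using A(1) by (rule E0_seq)
  have "\<forall>n. \<exists>k. \<forall>i\<ge>k. \<forall>j\<ge>k. N (A n i - A n j) < 1 / real (Suc n)"
    using cauchy_inD[OF A(1)] by auto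
  then obtain k where k: "\<And>n i j. k n \<le> i \<Longrightarrow> k n \<le> j \<Longrightarrow> N (A n i - A n j) < 1 / real (Suc n)"
    by metis
  define e where "e n = A n (k n)" for n
  have e0: "e n \<in> E0" for n unfolding e_def using A(1) by (rule cauchy_in_mem)
  then have efs: "e n \<in> fs" for n by (rule E0_fs)
  have step: "N (e m - e n) \<le> 1 / real (Suc m) + hnorm ip (F m - F n) + 1 / real (Suc n)" for m n
  proof -
    have "(\<lambda>i. N (A m i - A n i)) \<longlonglongrightarrow> hnorm ip (F m - F n)"
      using hnorm_lim[OF cauchy_diff[OF A(1)[of m] A(1)[of n]]] J_diff[OF A(1)[of m] A(1)[of n]] A(2) by simp
    then have "(\<lambda>i. 1 / real (Suc m) + N (A m i - A n i) + 1 / real (Suc n)) \<longlonglongrightarrow>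
        1 / real (Suc m) + hnorm ip (F m - F n) + 1 / real (Suc n)"
      by (intro tendsto_intros)
    moreover have "\<exists>M. \<forall>i\<ge>M. N (e m - e n) \<le> 1 / real (Suc m) + N (A m i - A n i) + 1 / real (Suc n)"
    proof (intro exI[of _ "max (k m) (k n)"] allI impI)
      fix i assume i: "max (k m) (k n) \<le> i"
      have "N (e m - e n) \<le> N (e m - A m i) + N (A m i - e n)"
        using fs efs by (intro N_triangle3) auto
      moreover have "N (A m i - e n) \<le> N (A m i - A n i) + N (A n i - e n)"
        using fs efs by (intro N_triangle3) auto
      moreover have "N (e m - A m i) < 1 / real (Suc m)" "N (A n i - e n) < 1 / real (Suc n)"
        unfolding e_def using k[of m "k m" i] k[of n i "k n"] i by auto
      ultimately show "N (e m - e n) \<le> 1 / real (Suc m) + N (A m i - A n i) + 1 / real (Suc n)" by simp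
    qed
    ultimately show ?thesis by (intro LIMSEQ_le[OF tendsto_const]) auto
  qed
  have inv_small: "\<exists>M. \<forall>n\<ge>M. 1 / real (Suc n) < d" if d: "0 < d" for d :: real
  proof -
    obtain M where "inverse (real (Suc M)) < d" using reals_Archimedean[OF d] by blast
    then have "1 / real (Suc n) < d" if "M \<le> n" for n
      using that by (intro le_less_trans[of "1 / real (Suc n)" "1 / real (Suc M)"]) (auto simp: field_simps)
    then show ?thesis by blast
  qed
  have eC: "e \<in> cauchy_in E0"
    unfolding cauchy_in_def
  proof (intro CollectI conjI allI impI e0)
    fix d :: real assume d: "0 < d"
    then obtain M1 where M1: "\<forall>n\<ge>M1. 1 / real (Suc n) < d / 3" using inv_small[of "d / 3"] by auto
    obtain M2 where M2: "\<forall>m\<ge>M2. \<forall>n\<ge>M2. hnorm ip (F m - F n) < d / 3" using C[of "d / 3"] d by auto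
    show "\<exists>M. \<forall>m\<ge>M. \<forall>n\<ge>M. N (e m - e n) < d"
    proof (intro exI[of _ "max M1 M2"] allI impI)
      fix m n assume "max M1 M2 \<le> m" "max M1 M2 \<le> n"
      then have "1 / real (Suc m) < d / 3" "1 / real (Suc n) < d / 3" "hnorm ip (F m - F n) < d / 3"
        using M1 M2 by auto
      then show "N (e m - e n) < d" using step[of m n] by linarith
    qed
  qed
  have "(\<lambda>n. hnorm ip (F n - J e)) \<longlonglongrightarrow> 0"
    unfolding LIMSEQ_iff
  proof (intro allI impI)
    fix d :: real assume d: "0 < d"
    obtain M1 where M1: "\<forall>n\<ge>M1. 1 / real (Suc n) < d / 4" using inv_small[of "d / 4"] d by auto
    obtain M2 where M2: "\<forall>m\<ge>M2. \<forall>n\<ge>M2. N (e m - e n) < d / 4"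
      using cauchy_inD[OF eC, of "d / 4"] d by auto
    show "\<exists>M. \<forall>n\<ge>M. norm (hnorm ip (F n - J e) - 0) < d"
    proof (intro exI[of _ "max M1 M2"] allI impI)
      fix n assume n: "max M1 M2 \<le> n"
      have lim: "(\<lambda>i. N (A n i - e i)) \<longlonglongrightarrow> hnorm ip (F n - J e)"
        using hnorm_lim[OF cauchy_diff[OF A(1)[of n] eC]] J_diff[OF A(1)[of n] eC] A(2) by simp
      have "hnorm ip (F n - J e) \<le> d / 2"
      proof (intro LIMSEQ_le_const2[OF lim] exI[of _ "max (k n) M2"] allI impI)
        fix i assume i: "max (k n) M2 \<le> i"
        have "N (A n i - e i) \<le> N (A n i - e n) + N (e n - e i)"
          using fs efs by (intro N_triangle3) auto
        moreover have "N (A n i - e n) < 1 / real (Suc n)" unfolding e_def using k[of n i "k n"] i by auto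
        moreover have "1 / real (Suc n) < d / 4" "N (e n - e i) < d / 4" using M1 M2 n i by auto
        ultimately show "N (A n i - e i) \<le> d / 2" by linarith
      qed
      moreover have "0 \<le> hnorm ip (F n - J e)"
        using lim fs efs by (intro LIMSEQ_le_const) auto
      ultimately show "norm (hnorm ip (F n - J e) - 0) < d" using d by simp
    qed
  qed
  then show ?thesis using eC by auto
qed

section \<open>The unitary representation by translations\<close>

definition HM :: "(complex, 'g \<Rightarrow> complex) module" where
  "HM = \<lparr>carrier = HS, monoid.mult = \<lambda>_ _. 0, one = 0, zero = 0, add = (+), smult = scl\<rparr>"

lemma HM_simps [simp]: "carrier HM = HS" "\<zero>\<^bsub>HM\<^esub> = 0" "F \<oplus>\<^bsub>HM\<^esub> F' = F + F'" "c \<odot>\<^bsub>HM\<^esub> F = scl c F"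
  by (simp_all add: HM_def)

lemma HM_abelian: "abelian_group HM"
proof (rule abelian_groupI)
  fix x assume "x \<in> carrier HM"
  then show "\<exists>y\<in>carrier HM. y \<oplus>\<^bsub>HM\<^esub> x = \<zero>\<^bsub>HM\<^esub>" by (intro bexI[of _ "- x"]) auto
qed (auto simp: add.assoc add.commute)

lemma HM_minus: "x \<in> HS \<Longrightarrow> y \<in> HS \<Longrightarrow> x \<ominus>\<^bsub>HM\<^esub> y = x - y"
proof -
  assume "x \<in> HS" "y \<in> HS"
  then have "\<ominus>\<^bsub>HM\<^esub> y = - y"
    by (intro abelian_group.minus_equality[OF HM_abelian]) auto
  then show ?thesis by (simp add: a_minus_def)
qed

lemma HM_hilbert: "complex_hilbert_space HM ip"
proof (intro complex_hilbert_space.intro complex_hilbert_space_axioms.intro)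
  show "module complex_ring HM"
    by (rule moduleI[OF complex_ring_cring HM_abelian])
      (auto simp: complex_ring_def scl_def fun_eq_iff algebra_simps
        HS_scl[unfolded scl_def])
next
  fix X :: "nat \<Rightarrow> 'g \<Rightarrow> complex"
  assume X: "\<And>n. X n \<in> carrier HM"
    and C: "\<And>e. 0 < e \<Longrightarrow> \<exists>N. \<forall>m\<ge>N. \<forall>n\<ge>N. hnorm ip (X m \<ominus>\<^bsub>HM\<^esub> X n) < e"
  have "\<exists>E\<in>HS. (\<lambda>n. hnorm ip (X n - E)) \<longlonglongrightarrow> 0"
    using X C by (intro HS_complete) (auto simp: HM_minus)
  then show "\<exists>x\<in>carrier HM. (\<lambda>n. hnorm ip (X n \<ominus>\<^bsub>HM\<^esub> x)) \<longlonglongrightarrow> 0"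
    using X by (auto simp: HM_minus)
qed (auto simp: ip_add_HS ip_scl_HS ip_pos_HS intro: ip_cnj_HS)

text \<open>The group \<open>BijGroup\<close> consists of extensional bijections, hence the
  restriction to \<open>HS\<close>.\<close>

definition act :: "'g \<Rightarrow> ('g \<Rightarrow> complex) \<Rightarrow> 'g \<Rightarrow> complex" where
  "act g = restrict (shift g) HS"

lemma shift_HS_one: "F \<in> HS \<Longrightarrow> shift \<one> F = F"
  using J_shift[of \<one> "lift F"] lift[of F] by (simp add: shift_one[OF E0_seq])

lemma act_Bij: 
  assumes g: "g \<in> carrier \<Gamma>" shows "act g \<in> Bij HS"
proof -
  have "bij_betw (shift g) HS HS"
    using g by (intro bij_betw_byWitness[of _ "shift (inv g)"]) (auto simp: shift_mult shift_HS_one)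
  then show ?thesis by (simp add: Bij_def act_def bij_betw_restrict_eq cong: bij_betw_cong)
qed

lemma HM_rep: "unitary_rep \<Gamma> HM ip act"
proof (intro unitary_rep.intro HM_hilbert unitary_rep_axioms.intro)
  show "group_action \<Gamma> (carrier HM) act"
  proof (intro group_action.intro group_hom.intro group_hom_axioms.intro is_group group_BijGroup)
    show "act \<in> hom \<Gamma> (BijGroup (carrier HM))"
      by (intro homI)
        (auto simp: BijGroup_def act_Bij, auto simp: act_def compose_def fun_eq_iff shift_mult)
  qed
qed (auto simp: act_def shift_add shift_scl ip_shift_HS)

text \<open>Otherwise the class of \<open>u\<close> is almost invariant, and Property (T) produces
  an invariant \<open>w \<noteq> 0\<close> in the completion of \<open>E0\<close>. Seen through
  \<open>J\<close>, such a \<open>w\<close> is a constant function on the group; its pairing with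
  any \<open>e\<close> in \<open>E0\<close> is then a multiple of \<open>cnj (total e) = 0\<close>,
  so \<open>w\<close> has norm 0.\<close>

lemma kazhdan:
  assumes rep: "\<And>(H :: (complex, 'g \<Rightarrow> complex) module) ip \<pi>. \<lbrakk>unitary_rep \<Gamma> H ip \<pi>;
      \<exists>v\<in>carrier H. v \<noteq> \<zero>\<^bsub>H\<^esub> \<and> (\<forall>g\<in>Q. hnorm ip (\<pi> g v \<ominus>\<^bsub>H\<^esub> v) < \<epsilon> * hnorm ip v)\<rbrakk>
      \<Longrightarrow> \<exists>w\<in>carrier H. w \<noteq> \<zero>\<^bsub>H\<^esub> \<and> (\<forall>g\<in>carrier \<Gamma>. \<pi> g w = w)"
    and Q: "Q \<subseteq> carrier \<Gamma>" and u: "u \<in> E0" "N u > 0"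
  shows "\<exists>q\<in>Q. \<epsilon> * N u \<le> N (shift q u - u)"
proof (rule ccontr)
  assume neg: "\<not> (\<exists>q\<in>Q. \<epsilon> * N u \<le> N (shift q u - u))"
  define v where "v = J (\<lambda>_. u)"
  have v: "v \<in> HS" using u by (auto simp: v_def intro: cauchy_const)
  have nv: "hnorm ip v = N u" using u by (simp add: v_def hnorm_const)
  have "v \<noteq> 0"
  proof
    assume "v = 0"
    moreover have "scl 0 0 = (0 :: 'g \<Rightarrow> complex)" by (simp add: scl_def fun_eq_iff)
    then have "ip 0 0 = 0" using ip_scl_HS[of 0 0 0] by simp
    ultimately show False using nv u by (simp add: hnorm_def)
  qed
  moreover have "hnorm ip (act q v \<ominus>\<^bsub>HM\<^esub> v) < \<epsilon> * hnorm ip v" if q: "q \<in> Q" for q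
  proof -
    have qc: "q \<in> carrier \<Gamma>" using q Q by auto
    have "act q v \<ominus>\<^bsub>HM\<^esub> v = shift q v - v" using v qc by (simp add: act_def HM_minus)
    also have "\<dots> = J (\<lambda>_. shift q u - u)"
      unfolding v_def using u qc J_shift[OF qc cauchy_const[OF u(1)]]
        J_diff[OF cauchy_const[OF shift_E0[OF qc u(1)]] cauchy_const[OF u(1)]] by simp
    finally show ?thesis using neg q qc u by (auto simp: hnorm_const nv)
  qed
  ultimately obtain w where w: "w \<in> HS" "w \<noteq> 0" "\<And>g. g \<in> carrier \<Gamma> \<Longrightarrow> act g w = w"
    using rep[OF HM_rep] v by auto
  obtain a where a: "a \<in> cauchy_in E0" "w = J a" using w by (auto simp: HS_def)
  \<comment> \<open>Invariance under \<open>x\<close>, evaluated at the point \<open>x\<close>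
    itself: translation by \<open>x\<close> moves the value at \<open>\<one>\<close> there.\<close>
  have const: "w x = w \<one>" if x: "x \<in> carrier \<Gamma>" for x
  proof -
    have "w x = act x w x" using w(3)[OF x] by simp
    also have "\<dots> = w \<one>" using w(1) x by (simp add: act_def shift_def)
    finally show ?thesis .
  qed
  have "(\<lambda>n. N (a n)) \<longlonglongrightarrow> 0"
  proof (rule null_seq[OF a(1)])
    fix e assume e: "e \<in> E0"
    have "L a (\<lambda>_. e) = (\<Sum>y | e y \<noteq> 0. cnj (e y) * L a (\<lambda>_. dirac y))"
      by (rule L_expand[OF a(1) E0_fs[OF e]])
    also have "\<dots> = (\<Sum>y | e y \<noteq> 0. cnj (e y) * w \<one>)"
    proof (intro sum.cong refl)
      fix y assume "y \<in> {y. e y \<noteq> 0}"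
      then have y: "y \<in> carrier \<Gamma>" using fs_support[OF E0_fs[OF e]] by auto
      then have "L a (\<lambda>_. dirac y) = w y" by (simp add: a J_def)
      with const[OF y] show "cnj (e y) * L a (\<lambda>_. dirac y) = cnj (e y) * w \<one>" by simp
    qed
    also have "\<dots> = cnj (total e) * w \<one>" by (simp add: total_def sum_distrib_right)
    finally show "L a (\<lambda>_. e) = 0" using e by (simp add: E0_def)
  qed
  then have "hnorm ip w = 0" using hnorm_lim[OF a(1)] a(2) LIMSEQ_unique by blast
  then show False using ip_pos_HS[OF w(1,2)] by (simp add: hnorm_def)
qed

end

section \<open>The lazy random walk under Property (T)\<close>

locale fg_group = group \<Gamma> for \<Gamma> :: "('g, 'm) monoid_scheme" (structure) +
  fixes S :: "'g set"
  assumes S_finite: "finite S" and S_carrier: "S \<subseteq> carrier \<Gamma>"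
    and S_generates: "generate \<Gamma> S = carrier \<Gamma>" and infinite_carrier: "infinite (carrier \<Gamma>)"
begin

definition sgens :: "'g set" where "sgens = S \<union> (\<lambda>s. inv s) ` S"

text \<open>The degree of the Cayley graph: a generator that is its own inverse yields one neighbor,
  and the identity, if present, one loop that counts once.\<close>

definition d :: nat where "d = card sgens"

lemma sgens_finite [simp, intro]: "finite sgens"
  using S_finite by (simp add: sgens_def)

lemma sgens_carrier [simp]: "s \<in> sgens \<Longrightarrow> s \<in> carrier \<Gamma>"
  using S_carrier by (auto simp: sgens_def)

lemma sgens_inv [simp]: "s \<in> sgens \<Longrightarrow> inv s \<in> sgens"
  using S_carrier by (auto simp: sgens_def subset_iff)

lemma sgens_bij_inv: "bij_betw (\<lambda>s. inv s) sgens sgens"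
  by (rule bij_betw_byWitness[of _ "\<lambda>s. inv s"]) auto

section \<open>Balls of the word metric\<close>

primrec W :: "nat \<Rightarrow> 'g set" where
  "W 0 = {\<one>}"
| "W (Suc j) = W j \<union> (\<Union>u\<in>W j. (\<lambda>s. u \<otimes> s) ` sgens)"

lemma W_finite [simp, intro]: "finite (W j)"
  by (induction j) auto

lemma W_carrier: "x \<in> W j \<Longrightarrow> x \<in> carrier \<Gamma>"
  by (induction j arbitrary: x) auto

lemma W_subset: "W j \<subseteq> carrier \<Gamma>"
  using W_carrier by blast

lemma W_mono: "i \<le> j \<Longrightarrow> W i \<subseteq> W j"
  by (induction j) (auto simp: le_Suc_eq)

lemma one_W [simp, intro]: "\<one> \<in> W j"
  using W_mono[of 0 j] by auto

lemma W_SucI: "u \<in> W j \<Longrightarrow> s \<in> sgens \<Longrightarrow> u \<otimes> s \<in> W (Suc j)"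
  by auto

lemma sgens_W: "s \<in> sgens \<Longrightarrow> s \<in> W (Suc 0)"
  using W_SucI[of \<one> 0 s] by simp

lemma W_mult: "x \<in> W i \<Longrightarrow> y \<in> W j \<Longrightarrow> x \<otimes> y \<in> W (i + j)"
proof (induction j arbitrary: y)
  case 0 then show ?case using W_carrier by simp
next
  case (Suc j)
  show ?case
  proof (cases "y \<in> W j")
    case True then show ?thesis using Suc W_mono[of "i + j" "i + Suc j"] by auto
  next
    case False
    then obtain u s where us: "u \<in> W j" "s \<in> sgens" "y = u \<otimes> s" using Suc.prems by auto
    then have "x \<otimes> y = (x \<otimes> u) \<otimes> s" using Suc.prems W_carrier by (simp add: m_assoc)
    moreover have "x \<otimes> u \<in> W (i + j)" using Suc us by blast
    ultimately show ?thesis using W_SucI[of "x \<otimes> u" "i + j" s] us by simp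
  qed
qed

lemma W_inv: "x \<in> W j \<Longrightarrow> inv x \<in> W j"
proof (induction j arbitrary: x)
  case (Suc j)
  show ?case
  proof (cases "x \<in> W j")
    case True then show ?thesis using Suc.IH by auto
  next
    case False
    then obtain u s where us: "u \<in> W j" "s \<in> sgens" "x = u \<otimes> s" using Suc.prems by auto
    then have "inv x = inv s \<otimes> inv u" using W_carrier by (simp add: inv_mult_group)
    moreover have "inv s \<otimes> inv u \<in> W (Suc 0 + j)"
      using us Suc.IH by (intro W_mult sgens_W) auto
    ultimately show ?thesis by simp
  qed
qed simp

lemma W_exhaust: "x \<in> carrier \<Gamma> \<Longrightarrow> \<exists>j. x \<in> W j"
proof -
  assume "x \<in> carrier \<Gamma>"
  then have "x \<in> generate \<Gamma> S" by (simp add: S_generates)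
  then show ?thesis
  proof (induction rule: generate.induct)
    case (incl h) then show ?case using sgens_W[of h] unfolding sgens_def by blast
  next
    case (inv h) then show ?case using sgens_W[of "inv h"] unfolding sgens_def by blast
  next
    case (eng h1 h2) then show ?case using W_mult by blast
  qed (auto intro: exI[of _ 0])
qed

text \<open>The radius is kept at least 1 because \<open>gap\<close> divides by its square.\<close>

lemma W_cover: "finite Q \<Longrightarrow> Q \<subseteq> carrier \<Gamma> \<Longrightarrow> \<exists>l\<ge>1. Q \<subseteq> W l"
proof (induction Q rule: finite_induct)
  case (insert x Q)
  then obtain l where l: "l \<ge> 1" "Q \<subseteq> W l" by auto
  obtain j where j: "x \<in> W j" using insert.prems W_exhaust by (meson insert_subset)
  show ?case using l j W_mono[of l "l + j"] W_mono[of j "l + j"] by (intro exI[of _ "l + j"]) auto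
qed auto

lemma d_pos: "d > 0"
proof -
  have "sgens \<noteq> {}"
  proof
    assume e: "sgens = {}"
    then have "W j = {\<one>}" for j by (induction j) auto
    then have "carrier \<Gamma> \<subseteq> {\<one>}" using W_exhaust by auto
    then show False using infinite_carrier finite_subset by blast
  qed
  then show ?thesis by (simp add: d_def card_gt_0_iff)
qed

text \<open>The distribution of the lazy random walk from \<open>\<one>\<close> after
  \<open>j\<close> steps, that is, a convolution power of the symmetric measure giving mass 1/2 to
  \<open>\<one>\<close> and sharing the other half equally among \<open>sgens\<close>.\<close>

primrec walk :: "nat \<Rightarrow> 'g \<Rightarrow> real" where
  "walk 0 = (\<lambda>x. if x = \<one> then 1 else 0)"
| "walk (Suc j) = (\<lambda>x. if x \<in> carrier \<Gamma> then walk j x / 2 + (\<Sum>s\<in>sgens. walk j (inv s \<otimes> x)) / (2 * d) else 0)"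

lemma walk_support: "walk j x \<noteq> 0 \<Longrightarrow> x \<in> W j"
proof (induction j arbitrary: x)
  case (Suc j)
  then have x: "x \<in> carrier \<Gamma>" by (auto split: if_splits)
  then consider "walk j x \<noteq> 0" | "(\<Sum>s\<in>sgens. walk j (inv s \<otimes> x)) \<noteq> 0" using Suc.prems by force
  then show ?case
  proof cases
    case 1 then show ?thesis using Suc.IH by auto
  next
    case 2
    then obtain s where s: "s \<in> sgens" "walk j (inv s \<otimes> x) \<noteq> 0" by (meson sum.neutral)
    then have "s \<otimes> (inv s \<otimes> x) \<in> W (Suc 0 + j)" using Suc.IH by (intro W_mult sgens_W) auto
    then show ?thesis using s x by (simp add: m_assoc[symmetric])
  qed
qed (auto split: if_splits)

text \<open>This is the inner product of \<open>(P ^^ j) v\<close> with \<open>v\<close> (see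
  \<open>R_pow_v\<close>), written as a finite sum so that it makes sense and is continuous for
  arbitrary \<open>\<psi>\<close>.\<close>

definition moment :: "('g \<Rightarrow> real) \<Rightarrow> nat \<Rightarrow> real" where
  "moment \<psi> j = (\<Sum>x\<in>W j. walk j x * \<psi> x)"

lemma moment_on: "j \<le> m \<Longrightarrow> moment \<psi> j = (\<Sum>x\<in>W m. walk j x * \<psi> x)"
  unfolding moment_def using W_mono walk_support by (intro sum.mono_neutral_left) auto

end

locale pos_def_walk = pos_def_function \<Gamma> \<psi> + fg_group \<Gamma> S
  for \<Gamma> :: "('g, 'm) monoid_scheme" (structure) and \<psi> S
begin

section \<open>The walk operator on the group algebra\<close>

definition avg :: "('g \<Rightarrow> complex) \<Rightarrow> 'g \<Rightarrow> complex" where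
  "avg a = (\<Sum>s\<in>sgens. shift s a)"

text \<open>Laziness makes the operator positive (\<open>R_P_bounds\<close>), so that it defines a
  second semi-inner product with its own Cauchy-Schwarz inequality.\<close>

definition P :: "('g \<Rightarrow> complex) \<Rightarrow> 'g \<Rightarrow> complex" where
  "P a = scl (1 / 2) a + scl (of_real (1 / (2 * d))) (avg a)"

lemma sum_fs: "finite T \<Longrightarrow> (\<And>s. s \<in> T \<Longrightarrow> f s \<in> fs) \<Longrightarrow> (\<Sum>s\<in>T. f s) \<in> fs"
  by (induction T rule: finite_induct) auto

lemma B_sum_left: "\<lbrakk>finite T; \<And>s. s \<in> T \<Longrightarrow> f s \<in> fs; b \<in> fs\<rbrakk> \<Longrightarrow> B (\<Sum>s\<in>T. f s) b = (\<Sum>s\<in>T. B (f s) b)"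
proof (induction T rule: finite_induct)
  case empty
  show ?case using B_scl_left[of 0 b 0] empty by (simp add: scl_def B_def)
qed (simp add: B_add_left sum_fs)

lemma avg_fs [simp, intro]: "a \<in> fs \<Longrightarrow> avg a \<in> fs"
  unfolding avg_def by (intro sum_fs) auto

lemma P_fs [simp, intro]: "a \<in> fs \<Longrightarrow> P a \<in> fs"
  unfolding P_def by auto

lemma total_sum_shift:
  assumes "finite T" "T \<subseteq> carrier \<Gamma>" "a \<in> fs"
  shows "total (\<Sum>s\<in>T. shift s a) = of_nat (card T) * total a"
  using assms
proof (induction T rule: finite_induct)
  case empty
  show ?case by (simp add: total_def)
next
  case (insert x T)
  then have "shift x a \<in> fs" "(\<Sum>s\<in>T. shift s a) \<in> fs" by (auto intro!: sum_fs)
  note mem = this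
  have "total (\<Sum>s\<in>insert x T. shift s a) = total (shift x a + (\<Sum>s\<in>T. shift s a))"
    using insert.hyps by (intro arg_cong[of _ _ total] sum.insert)
  also have "\<dots> = total (shift x a) + total (\<Sum>s\<in>T. shift s a)" using mem by (rule total_add)
  also have "\<dots> = total a + of_nat (card T) * total a"
    using insert by (simp only: total_shift insert_subset)
  also have "\<dots> = of_nat (card (insert x T)) * total a"
    using insert.hyps by (simp add: algebra_simps)
  finally show ?case .
qed

text \<open>The weights 1/2 and \<open>d\<close> times \<open>1 / (2 * d)\<close> add up to 1. Hence
  \<open>P\<close> preserves \<open>E0\<close> and \<open>v - P v\<close> belongs to it.\<close>

lemma total_P: "a \<in> fs \<Longrightarrow> total (P a) = total a"
  unfolding P_def using total_sum_shift[of sgens a] d_pos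
  by (simp add: total_add total_scl avg_def[symmetric] subset_iff d_def[symmetric])

lemma P_E0 [simp, intro]: "a \<in> E0 \<Longrightarrow> P a \<in> E0"
  by (simp add: E0_def total_P)

definition R :: "('g \<Rightarrow> complex) \<Rightarrow> ('g \<Rightarrow> complex) \<Rightarrow> real" where "R a b = Re (B a b)"

lemma R_sym: "a \<in> fs \<Longrightarrow> b \<in> fs \<Longrightarrow> R b a = R a b" by (simp add: R_def Re_B_sym)

lemma R_self: "a \<in> fs \<Longrightarrow> R a a = (N a)\<^sup>2" by (simp add: R_def N_sq)

lemma R_add_left: "\<lbrakk>a \<in> fs; b \<in> fs; e \<in> fs\<rbrakk> \<Longrightarrow> R (a + b) e = R a e + R b e"
  by (simp add: R_def B_add_left)

lemma R_add_right: "\<lbrakk>a \<in> fs; b \<in> fs; e \<in> fs\<rbrakk> \<Longrightarrow> R e (a + b) = R e a + R e b"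
  by (simp add: R_def B_add_right)

lemma R_diff_left: "\<lbrakk>a \<in> fs; b \<in> fs; e \<in> fs\<rbrakk> \<Longrightarrow> R (a - b) e = R a e - R b e"
  by (simp add: R_def B_diff_left)

lemma R_scl_left: "\<lbrakk>a \<in> fs; e \<in> fs\<rbrakk> \<Longrightarrow> R (scl (of_real t) a) e = t * R a e"
  by (simp add: R_def B_scl_left)

lemma R_scl_right: "\<lbrakk>a \<in> fs; e \<in> fs\<rbrakk> \<Longrightarrow> R e (scl (of_real t) a) = t * R e a"
  by (simp add: R_def B_scl_right)

lemma R_P: 
  assumes "a \<in> fs" "b \<in> fs"
  shows "R (P a) b = R a b / 2 + (\<Sum>s\<in>sgens. R (shift s a) b) / (2 * d)"
proof -
  have "R (P a) b = R (scl (of_real (1 / 2)) a) b + R (scl (of_real (1 / (2 * d))) (avg a)) b"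
    using assms unfolding P_def by (subst R_add_left) auto
  also have "\<dots> = R a b / 2 + R (avg a) b / (2 * d)"
    using assms R_scl_left[of a b "1 / 2"] R_scl_left[of "avg a" b "1 / (2 * d)"] by simp
  also have "R (avg a) b = (\<Sum>s\<in>sgens. R (shift s a) b)"
    using assms unfolding avg_def R_def by (subst B_sum_left) auto
  finally show ?thesis .
qed

lemma R_shift_inv: 
  assumes "g \<in> carrier \<Gamma>" "a \<in> fs" "b \<in> fs"
  shows "R (shift (inv g) a) b = R a (shift g b)"
  using B_shift[of g "shift (inv g) a" b] assms by (simp add: R_def shift_mult shift_one)

text \<open>Self-adjointness holds because \<open>sgens\<close> is closed under inversion and the
  adjoint of a translation is its inverse.\<close>

lemma R_P_sym:
  assumes a: "a \<in> fs" and b: "b \<in> fs" shows "R (P a) b = R a (P b)"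
proof -
  have "(\<Sum>s\<in>sgens. R (shift s a) b) = (\<Sum>s\<in>sgens. R (shift (inv s) a) b)"
    using sum.reindex_bij_betw[OF sgens_bij_inv, of "\<lambda>s. R (shift s a) b"] by simp
  also have "\<dots> = (\<Sum>s\<in>sgens. R (shift s b) a)"
    using assms by (intro sum.cong refl) (simp add: R_shift_inv R_sym[of a])
  finally have "R (P a) b = R (P b) a"
    using assms by (simp add: R_P R_sym[of a b])
  also have "\<dots> = R a (P b)" using assms by (simp add: R_sym)
  finally show ?thesis .
qed

lemma R_shift_bound: "s \<in> sgens \<Longrightarrow> a \<in> fs \<Longrightarrow> \<bar>R (shift s a) a\<bar> \<le> (N a)\<^sup>2"
  using Re_B_le[of "shift s a" a] by (simp add: R_def N_shift power2_eq_square)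

lemma R_P_bounds:
  assumes a: "a \<in> fs" shows "0 \<le> R (P a) a" "R (P a) a \<le> (N a)\<^sup>2"
proof -
  have "\<bar>\<Sum>s\<in>sgens. R (shift s a) a\<bar> \<le> (\<Sum>s\<in>sgens. (N a)\<^sup>2)"
    by (rule order_trans[OF sum_abs]) (intro sum_mono R_shift_bound a)
  then have *: "\<bar>\<Sum>s\<in>sgens. R (shift s a) a\<bar> \<le> d * (N a)\<^sup>2" by (simp add: d_def)
  have "R (P a) a = (N a)\<^sup>2 / 2 + (\<Sum>s\<in>sgens. R (shift s a) a) / (2 * d)"
    using a by (simp add: R_P R_self)
  moreover have "(\<Sum>s\<in>sgens. R (shift s a) a) / (2 * d) \<le> (N a)\<^sup>2 / 2"
    using * d_pos by (auto simp: field_simps)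
  moreover have "- ((N a)\<^sup>2 / 2) \<le> (\<Sum>s\<in>sgens. R (shift s a) a) / (2 * d)"
    using * d_pos by (auto simp: field_simps)
  ultimately show "0 \<le> R (P a) a" "R (P a) a \<le> (N a)\<^sup>2" by auto
qed

lemma P_add: "P (a + b) = P a + P b"
  by (simp add: P_def avg_def shift_add sum.distrib) (simp add: scl_def fun_eq_iff algebra_simps)

lemma P_scl: "P (scl c a) = scl c (P a)"
proof -
  have "(\<Sum>s\<in>T. shift s (scl c a)) = scl c (\<Sum>s\<in>T. shift s a)" if "finite T" for T
    using that by (induction T rule: finite_induct) (auto simp: shift_scl, auto simp: scl_def fun_eq_iff algebra_simps)
  then show ?thesis
    by (simp add: P_def avg_def) (simp add: scl_def fun_eq_iff algebra_simps)
qed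

lemma P_diff: "P (a - b) = P a - P b"
  using P_add[of a "- b"] P_scl[of "- 1" b] by (simp add: scl_minus_one)

lemma R_P_cauchy_schwarz:
  assumes a: "a \<in> fs" and b: "b \<in> fs"
  shows "(R (P a) b)\<^sup>2 \<le> R (P a) a * R (P b) b"
proof (rule psd_cauchy_schwarz)
  fix t :: real
  have "0 \<le> R (P (a + scl (of_real t) b)) (a + scl (of_real t) b)"
    using assms by (intro R_P_bounds) auto
  also have "\<dots> = R (P a) a + 2 * t * R (P a) b + t\<^sup>2 * R (P b) b"
    using assms R_P_sym[OF b a] R_sym[of b "P a"]
    by (simp add: P_add P_scl R_add_left R_add_right R_scl_left R_scl_right power2_eq_square algebra_simps)
  finally show "0 \<le> R (P a) a + 2 * t * R (P a) b + t\<^sup>2 * R (P b) b" .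
qed (use assms R_P_bounds in auto)

text \<open>Cauchy-Schwarz for the form of \<open>P\<close>, applied to \<open>a\<close> and
  \<open>P a\<close>. It stands in for a square root of \<open>P\<close> and avoids spectral
  theory.\<close>

lemma N_P_fourth:
  assumes a: "a \<in> fs"
  shows "((N (P a))\<^sup>2)\<^sup>2 \<le> R (P a) a * R (P (P a)) (P a)"
  using R_P_cauchy_schwarz[OF a P_fs[OF a]] R_self[OF P_fs[OF a]] by simp

text \<open>The operator inequality that the square of \<open>P\<close> is at most \<open>P\<close>,
  from \<open>0 \<le> P \<le> 1\<close>: bound the last factor in \<open>N_P_fourth\<close> by the
  square of \<open>N (P a)\<close> and cancel.\<close>

lemma N_P_sq_le:
  assumes a: "a \<in> fs" shows "(N (P a))\<^sup>2 \<le> R (P a) a"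
proof (cases "N (P a) = 0")
  case True then show ?thesis using R_P_bounds[OF a] by simp
next
  case False
  then have pos: "(N (P a))\<^sup>2 > 0" by simp
  have "R (P a) a * R (P (P a)) (P a) \<le> R (P a) a * (N (P a))\<^sup>2"
    using R_P_bounds[OF a] R_P_bounds[OF P_fs[OF a]] by (intro mult_left_mono) auto
  then have "(N (P a))\<^sup>2 * (N (P a))\<^sup>2 \<le> R (P a) a * (N (P a))\<^sup>2"
    using N_P_fourth[OF a] by (simp add: power2_eq_square)
  then show ?thesis using pos by (rule mult_right_le_imp_le)
qed

section \<open>From a Kazhdan pair to a spectral gap\<close>

lemma N_shift_diff_le:
  assumes u: "u \<in> fs" and m: "\<And>s. s \<in> sgens \<Longrightarrow> N (shift s u - u) \<le> m" "0 \<le> m"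
  shows "x \<in> W j \<Longrightarrow> N (shift x u - u) \<le> real j * m"
proof (induction j arbitrary: x)
  case 0
  then have "shift x u - u = u - u" using u by (simp add: shift_one)
  also have "\<dots> = 0" by (rule diff_self)
  finally show ?case unfolding N_def B_def by simp
next
  case (Suc j)
  show ?case
  proof (cases "x \<in> W j")
    case True then show ?thesis using Suc.IH[of x] m(2) by (simp add: algebra_simps)
  next
    case False
    then obtain y s where ys: "y \<in> W j" "s \<in> sgens" "x = y \<otimes> s" using Suc.prems by auto
    have y: "y \<in> carrier \<Gamma>" using ys W_carrier by blast
    have "shift x u - u = shift y (shift s u - u) + (shift y u - u)"
      using y ys by (simp add: shift_diff shift_mult)
    then have "N (shift x u - u) = N (shift y (shift s u - u) + (shift y u - u))" by (rule arg_cong)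
    also have "\<dots> \<le> N (shift y (shift s u - u)) + N (shift y u - u)"
      using u y ys by (intro N_triangle) auto
    also have "\<dots> \<le> m + real j * m"
    proof (rule add_mono)
      have "shift s u - u \<in> fs" using u ys by auto
      then show "N (shift y (shift s u - u)) \<le> m" using m(1)[OF ys(2)] by (simp only: N_shift[OF y])
    qed (rule Suc.IH[OF ys(1)])
    also have "m + real j * m = real (Suc j) * m" by (simp add: algebra_simps)
    finally show ?thesis .
  qed
qed

text \<open>Since \<open>q\<close> is a word of length at most \<open>l\<close>, some generator
  \<open>s0\<close> moves \<open>u\<close> by at least \<open>\<epsilon> * N u / l\<close>.
  Displacing by \<open>m\<close> lowers \<open>R (shift s u) u\<close> by half the square of
  \<open>m\<close>; as \<open>s0\<close> is one of \<open>d\<close> generators, each of weight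
  \<open>1 / (2 * d)\<close>, this gives the constant.\<close>

lemma gap:
  assumes q: "q \<in> W l" "1 \<le> l" "\<epsilon> * N u \<le> N (shift q u - u)" and \<epsilon>: "0 < \<epsilon>" and u: "u \<in> fs"
  shows "R (P u) u \<le> (1 - \<epsilon>\<^sup>2 / (4 * d * l\<^sup>2)) * (N u)\<^sup>2"
proof -
  have ne: "sgens \<noteq> {}" using d_pos by (auto simp: d_def)
  define m where "m = Max ((\<lambda>s. N (shift s u - u)) ` sgens)"
  have le: "N (shift s u - u) \<le> m" if "s \<in> sgens" for s
    using that by (auto simp: m_def)
  have "m \<in> (\<lambda>s. N (shift s u - u)) ` sgens" unfolding m_def using ne by (intro Max_in) auto
  then obtain s0 where s0: "s0 \<in> sgens" "m = N (shift s0 u - u)" by auto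
  have m0: "0 \<le> m" using s0 u by simp
  have "\<epsilon> * N u \<le> l * m" using N_shift_diff_le[OF u le m0 q(1)] q(3) by simp
  then have *: "\<epsilon>\<^sup>2 * (N u)\<^sup>2 \<le> l\<^sup>2 * m\<^sup>2"
    using power_mono[of "\<epsilon> * N u" "l * m" 2] \<epsilon> u by (simp add: power_mult_distrib)
  define X where "X = \<epsilon>\<^sup>2 / l\<^sup>2 * (N u)\<^sup>2"
  have m2: "X \<le> m\<^sup>2" using * q(2) by (simp add: X_def field_simps)
  have R1: "R (shift s u) u = (N u)\<^sup>2 - (N (shift s u - u))\<^sup>2 / 2" if "s \<in> sgens" for s
    using that u by (simp add: N_diff_sq N_shift R_def field_simps)
  have "(\<Sum>s\<in>sgens. R (shift s u) u) = d * (N u)\<^sup>2 - (\<Sum>s\<in>sgens. (N (shift s u - u))\<^sup>2 / 2)"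
    by (simp add: R1 sum_subtractf d_def)
  moreover have "m\<^sup>2 / 2 \<le> (\<Sum>s\<in>sgens. (N (shift s u - u))\<^sup>2 / 2)"
    using member_le_sum[of s0 sgens "\<lambda>s. (N (shift s u - u))\<^sup>2 / 2"] s0 by simp
  ultimately have "(\<Sum>s\<in>sgens. R (shift s u) u) \<le> d * (N u)\<^sup>2 - X / 2" using m2 by linarith
  then have "(\<Sum>s\<in>sgens. R (shift s u) u) / (2 * d) \<le> (d * (N u)\<^sup>2 - X / 2) / (2 * d)"
    by (intro divide_right_mono) auto
  also have "\<dots> = (N u)\<^sup>2 / 2 - \<epsilon>\<^sup>2 / (4 * d * l\<^sup>2) * (N u)\<^sup>2"
    using d_pos q(2) by (simp add: X_def field_simps)
  finally show ?thesis using u by (simp add: R_P R_self algebra_simps)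
qed

text \<open>The hypothesis bounds only the quadratic form. Used for both \<open>u\<close> and
  \<open>P u\<close>, it bounds the two factors in \<open>N_P_fourth\<close>, and cancelling the
  square of \<open>N (P u)\<close> turns it into a norm bound.\<close>

lemma contraction:
  assumes g: "\<And>u. u \<in> E0 \<Longrightarrow> R (P u) u \<le> (1 - c) * (N u)\<^sup>2" and c: "0 < c" "c < 1" and u: "u \<in> E0"
  shows "N (P u) \<le> (1 - c) * N u"
proof (cases "N (P u) = 0")
  case True then show ?thesis using c u by (simp add: E0_fs)
next
  case False
  have uf: "u \<in> fs" "P u \<in> fs" using u by (auto simp: E0_fs)
  have pos: "(N (P u))\<^sup>2 > 0" using False by simp
  have "R (P u) u * R (P (P u)) (P u) \<le> ((1 - c) * (N u)\<^sup>2) * ((1 - c) * (N (P u))\<^sup>2)"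
    using c u uf R_P_bounds[OF uf(1)] R_P_bounds[OF uf(2)] by (intro mult_mono g) auto
  then have "(N (P u))\<^sup>2 * (N (P u))\<^sup>2 \<le> ((1 - c) * N u)\<^sup>2 * (N (P u))\<^sup>2"
    using N_P_fourth[OF uf(1)] by (simp add: power2_eq_square algebra_simps)
  then have "(N (P u))\<^sup>2 \<le> ((1 - c) * N u)\<^sup>2" using pos by (rule mult_right_le_imp_le)
  then show ?thesis by (rule power2_le_imp_le) (use c uf in auto)
qed

lemma R_pow: "a \<in> fs \<Longrightarrow> b \<in> fs \<Longrightarrow> R ((P ^^ i) a) ((P ^^ j) b) = R ((P ^^ (i + j)) a) b"
proof (induction j arbitrary: i)
  case (Suc j)
  have f: "(P ^^ n) a \<in> fs" "(P ^^ n) b \<in> fs" for n using Suc.prems by (induction n) auto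
  have "R ((P ^^ i) a) ((P ^^ Suc j) b) = R (P ((P ^^ i) a)) ((P ^^ j) b)"
    using f by (simp add: R_P_sym)
  also have "\<dots> = R ((P ^^ (Suc i + j)) a) b" using Suc.IH[of "Suc i"] Suc.prems by simp
  finally show ?case by simp
qed simp

abbreviation "v \<equiv> dirac \<one>"

lemma P_pow_v: "(P ^^ j) v = (\<lambda>x. of_real (walk j x))"
proof (induction j)
  case 0 show ?case by (auto simp: dirac_def)
next
  case (Suc j)
  have s: "(\<Sum>s\<in>T. shift s a) x = (\<Sum>s\<in>T. shift s a x)" if "finite T" for T a x
    using that by (induction T rule: finite_induct) auto
  have z: "walk j x = 0" if "x \<notin> carrier \<Gamma>" for x using that walk_support W_carrier by blast
  have "(P ^^ Suc j) v = P (\<lambda>x. of_real (walk j x))" using Suc by simp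
  also have "\<dots> = (\<lambda>x. of_real (walk (Suc j) x))"
    unfolding P_def scl_def avg_def fun_eq_iff plus_fun_apply s[OF sgens_finite]
    using z by (auto simp: shift_def)
  finally show ?case .
qed

lemma R_v:
  assumes a: "a \<in> fs" shows "R a v = (\<Sum>x | a x \<noteq> 0. Re (a x) * \<psi> x)"
proof -
  have "{y. v y \<noteq> (0 :: complex)} = {\<one>}" by (auto simp: dirac_def)
  then have "B a v = (\<Sum>x | a x \<noteq> 0. a x * of_real (\<psi> (inv x \<otimes> \<one>)))"
    unfolding B_def by (simp add: dirac_def)
  also have "\<dots> = (\<Sum>x | a x \<noteq> 0. a x * of_real (\<psi> x))"
    using fs_support[OF a] by (intro sum.cong refl) (auto simp: psi_inv)
  finally show ?thesis by (simp add: R_def)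
qed

lemma P_pow_v_fs [simp, intro]: "(P ^^ j) v \<in> fs" by (induction j) auto

lemma R_pow_v: "R ((P ^^ j) v) v = moment \<psi> j"
  unfolding R_v[OF P_pow_v_fs] moment_def unfolding P_pow_v
  using walk_support[of j] by (intro sum.mono_neutral_cong_left) auto

lemma N_v: "(N v)\<^sup>2 = \<psi> \<one>"
  using R_self[of v] R_pow_v[of 0] by (simp add: moment_def)

text \<open>The vector \<open>v\<close> has total 1 and is out of reach of the gap, but
  \<open>u = v - P v\<close> lies in \<open>E0\<close>. The moment difference is the pairing of
  \<open>(P ^^ (2 * k)) u\<close> with \<open>v\<close>, which decays; and
  \<open>v - (P ^^ k) v\<close> is the sum of the \<open>(P ^^ i) u\<close> for
  \<open>i < k\<close>, a geometric sum of norm at most \<open>N u / c\<close> whatever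
  \<open>k\<close> is.\<close>

lemma moment_decay:
  assumes g: "\<And>u. u \<in> E0 \<Longrightarrow> R (P u) u \<le> (1 - c) * (N u)\<^sup>2" and c: "0 < c" "c < 1"
  shows "moment \<psi> (2 * k) - moment \<psi> (Suc (2 * k)) \<le> (1 - c) ^ k * \<psi> \<one>"
    and "c\<^sup>2 * (moment \<psi> 0 - 2 * moment \<psi> k + moment \<psi> (2 * k)) \<le> moment \<psi> 0 - moment \<psi> 1"
proof -
  define u where "u = v - P v"
  have uE: "u \<in> E0" by (auto simp: u_def E0_def total_add[of v "- P v", simplified] total_P
      total_scl[of "P v" "- 1", simplified scl_minus_one])
  have uf: "u \<in> fs" using uE by (rule E0_fs)
  have pE: "(P ^^ j) u \<in> E0" for j using uE by (induction j) auto
  have pf: "(P ^^ j) u \<in> fs" for j using pE by (rule E0_fs)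
  have pN: "N ((P ^^ j) u) \<le> (1 - c) ^ j * N u" for j
  proof (induction j)
    case (Suc j)
    have "N (P ((P ^^ j) u)) \<le> (1 - c) * N ((P ^^ j) u)" by (rule contraction[OF g c pE])
    also have "\<dots> \<le> (1 - c) * ((1 - c) ^ j * N u)" using Suc c by (intro mult_left_mono) auto
    finally show ?case by simp
  qed simp
  have pd: "(P ^^ j) u = (P ^^ j) v - (P ^^ Suc j) v" for j
  proof (induction j)
    case (Suc j)
    have "(P ^^ Suc j) u = P ((P ^^ j) v - (P ^^ Suc j) v)" by (simp only: Suc funpow.simps o_apply)
    also have "\<dots> = (P ^^ Suc j) v - (P ^^ Suc (Suc j)) v" by (simp only: P_diff funpow.simps o_apply)
    finally show ?case .
  qed (simp add: u_def)
  \<comment> \<open>Expanding the square leaves \<open>(N (P v))\<^sup>2 - 2 * R (P v) v\<close>;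
    since the square of \<open>P\<close> is at most \<open>P\<close>, this is at most
    \<open>- R (P v) v\<close>.\<close>
  have Nu: "(N u)\<^sup>2 \<le> moment \<psi> 0 - moment \<psi> 1"
  proof -
    have "(N u)\<^sup>2 = (N v)\<^sup>2 - 2 * R (P v) v + (N (P v))\<^sup>2"
      unfolding u_def using R_sym[of v "P v"] by (simp add: N_diff_sq R_def)
    also have "\<dots> \<le> (N v)\<^sup>2 - R (P v) v" using N_P_sq_le[of v] by simp
    finally show ?thesis using R_pow_v[of 1] R_pow_v[of 0] R_self[of v] by simp
  qed
  have "R (P v) v \<ge> 0" using R_P_bounds(1)[of v] by simp
  then have Nuv: "(N u)\<^sup>2 \<le> (N v)\<^sup>2" using Nu R_pow_v[of 1] R_pow_v[of 0] R_self[of v] by simp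
  then have Nuv': "N u \<le> N v" by (rule power2_le_imp_le) auto
  have "moment \<psi> (2 * k) - moment \<psi> (Suc (2 * k)) = R ((P ^^ (2 * k)) u) v"
    unfolding pd by (simp only: R_diff_left[OF P_pow_v_fs P_pow_v_fs fs_dirac[OF one_closed]] R_pow_v)
  also have "\<dots> = R ((P ^^ k) u) ((P ^^ k) v)"
    using uf by (simp add: R_pow mult_2)
  also have "\<dots> = R ((P ^^ (k + k)) u) v" using uf by (simp add: R_pow)
  also have "\<dots> \<le> N ((P ^^ (k + k)) u) * N v" using Re_B_le[OF pf[of "k + k"], of v] by (auto simp: R_def)
  also have "\<dots> \<le> ((1 - c) ^ (k + k) * N u) * N v" using pN by (intro mult_right_mono) auto
  also have "\<dots> \<le> ((1 - c) ^ k * N v) * N v"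
    using c Nuv' uf by (intro mult_right_mono mult_mono power_decreasing) auto
  finally show "moment \<psi> (2 * k) - moment \<psi> (Suc (2 * k)) \<le> (1 - c) ^ k * \<psi> \<one>"
    unfolding N_v[symmetric] by (simp add: power2_eq_square algebra_simps)
  have "N (v - (P ^^ k) v) \<le> (\<Sum>i<k. (1 - c) ^ i) * N u"
  proof (induction k)
    case (Suc k)
    have "v - (P ^^ Suc k) v = (v - (P ^^ k) v) + (P ^^ k) u" unfolding pd by simp
    then have "N (v - (P ^^ Suc k) v) = N ((v - (P ^^ k) v) + (P ^^ k) u)" by (rule arg_cong)
    also have "\<dots> \<le> N (v - (P ^^ k) v) + N ((P ^^ k) u)"
      using pf by (intro N_triangle) auto
    also have "\<dots> \<le> (\<Sum>i<k. (1 - c) ^ i) * N u + (1 - c) ^ k * N u"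
      by (intro add_mono Suc pN)
    also have "\<dots> = (\<Sum>i<Suc k. (1 - c) ^ i) * N u" by (simp add: algebra_simps)
    finally show ?case .
  qed simp
  also have "\<dots> \<le> 1 / c * N u"
  proof (rule mult_right_mono)
    have "(\<Sum>i<k. (1 - c) ^ i) = (1 - (1 - c) ^ k) / c" using c by (simp add: sum_gp_strict)
    also have "\<dots> \<le> 1 / c" using c by (intro divide_right_mono) auto
    finally show "(\<Sum>i<k. (1 - c) ^ i) \<le> 1 / c" .
  qed (use uf in auto)
  finally have "c * N (v - (P ^^ k) v) \<le> N u" using c by (simp add: field_simps)
  then have "(c * N (v - (P ^^ k) v))\<^sup>2 \<le> (N u)\<^sup>2" using c by (intro power_mono) auto
  then have "c\<^sup>2 * (N (v - (P ^^ k) v))\<^sup>2 \<le> moment \<psi> 0 - moment \<psi> 1"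
    using Nu by (simp add: power_mult_distrib)
  moreover have "(N (v - (P ^^ k) v))\<^sup>2 = moment \<psi> 0 - 2 * moment \<psi> k + moment \<psi> (2 * k)"
  proof -
    have "(N (v - (P ^^ k) v))\<^sup>2 = (N v)\<^sup>2 - 2 * R v ((P ^^ k) v) + (N ((P ^^ k) v))\<^sup>2"
      by (simp add: N_diff_sq R_def)
    also have "R v ((P ^^ k) v) = moment \<psi> k" using R_sym[of "(P ^^ k) v" v] by (simp add: R_pow_v)
    also have "(N ((P ^^ k) v))\<^sup>2 = moment \<psi> (2 * k)"
      using R_self[OF P_pow_v_fs[of k]] by (simp add: R_pow R_pow_v mult_2)
    also have "(N v)\<^sup>2 = moment \<psi> 0" using R_self[of v] R_pow_v[of 0] by simp
    finally show ?thesis .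
  qed
  ultimately show "c\<^sup>2 * (moment \<psi> 0 - 2 * moment \<psi> k + moment \<psi> (2 * k)) \<le> moment \<psi> 0 - moment \<psi> 1"
    by simp
qed

end

lemma (in fg_group) property_T_moments:
  assumes "property_T \<Gamma>"
  obtains c where "0 < c" "c < 1"
    "\<And>\<psi> k. pos_def_function \<Gamma> \<psi> \<Longrightarrow>
      moment \<psi> (2 * k) - moment \<psi> (Suc (2 * k)) \<le> (1 - c) ^ k * \<psi> \<one>"
    "\<And>\<psi> k. pos_def_function \<Gamma> \<psi> \<Longrightarrow>
      c\<^sup>2 * (moment \<psi> 0 - 2 * moment \<psi> k + moment \<psi> (2 * k)) \<le> moment \<psi> 0 - moment \<psi> 1"
proof -
  obtain Q \<epsilon> where Q: "finite Q" "Q \<subseteq> carrier \<Gamma>" and \<epsilon>: "0 < \<epsilon>"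
    and T: "\<And>(H :: (complex, 'g \<Rightarrow> complex) module) ip \<pi>. \<lbrakk>unitary_rep \<Gamma> H ip \<pi>;
      \<exists>v\<in>carrier H. v \<noteq> \<zero>\<^bsub>H\<^esub> \<and> (\<forall>g\<in>Q. hnorm ip (\<pi> g v \<ominus>\<^bsub>H\<^esub> v) < \<epsilon> * hnorm ip v)\<rbrakk>
      \<Longrightarrow> \<exists>w\<in>carrier H. w \<noteq> \<zero>\<^bsub>H\<^esub> \<and> (\<forall>g\<in>carrier \<Gamma>. \<pi> g w = w)"
    using assms unfolding property_T_def by auto
  obtain l where l: "l \<ge> 1" "Q \<subseteq> W l" using W_cover[OF Q] by blast
  \<comment> \<open>The constant is fixed before \<open>\<psi>\<close> and \<open>k\<close>. The
    minimum with 1/2 keeps it below 1.\<close>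
  define c where "c = min (1 / 2) (\<epsilon>\<^sup>2 / (4 * d * l\<^sup>2))"
  have c: "0 < c" "c < 1" using \<epsilon> l d_pos by (auto simp: c_def)
  have gap': "pos_def_walk.R \<Gamma> \<psi> (pos_def_walk.P \<Gamma> S u) u \<le> (1 - c) * (pos_def_function.N \<Gamma> \<psi> u)\<^sup>2"
    if psi: "pos_def_function \<Gamma> \<psi>" and u: "u \<in> pos_def_function.E0 \<Gamma>" for \<psi> u
  proof -
    interpret pos_def_walk \<Gamma> \<psi> S
      using psi fg_group_axioms by (simp add: pos_def_walk_def)
    have uf: "u \<in> fs" using u by (rule E0_fs)
    show ?thesis
    proof (cases "N u = 0")
      case True
      then show ?thesis using R_P_bounds(2)[OF uf] by simp
    next
      case False
      then have "N u > 0" using N_nonneg[OF uf] by linarith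
      then have "\<exists>q\<in>Q. \<epsilon> * N u \<le> N (shift q u - u)"
        by (intro kazhdan Q(2) u) (rule T)
      then obtain q where q: "q \<in> Q" "\<epsilon> * N u \<le> N (shift q u - u)" by blast
      have "R (P u) u \<le> (1 - \<epsilon>\<^sup>2 / (4 * d * l\<^sup>2)) * (N u)\<^sup>2"
        using gap[of q l] q l \<epsilon> uf by auto
      also have "\<dots> \<le> (1 - c) * (N u)\<^sup>2" by (intro mult_right_mono) (auto simp: c_def)
      finally show ?thesis .
    qed
  qed
  show ?thesis
  proof (rule that[OF c])
    fix \<psi> k assume psi: "pos_def_function \<Gamma> \<psi>"
    then interpret pos_def_walk \<Gamma> \<psi> S
      using fg_group_axioms by (simp add: pos_def_walk_def)
    show "moment \<psi> (2 * k) - moment \<psi> (Suc (2 * k)) \<le> (1 - c) ^ k * \<psi> \<one>"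
      "c\<^sup>2 * (moment \<psi> 0 - 2 * moment \<psi> k + moment \<psi> (2 * k)) \<le> moment \<psi> 0 - moment \<psi> 1"
      using moment_decay[OF gap'[OF psi] c] by blast+
  qed
qed

section \<open>Functions that are positive definite on a ball\<close>

context fg_group
begin

text \<open>Coefficients live on \<open>W M\<close>, so the condition reads \<open>\<psi>\<close> on
  \<open>W (M + M)\<close>. The normalization at \<open>\<one>\<close> bounds \<open>\<psi>\<close>
  on \<open>W M\<close>, which provides the compactness.\<close>

definition local_pd :: "nat \<Rightarrow> ('g \<Rightarrow> real) \<Rightarrow> bool" where
  "local_pd M \<psi> \<longleftrightarrow> \<psi> \<one> = 1 \<and> (\<forall>x\<in>W M. \<psi> (inv x) = \<psi> x) \<and>
     (\<forall>c. 0 \<le> (\<Sum>x\<in>W M. \<Sum>y\<in>W M. c x * c y * \<psi> (inv x \<otimes> y)))"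

lemma local_pd_subset:
  assumes "local_pd M \<psi>" "A \<subseteq> W M"
  shows "0 \<le> (\<Sum>x\<in>A. \<Sum>y\<in>A. c x * c y * \<psi> (inv x \<otimes> y))"
proof -
  define c' where "c' x = (if x \<in> A then c x else 0)" for x
  have "(\<Sum>x\<in>A. \<Sum>y\<in>A. c x * c y * \<psi> (inv x \<otimes> y)) = (\<Sum>x\<in>A. \<Sum>y\<in>A. c' x * c' y * \<psi> (inv x \<otimes> y))"
    by (intro sum.cong refl) (auto simp: c'_def)
  also have "\<dots> = (\<Sum>x\<in>A. \<Sum>y\<in>W M. c' x * c' y * \<psi> (inv x \<otimes> y))"
    using assms(2) by (intro sum.cong refl sum.mono_neutral_left) (auto simp: c'_def)
  also have "\<dots> = (\<Sum>x\<in>W M. \<Sum>y\<in>W M. c' x * c' y * \<psi> (inv x \<otimes> y))"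
    using assms(2) by (intro sum.mono_neutral_left) (auto simp: c'_def)
  finally show ?thesis using assms(1) by (simp add: local_pd_def)
qed

lemma local_pd_mono: "local_pd M \<psi> \<Longrightarrow> M' \<le> M \<Longrightarrow> local_pd M' \<psi>"
  unfolding local_pd_def[of M'] using local_pd_subset[of M \<psi> "W M'"] W_mono[of M' M]
  by (auto simp: local_pd_def)

text \<open>Positivity on the two points \<open>\<one>\<close> and \<open>x\<close> with
  coefficients 1 and \<open>\<sigma> = \<plusminus>1\<close> reads
  \<open>0 \<le> 2 + 2 * \<sigma> * \<psi> x\<close>. For \<open>x = \<one>\<close> there is only
  one point, hence the case distinction.\<close>

lemma local_pd_bounded:
  assumes "local_pd M \<psi>" "x \<in> W M" shows "\<bar>\<psi> x\<bar> \<le> 1"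
proof -
  have xc: "x \<in> carrier \<Gamma>" using assms W_carrier by blast
  have two: "0 \<le> 2 + 2 * \<sigma> * \<psi> x" if \<sigma>: "\<sigma> * \<sigma> = 1" for \<sigma>
  proof (cases "x = \<one>")
    case True
    have "\<sigma> = 1 \<or> \<sigma> = - 1" using \<sigma> square_eq_1_iff by blast
    then show ?thesis using True assms by (auto simp: local_pd_def)
  next
    case False
    have psi: "\<psi> \<one> = 1" "\<psi> (inv x) = \<psi> x" using assms by (auto simp: local_pd_def)
    have "0 \<le> (\<Sum>y\<in>{\<one>, x}. \<Sum>z\<in>{\<one>, x}. (if y = x then \<sigma> else 1) * (if z = x then \<sigma> else 1) * \<psi> (inv y \<otimes> z))"
      using assms by (intro local_pd_subset) auto
    also have "\<dots> = 1 + \<sigma> * \<psi> x + (\<sigma> * \<psi> x + \<sigma> * \<sigma>)"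
      using False xc psi by simp
    finally show ?thesis using \<sigma> by simp
  qed
  show ?thesis using two[of 1] two[of "- 1"] by auto
qed

text \<open>If no radius worked, counterexamples of growing radius, cut off to lie in the compact
  cube with sides \<open>{- 1..1}\<close>, would show that the decreasing closed sets
  \<open>C M\<close> all meet the cube. A common point is positive definite on the whole group with
  \<open>\<Phi> \<ge> \<beta>\<close>, which \<open>pd\<close> forbids.\<close>

lemma local_pd_compactness:
  fixes \<Phi> :: "('g \<Rightarrow> real) \<Rightarrow> real"
  assumes cont: "continuous_on UNIV \<Phi>"
    and pd: "\<And>\<psi>. pos_def_function \<Gamma> \<psi> \<Longrightarrow> \<psi> \<one> = 1 \<Longrightarrow> \<Phi> \<psi> \<le> 0"
    and loc: "\<And>\<psi> \<psi>'. (\<And>x. x \<in> W m \<Longrightarrow> \<psi> x = \<psi>' x) \<Longrightarrow> \<Phi> \<psi> = \<Phi> \<psi>'"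
    and \<beta>: "0 < \<beta>"
  shows "\<exists>M. \<forall>\<psi>. local_pd M \<psi> \<longrightarrow> \<Phi> \<psi> \<le> \<beta>"
proof (rule ccontr)
  assume neg: "\<not> ?thesis"
  define X where "X = (PiE UNIV (\<lambda>_. {- 1..1}) :: ('g \<Rightarrow> real) set)"
  have compX: "compact X"
  proof -
    have "compactin (product_topology (\<lambda>_. euclidean) UNIV) X"
      unfolding X_def by (subst compactin_PiE) auto
    then show ?thesis by (simp add: euclidean_product_topology)
  qed
  define C where "C M = {\<psi>. local_pd M \<psi> \<and> \<beta> \<le> \<Phi> \<psi>}" for M
  have ev: "continuous_on UNIV (\<lambda>\<psi> :: 'g \<Rightarrow> real. \<psi> x)" for x by simp
  have closedC: "closed (C M)" for M
  proof -
    have "C M = {\<psi>. \<psi> \<one> = 1} \<inter> (\<Inter>x\<in>W M. {\<psi>. \<psi> (inv x) = \<psi> x}) \<inter>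
       (\<Inter>c. {\<psi>. 0 \<le> (\<Sum>x\<in>W M. \<Sum>y\<in>W M. c x * c y * \<psi> (inv x \<otimes> y))}) \<inter> {\<psi>. \<beta> \<le> \<Phi> \<psi>}"
      by (auto simp: C_def local_pd_def)
    moreover have "closed {\<psi> :: 'g \<Rightarrow> real. \<psi> \<one> = 1}" by (intro closed_Collect_eq ev continuous_on_const)
    moreover have "closed (\<Inter>x\<in>W M. {\<psi> :: 'g \<Rightarrow> real. \<psi> (inv x) = \<psi> x})"
      by (intro closed_INT ballI closed_Collect_eq ev)
    moreover have "closed (\<Inter>c. {\<psi> :: 'g \<Rightarrow> real. 0 \<le> (\<Sum>x\<in>W M. \<Sum>y\<in>W M. c x * c y * \<psi> (inv x \<otimes> y))})"
      by (intro closed_INT ballI closed_Collect_le continuous_on_sum continuous_on_mult continuous_on_const ev)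
    moreover have "closed {\<psi>. \<beta> \<le> \<Phi> \<psi>}"
      by (intro closed_Collect_le continuous_on_const cont)
    ultimately show ?thesis by (simp only: closed_Int)
  qed
  have ne: "X \<inter> C M \<noteq> {}" for M
  proof -
    \<comment> \<open>Bounds on \<open>\<psi>\<close> are known on \<open>W M'\<close> only, so it
      is set to 0 outside to enter the cube. The cut must spare the products
      \<open>inv x \<otimes> y\<close> with \<open>x\<close>, \<open>y\<close> in
      \<open>W M\<close>, which need radius \<open>2 * M\<close>, and the ball \<open>W m\<close>
      that \<open>\<Phi>\<close> reads.\<close>
    define M' where "M' = 2 * M + m"
    obtain \<psi> where \<psi>: "local_pd M' \<psi>" "\<beta> < \<Phi> \<psi>" using neg by (auto simp: not_le)
    define \<psi>' where "\<psi>' x = (if x \<in> W M' then \<psi> x else 0)" for x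
    have "W m \<subseteq> W M'" by (intro W_mono) (simp add: M'_def)
    then have "\<Phi> \<psi>' = \<Phi> \<psi>" by (intro loc) (auto simp: \<psi>'_def)
    moreover have "\<psi>' \<in> X"
      using local_pd_bounded[OF \<psi>(1)] by (auto simp: X_def \<psi>'_def abs_le_iff)
    moreover have "local_pd M \<psi>'"
    proof -
      have l: "local_pd M \<psi>" by (rule local_pd_mono[OF \<psi>(1)]) (simp add: M'_def)
      have "W M \<subseteq> W M'" by (intro W_mono) (simp add: M'_def)
      moreover have "inv x \<otimes> y \<in> W M'" if "x \<in> W M" "y \<in> W M" for x y
        using W_mult[OF W_inv[OF that(1)] that(2)] W_mono[of "M + M" M'] by (auto simp: M'_def)
      ultimately show ?thesis using l W_inv by (auto simp: local_pd_def \<psi>'_def subset_iff cong: sum.cong)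
    qed
    ultimately show ?thesis using \<psi>(2) by (auto simp: C_def)
  qed
  have "X \<inter> (\<Inter>M. C M) \<noteq> {}"
  proof (rule compact_imp_fip_image[OF compX])
    fix I :: "nat set" assume fin: "finite I"
    \<comment> \<open>The sets \<open>C M\<close> decrease with \<open>M\<close>; inserting 0 gives
      the maximum a meaning for empty \<open>I\<close>.\<close>
    have "C (Max (insert 0 I)) \<subseteq> (\<Inter>M\<in>I. C M)"
      using fin by (auto simp: C_def intro: local_pd_mono)
    then show "X \<inter> (\<Inter>M\<in>I. C M) \<noteq> {}" using ne[of "Max (insert 0 I)"] by blast
  qed (rule closedC)
  then obtain \<psi> where \<psi>: "\<And>M. local_pd M \<psi>" "\<beta> \<le> \<Phi> \<psi>" by (auto simp: C_def)
  have "pos_def_function \<Gamma> \<psi>"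
  proof (intro pos_def_function.intro is_group pos_def_function_axioms.intro)
    fix x assume "x \<in> carrier \<Gamma>"
    then show "\<psi> (inv x) = \<psi> x" using W_exhaust \<psi>(1) by (auto simp: local_pd_def)
  next
    fix A and c :: "'g \<Rightarrow> real" assume "finite A" "A \<subseteq> carrier \<Gamma>"
    then obtain l where "A \<subseteq> W l" using W_cover by blast
    then show "0 \<le> (\<Sum>x\<in>A. \<Sum>y\<in>A. c x * c y * \<psi> (inv x \<otimes> y))"
      using local_pd_subset[OF \<psi>(1)] by blast
  qed
  then have "\<Phi> \<psi> \<le> 0" using pd \<psi>(1)[of 0] by (auto simp: local_pd_def)
  then show False using \<psi>(2) \<beta> by simp
qed

lemma continuous_moment: "continuous_on UNIV (\<lambda>\<psi>. moment \<psi> j)"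
  unfolding moment_def by (intro continuous_intros) simp

lemma moment_cong: "(\<And>x. x \<in> W m \<Longrightarrow> \<psi> x = \<psi>' x) \<Longrightarrow> j \<le> m \<Longrightarrow> moment \<psi> j = moment \<psi>' j"
  by (simp add: moment_on cong: sum.cong)

text \<open>Both inequalities involve \<open>\<psi>\<close> on the ball of radius
  \<open>2 * k + 1\<close> only, so compactness applies to each. The radius \<open>M\<close> depends
  on \<open>k\<close> and \<open>\<beta>\<close>, while \<open>c\<close> does not.\<close>

lemma property_T_local_moments:
  assumes "property_T \<Gamma>"
  obtains c where "0 < c" "c < 1"
    "\<And>k \<beta>. 0 < \<beta> \<Longrightarrow> \<exists>M. \<forall>\<psi>. local_pd M \<psi> \<longrightarrow>
      moment \<psi> (2 * k) - moment \<psi> (Suc (2 * k)) \<le> (1 - c) ^ k + \<beta> \<and>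
      c\<^sup>2 * (moment \<psi> 0 - 2 * moment \<psi> k + moment \<psi> (2 * k)) \<le> moment \<psi> 0 - moment \<psi> 1 + \<beta>"
proof -
  obtain c where c: "0 < c" "c < 1"
    and m1: "\<And>\<psi> k. pos_def_function \<Gamma> \<psi> \<Longrightarrow>
      moment \<psi> (2 * k) - moment \<psi> (Suc (2 * k)) \<le> (1 - c) ^ k * \<psi> \<one>"
    and m2: "\<And>\<psi> k. pos_def_function \<Gamma> \<psi> \<Longrightarrow>
      c\<^sup>2 * (moment \<psi> 0 - 2 * moment \<psi> k + moment \<psi> (2 * k)) \<le> moment \<psi> 0 - moment \<psi> 1"
    using property_T_moments[OF assms] by blast
  show ?thesis
  proof (rule that[OF c])
    fix k and \<beta> :: real assume \<beta>: "0 < \<beta>"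
    have "\<exists>M. \<forall>\<psi>. local_pd M \<psi> \<longrightarrow> moment \<psi> (2 * k) - moment \<psi> (Suc (2 * k)) - (1 - c) ^ k \<le> \<beta>"
    proof (rule local_pd_compactness[OF _ _ _ \<beta>])
      show "continuous_on UNIV (\<lambda>\<psi>. moment \<psi> (2 * k) - moment \<psi> (Suc (2 * k)) - (1 - c) ^ k)"
        by (intro continuous_intros continuous_moment)
      show "moment \<psi> (2 * k) - moment \<psi> (Suc (2 * k)) - (1 - c) ^ k
          = moment \<psi>' (2 * k) - moment \<psi>' (Suc (2 * k)) - (1 - c) ^ k"
        if *: "\<And>x. x \<in> W (Suc (2 * k)) \<Longrightarrow> \<psi> x = \<psi>' x" for \<psi> \<psi>'
      proof -
        have "moment \<psi> j = moment \<psi>' j" if "j \<le> Suc (2 * k)" for j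
          by (rule moment_cong[OF *  that])
        then show ?thesis by simp
      qed
      show "moment \<psi> (2 * k) - moment \<psi> (Suc (2 * k)) - (1 - c) ^ k \<le> 0"
        if "pos_def_function \<Gamma> \<psi>" "\<psi> \<one> = 1" for \<psi>
        using m1[OF that(1), of k] that(2) by simp
    qed
    then obtain M1 where M1: "\<And>\<psi>. local_pd M1 \<psi> \<Longrightarrow> moment \<psi> (2 * k) - moment \<psi> (Suc (2 * k)) - (1 - c) ^ k \<le> \<beta>"
      by blast
    define F where "F \<psi> = c\<^sup>2 * (moment \<psi> 0 - 2 * moment \<psi> k + moment \<psi> (2 * k)) - (moment \<psi> 0 - moment \<psi> 1)" for \<psi>
    have "\<exists>M. \<forall>\<psi>. local_pd M \<psi> \<longrightarrow> F \<psi> \<le> \<beta>"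
    proof (rule local_pd_compactness[OF _ _ _ \<beta>])
      show "continuous_on UNIV F"
        unfolding F_def by (intro continuous_intros continuous_moment)
      show "F \<psi> = F \<psi>'"
        if *: "\<And>x. x \<in> W (2 * k + 1) \<Longrightarrow> \<psi> x = \<psi>' x" for \<psi> \<psi>'
      proof -
        have "moment \<psi> j = moment \<psi>' j" if "j \<le> 2 * k + 1" for j
          by (rule moment_cong[OF * that])
        then show ?thesis by (simp add: F_def)
      qed
    qed (use m2[of _ k] in \<open>simp add: F_def\<close>)
    then obtain M2 where M2: "\<And>\<psi>. local_pd M2 \<psi> \<Longrightarrow> F \<psi> \<le> \<beta>"
      by blast
    show "\<exists>M. \<forall>\<psi>. local_pd M \<psi> \<longrightarrow>
      moment \<psi> (2 * k) - moment \<psi> (Suc (2 * k)) \<le> (1 - c) ^ k + \<beta> \<and>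
      c\<^sup>2 * (moment \<psi> 0 - 2 * moment \<psi> k + moment \<psi> (2 * k)) \<le> moment \<psi> 0 - moment \<psi> 1 + \<beta>"
    proof (intro exI[of _ "max M1 M2"] allI impI)
      fix \<psi> assume "local_pd (max M1 M2) \<psi>"
      then have "local_pd M1 \<psi>" "local_pd M2 \<psi>" by (auto intro: local_pd_mono)
      then show "moment \<psi> (2 * k) - moment \<psi> (Suc (2 * k)) \<le> (1 - c) ^ k + \<beta> \<and>
        c\<^sup>2 * (moment \<psi> 0 - 2 * moment \<psi> k + moment \<psi> (2 * k)) \<le> moment \<psi> 0 - moment \<psi> 1 + \<beta>"
        using M1[of \<psi>] M2[of \<psi>] by (simp add: F_def)
    qed
  qed
qed

end

section \<open>Automorphisms of balls in the Cayley graph\<close>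

context fg_group
begin

definition adj :: "'g \<Rightarrow> 'g \<Rightarrow> bool" where "adj u v \<longleftrightarrow> inv u \<otimes> v \<in> sgens"

text \<open>Root-preserving automorphisms of a finite ball, which need not extend to the Cayley
  graph. Extending them by the identity outside (\<open>permutes\<close>) makes them a finite group
  under composition.\<close>

definition ball_auts :: "nat \<Rightarrow> ('g \<Rightarrow> 'g) set" where
  "ball_auts K = {h. h permutes W K \<and> h \<one> = \<one> \<and> (\<forall>u\<in>W K. \<forall>v\<in>W K. adj (h u) (h v) \<longleftrightarrow> adj u v)}"

lemma ball_auts_finite [simp, intro]: "finite (ball_auts K)"
  by (rule finite_subset[OF _ finite_permutations[OF W_finite[of K]]]) (auto simp: ball_auts_def)

lemma ball_auts_permutes: "h \<in> ball_auts K \<Longrightarrow> h permutes W K"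
  and ball_auts_one: "h \<in> ball_auts K \<Longrightarrow> h \<one> = \<one>"
  and ball_auts_adj: "\<lbrakk>h \<in> ball_auts K; u \<in> W K; v \<in> W K\<rbrakk> \<Longrightarrow> adj (h u) (h v) \<longleftrightarrow> adj u v"
  by (auto simp: ball_auts_def)

lemma ball_auts_W: "h \<in> ball_auts K \<Longrightarrow> u \<in> W K \<Longrightarrow> h u \<in> W K"
  using permutes_in_image[OF ball_auts_permutes] by blast

lemma ball_auts_inj: "h \<in> ball_auts K \<Longrightarrow> h u = h v \<longleftrightarrow> u = v"
  using permutes_inj[OF ball_auts_permutes] by (metis injD)

lemma ball_auts_id [simp, intro]: "id \<in> ball_auts K"
  by (auto simp: ball_auts_def permutes_id)

lemma ball_auts_comp: "h \<in> ball_auts K \<Longrightarrow> h' \<in> ball_auts K \<Longrightarrow> h \<circ> h' \<in> ball_auts K"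
  using ball_auts_W[of h' K] by (auto simp: ball_auts_def intro: permutes_compose)

lemma ball_auts_inverse: 
  assumes h: "h \<in> ball_auts K" shows "inv_into UNIV h \<in> ball_auts K"
proof -
  have p: "h permutes W K" using h by (rule ball_auts_permutes)
  have p': "inv_into UNIV h permutes W K" by (rule permutes_inv[OF p])
  have hi: "h (inv_into UNIV h u) = u" for u using permutes_inverses[OF p] by simp
  have "inv_into UNIV h \<one> = \<one>" using ball_auts_one[OF h] permutes_inverses(2)[OF p, of \<one>] by simp
  moreover have "adj (inv_into UNIV h u) (inv_into UNIV h v) \<longleftrightarrow> adj u v" if "u \<in> W K" "v \<in> W K" for u v
    using ball_auts_adj[OF h, of "inv_into UNIV h u" "inv_into UNIV h v"] that hi
      permutes_in_image[OF p'] by simp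
  ultimately show ?thesis using p' by (simp add: ball_auts_def)
qed

lemma adj_translate: "\<lbrakk>g \<in> carrier \<Gamma>; u \<in> carrier \<Gamma>; v \<in> carrier \<Gamma>\<rbrakk> \<Longrightarrow> adj (g \<otimes> u) (g \<otimes> v) \<longleftrightarrow> adj u v"
proof -
  assume c: "g \<in> carrier \<Gamma>" "u \<in> carrier \<Gamma>" "v \<in> carrier \<Gamma>"
  have "inv (g \<otimes> u) \<otimes> (g \<otimes> v) = inv u \<otimes> (inv g \<otimes> (g \<otimes> v))" using c by (simp add: inv_mult_group m_assoc)
  also have "inv g \<otimes> (g \<otimes> v) = v" using c by (simp add: m_assoc[symmetric])
  finally show ?thesis by (simp add: adj_def)
qed

lemma mult_insert_inv:
  assumes "a \<in> carrier \<Gamma>" "b \<in> carrier \<Gamma>" "c \<in> carrier \<Gamma>"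
  shows "a \<otimes> c = (a \<otimes> b) \<otimes> (inv b \<otimes> c)"
proof -
  have "b \<otimes> (inv b \<otimes> c) = c" using assms by (simp add: m_assoc[symmetric])
  then show ?thesis using assms by (simp add: m_assoc)
qed

text \<open>The path from \<open>y\<close> to \<open>y \<otimes> u\<close> spelled by a word for
  \<open>u\<close> stays in \<open>W K\<close>, and \<open>h\<close> sends its edges to
  edges.\<close>

lemma ball_auts_displacement:
  assumes h: "h \<in> ball_auts K" and y: "y \<in> W m"
  shows "u \<in> W j \<Longrightarrow> m + j \<le> K \<Longrightarrow> inv (h y) \<otimes> h (y \<otimes> u) \<in> W j"
proof (induction j arbitrary: u)
  case 0
  have "h y \<in> W K" using ball_auts_W[OF h] W_mono[of m K] y 0 by auto
  then show ?case using 0 y W_carrier by simp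
next
  case (Suc j)
  show ?case
  proof (cases "u \<in> W j")
    case True then show ?thesis using Suc by auto
  next
    case False
    then obtain w s where ws: "w \<in> W j" "s \<in> sgens" "u = w \<otimes> s" using Suc.prems by auto
    have c: "y \<in> carrier \<Gamma>" "w \<in> carrier \<Gamma>" "s \<in> carrier \<Gamma>" using y ws W_carrier by auto
    have in1: "y \<otimes> w \<in> W K" using W_mult[OF y ws(1)] W_mono[of "m + j" K] Suc.prems by auto
    have in2: "y \<otimes> u \<in> W K" using W_mult[OF y Suc.prems(1)] W_mono[of "m + Suc j" K] Suc.prems by auto
    have "adj w u" using c ws by (simp add: adj_def m_assoc[symmetric])
    then have "adj (y \<otimes> w) (y \<otimes> u)" using c ws by (simp add: adj_translate)
    then have "adj (h (y \<otimes> w)) (h (y \<otimes> u))" using ball_auts_adj[OF h in1 in2] by simp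
    then have t: "inv (h (y \<otimes> w)) \<otimes> h (y \<otimes> u) \<in> sgens" by (simp add: adj_def)
    have hc: "h y \<in> carrier \<Gamma>" "h (y \<otimes> w) \<in> carrier \<Gamma>" "h (y \<otimes> u) \<in> carrier \<Gamma>"
      using ball_auts_W[OF h] in1 in2 y W_mono[of m K] Suc.prems W_carrier by auto
    have "inv (h y) \<otimes> h (y \<otimes> u) = (inv (h y) \<otimes> h (y \<otimes> w)) \<otimes> (inv (h (y \<otimes> w)) \<otimes> h (y \<otimes> u))"
      by (rule mult_insert_inv) (use hc in auto)
    moreover have "inv (h y) \<otimes> h (y \<otimes> w) \<in> W j" using Suc ws by simp
    ultimately show ?thesis using W_SucI[OF _ t] by simp
  qed
qed

text \<open>The map \<open>h\<close> seen from \<open>y\<close>: translate \<open>\<one>\<close> to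
  \<open>y\<close>, apply \<open>h\<close>, translate \<open>h y\<close> back to
  \<open>\<one>\<close>. Moving the root costs radius, so the result is an automorphism of a smaller
  ball \<open>W n\<close> and is completed by the identity.\<close>

definition twist :: "nat \<Rightarrow> ('g \<Rightarrow> 'g) \<Rightarrow> 'g \<Rightarrow> 'g \<Rightarrow> 'g" where
  "twist n h y u = (if u \<in> W n then inv (h y) \<otimes> h (y \<otimes> u) else u)"

lemma W_mult_le: "x \<in> W i \<Longrightarrow> y \<in> W j \<Longrightarrow> i + j \<le> k \<Longrightarrow> x \<otimes> y \<in> W k"
  using W_mult W_mono by blast

lemma twist_ball_auts:
  assumes h: "h \<in> ball_auts K" and y: "y \<in> W m" and le: "m + n \<le> K"
  shows "twist n h y \<in> ball_auts n"
proof -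
  have yc: "y \<in> carrier \<Gamma>" using y W_carrier by blast
  have yK: "y \<in> W K" using y W_mono[of m K] le by auto
  have hyc: "h y \<in> carrier \<Gamma>" using ball_auts_W[OF h yK] W_carrier by blast
  have inK: "y \<otimes> u \<in> W K" if "u \<in> W n" for u using W_mult_le[OF y that le] .
  have hc: "h (y \<otimes> u) \<in> carrier \<Gamma>" if "u \<in> W n" for u using ball_auts_W[OF h inK[OF that]] W_carrier by blast
  have "twist n h y ` W n \<subseteq> W n"
    using ball_auts_displacement[OF h y _ le] by (auto simp: twist_def)
  moreover have inj: "inj_on (twist n h y) (W n)"
  proof (rule inj_onI)
    fix u v assume uv: "u \<in> W n" "v \<in> W n" "twist n h y u = twist n h y v"
    then have "h (y \<otimes> u) = h (y \<otimes> v)" using hc hyc by (simp add: twist_def)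
    then have "y \<otimes> u = y \<otimes> v" using ball_auts_inj[OF h] by blast
    moreover have "u \<in> carrier \<Gamma>" "v \<in> carrier \<Gamma>" using uv W_carrier by auto
    ultimately show "u = v" using yc by simp
  qed
  ultimately have "bij_betw (twist n h y) (W n) (W n)"
    by (simp add: bij_betw_def endo_inj_surj)
  then have "twist n h y permutes W n"
    by (rule bij_imp_permutes) (simp add: twist_def)
  moreover have "twist n h y \<one> = \<one>" using yc hyc by (simp add: twist_def)
  moreover have "adj (twist n h y u) (twist n h y v) \<longleftrightarrow> adj u v" if "u \<in> W n" "v \<in> W n" for u v
  proof -
    have "adj (twist n h y u) (twist n h y v) \<longleftrightarrow> adj (h (y \<otimes> u)) (h (y \<otimes> v))"
      using that hc hyc by (simp add: twist_def adj_translate)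
    also have "\<dots> \<longleftrightarrow> adj (y \<otimes> u) (y \<otimes> v)" using ball_auts_adj[OF h] inK that by blast
    also have "\<dots> \<longleftrightarrow> adj u v" using that yc W_carrier by (simp add: adj_translate)
    finally show ?thesis .
  qed
  ultimately show ?thesis by (simp add: ball_auts_def)
qed

lemma ball_auts_ball: "h \<in> ball_auts K \<Longrightarrow> u \<in> W j \<Longrightarrow> j \<le> K \<Longrightarrow> h u \<in> W j"
  using ball_auts_displacement[of h K \<one> 0 u j] ball_auts_W[of h K u] W_mono[of j K] W_carrier[of _ K]
    W_carrier[of u j]
  by (auto simp: ball_auts_one)

text \<open>An automorphism fixing the root preserves the smaller balls; re-rooting at
  \<open>\<one>\<close> is therefore plain restriction.\<close>

lemma ball_auts_restrict:
  assumes h: "h \<in> ball_auts K" and le: "n \<le> K"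
  shows "\<exists>h'\<in>ball_auts n. \<forall>u\<in>W n. h' u = h u"
proof (intro bexI ballI)
  show "twist n h \<one> \<in> ball_auts n" by (rule twist_ball_auts[OF h, of _ 0]) (use le in auto)
  fix u assume u: "u \<in> W n"
  then have "u \<in> carrier \<Gamma>" "h u \<in> carrier \<Gamma>"
    using W_carrier ball_auts_ball[OF h u le] by auto
  then show "twist n h \<one> u = h u" using u by (simp add: twist_def ball_auts_one[OF h])
qed

lemma ball_auts_sgens: "h \<in> ball_auts K \<Longrightarrow> 1 \<le> K \<Longrightarrow> s \<in> sgens \<Longrightarrow> h s \<in> sgens"
  using ball_auts_adj[of h K \<one> s] W_mono[of 1 K] sgens_W[of s] ball_auts_W[of h K s] W_carrier[of "h s" K]
  by (auto simp: adj_def ball_auts_one)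

text \<open>The walk depends only on the graph structure. Removing the first step \<open>s\<close>
  replaces \<open>h\<close> by \<open>twist (K - 1) h s\<close> and \<open>x\<close> by
  \<open>inv s \<otimes> x\<close>: one unit of radius is lost and the length of the point grows by
  one, hence the \<open>2 * j\<close>.\<close>

lemma walk_ball_auts:
  "h \<in> ball_auts K \<Longrightarrow> x \<in> W i \<Longrightarrow> i + 2 * j \<le> K \<Longrightarrow> walk j (h x) = walk j x"
proof (induction j arbitrary: h K x i)
  case 0
  then have "h x = \<one> \<longleftrightarrow> x = \<one>" using ball_auts_inj[of h K x \<one>] ball_auts_one by force
  then show ?case by simp
next
  case (Suc j)
  have xK: "x \<in> W K" using Suc.prems W_mono[of i K] by auto
  then have c: "x \<in> carrier \<Gamma>" "h x \<in> carrier \<Gamma>" using ball_auts_W Suc.prems W_carrier by blast+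
  have "h ` sgens \<subseteq> sgens" using ball_auts_sgens[OF Suc.prems(1)] Suc.prems(3) by auto
  moreover have "inj_on h sgens" using ball_auts_inj[OF Suc.prems(1)] by (auto simp: inj_on_def)
  ultimately have "bij_betw h sgens sgens"
    using endo_inj_surj[OF sgens_finite] by (auto simp: bij_betw_def)
  \<comment> \<open>The first step \<open>s\<close> of walks to \<open>x\<close> is matched with the
    first step \<open>h s\<close> of walks to \<open>h x\<close>.\<close>
  then have "(\<Sum>s\<in>sgens. walk j (inv s \<otimes> h x)) = (\<Sum>s\<in>sgens. walk j (inv (h s) \<otimes> h x))"
    by (rule sum.reindex_bij_betw[symmetric])
  also have "\<dots> = (\<Sum>s\<in>sgens. walk j (inv s \<otimes> x))"
  proof (rule sum.cong[OF refl])
    fix s assume s: "s \<in> sgens"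
    have x': "inv s \<otimes> x \<in> W (1 + i)" using s sgens_W[of "inv s"] Suc.prems(2) by (intro W_mult) auto
    have t: "twist (K - 1) h s \<in> ball_auts (K - 1)"
      using s sgens_W[of s] Suc.prems by (intro twist_ball_auts[where K = K and m = 1]) auto
    have "walk j (twist (K - 1) h s (inv s \<otimes> x)) = walk j (inv s \<otimes> x)"
      by (rule Suc.IH[OF t x']) (use Suc.prems in simp)
    moreover have "inv s \<otimes> x \<in> W (K - 1)" by (rule subsetD[OF W_mono x']) (use Suc.prems(3) in arith)
    then have "twist (K - 1) h s (inv s \<otimes> x) = inv (h s) \<otimes> h x"
      using s c by (simp add: twist_def m_assoc[symmetric])
    ultimately show "walk j (inv (h s) \<otimes> h x) = walk j (inv s \<otimes> x)" by simp
  qed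
  finally show ?case using c Suc.IH[OF Suc.prems(1,2)] Suc.prems(3) by simp
qed

section \<open>Stable orbits and equidistribution of ratios\<close>

definition orb :: "nat \<Rightarrow> 'g \<Rightarrow> 'g set" where "orb K g = (\<lambda>h. h g) ` ball_auts K"

lemma orb_antimono: "g \<in> W n \<Longrightarrow> n \<le> K \<Longrightarrow> K \<le> K' \<Longrightarrow> orb K' g \<subseteq> orb K g"
proof
  fix z assume a: "g \<in> W n" "n \<le> K" "K \<le> K'" "z \<in> orb K' g"
  then obtain h where h: "h \<in> ball_auts K'" "z = h g" by (auto simp: orb_def)
  obtain h' where "h' \<in> ball_auts K" "\<forall>u\<in>W K. h' u = h u" using ball_auts_restrict[OF h(1) a(3)] by blast
  moreover have "g \<in> W K" using a W_mono by blast
  ultimately show "z \<in> orb K g" unfolding orb_def h by (intro image_eqI[of _ _ h']) auto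
qed

lemma orb_finite [simp, intro]: "finite (orb K g)" by (simp add: orb_def)

text \<open>The orbits of \<open>g\<close> are finite and shrink as the radius grows, so one of
  least cardinality is final. From then on every image of \<open>g\<close> is also attained by
  automorphisms of all larger balls.\<close>

lemma orb_stable_single:
  assumes "g \<in> W n" shows "\<exists>K0\<ge>n. \<forall>K\<ge>K0. orb K g = orb K0 g"
proof -
  define f where "f K = card (orb (n + K) g)" for K
  obtain K1 where K1: "\<And>K. f K1 \<le> f K" using ex_has_least_nat[of "\<lambda>_. True" 0 f] by auto
  show ?thesis
  proof (intro exI[of _ "n + K1"] conjI allI impI)
    fix K assume K: "n + K1 \<le> K"
    then obtain j where j: "K = n + j" "K1 \<le> j" by (metis add_le_cancel_left le_add1 le_trans nat_le_iff_add)
    have "orb K g \<subseteq> orb (n + K1) g" using assms K by (intro orb_antimono[of g n]) auto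
    moreover have "card (orb (n + K1) g) \<le> card (orb K g)" using K1[of j] by (simp add: f_def j)
    ultimately show "orb K g = orb (n + K1) g" by (intro card_seteq) auto
  qed simp
qed

lemma orb_stable: "\<exists>K0\<ge>n. \<forall>g\<in>W n. \<forall>K\<ge>K0. orb K g = orb K0 g"
proof -
  have "\<forall>g\<in>W n. \<exists>K0\<ge>n. \<forall>K\<ge>K0. orb K g = orb K0 g" using orb_stable_single by blast
  then obtain f where f: "\<forall>g\<in>W n. f g \<ge> n \<and> (\<forall>K\<ge>f g. orb K g = orb (f g) g)" by metis
  define K0 where "K0 = Max (f ` W n)"
  have le: "f g \<le> K0" if "g \<in> W n" for g unfolding K0_def using that by (intro Max_ge) auto
  show ?thesis
  proof (intro exI[of _ K0] conjI ballI allI impI)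
    show "n \<le> K0" using f le one_W[of n] by (meson le_trans)
    fix g K assume "g \<in> W n" "K0 \<le> K"
    then show "orb K g = orb K0 g" using f le by (metis le_trans)
  qed
qed

text \<open>The ratio \<open>inv (k x) \<otimes> k z\<close> is the position of \<open>k z\<close>
  seen from \<open>k x\<close>. Composing \<open>k\<close> with \<open>h\<close> re-rooted at
  \<open>inv (k x)\<close> applies \<open>h\<close> to this ratio. The formula for
  \<open>T k x\<close> is there to recover \<open>k x\<close> from \<open>T k\<close>.\<close>

lemma ratio_transform:
  assumes h: "h \<in> ball_auts (a + n)" and x: "x \<in> W a" and z: "z \<in> W n" and an: "a \<le> n"
    and k: "k \<in> ball_auts n"
  defines "T \<equiv> (\<lambda>k. twist n h (inv (k x)) \<circ> k)"
  shows "T k \<in> ball_auts n" and "inv (T k x) \<otimes> T k z = h (inv (k x) \<otimes> k z)"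
    and "T k x = inv (h (inv (k x)))"
proof -
  have kx: "k x \<in> W a" using ball_auts_ball[OF k x an] .
  have y: "inv (k x) \<in> W a" using W_inv[OF kx] .
  have yK: "inv (k x) \<in> W (a + n)" using y W_mono[of a "a + n"] by auto
  have kz: "k z \<in> W n" using ball_auts_W[OF k z] .
  have kxn: "k x \<in> W n" using kx W_mono[OF an] by blast
  have c: "k x \<in> carrier \<Gamma>" "k z \<in> carrier \<Gamma>" using kx kz W_carrier by auto
  have hy: "h (inv (k x)) \<in> carrier \<Gamma>" using ball_auts_W[OF h yK] W_carrier by blast
  have hz: "h (inv (k x) \<otimes> k z) \<in> carrier \<Gamma>" using ball_auts_W[OF h W_mult[OF y kz]] W_carrier by blast
  have "twist n h (inv (k x)) \<in> ball_auts n" by (rule twist_ball_auts[OF h y]) simp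
  then show "T k \<in> ball_auts n" unfolding T_def using k by (rule ball_auts_comp)
  show Tx: "T k x = inv (h (inv (k x)))"
    using kxn c hy by (simp add: T_def twist_def ball_auts_one[OF h])
  have "T k z = inv (h (inv (k x))) \<otimes> h (inv (k x) \<otimes> k z)" using kz by (simp add: T_def twist_def)
  then show "inv (T k x) \<otimes> T k z = h (inv (k x) \<otimes> k z)"
    unfolding Tx using hy hz by (simp add: m_assoc[symmetric])
qed

text \<open>The map \<open>T\<close> injects one fibre into the other: \<open>T k x\<close>
  determines \<open>k x\<close>, thereby the twist that was composed with \<open>k\<close>, and this
  twist is injective.\<close>

lemma card_ratio_le:
  assumes h: "h \<in> ball_auts (a + n)" and x: "x \<in> W a" and z: "z \<in> W n" and an: "a \<le> n"
  shows "card {k \<in> ball_auts n. inv (k x) \<otimes> k z = w} \<le> card {k \<in> ball_auts n. inv (k x) \<otimes> k z = h w}"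
proof (rule card_inj_on_le)
  define T where "T = (\<lambda>k. twist n h (inv (k x)) \<circ> k)"
  have R: "T k \<in> ball_auts n" "inv (T k x) \<otimes> T k z = h (inv (k x) \<otimes> k z)" "T k x = inv (h (inv (k x)))"
    if "k \<in> ball_auts n" for k
    using ratio_transform[OF h x z an that] by (simp_all add: T_def)
  show "T ` {k \<in> ball_auts n. inv (k x) \<otimes> k z = w} \<subseteq> {k \<in> ball_auts n. inv (k x) \<otimes> k z = h w}"
    using R by auto
  show "inj_on T {k \<in> ball_auts n. inv (k x) \<otimes> k z = w}"
  proof (rule inj_onI)
    fix k l assume "k \<in> {k \<in> ball_auts n. inv (k x) \<otimes> k z = w}" "l \<in> {k \<in> ball_auts n. inv (k x) \<otimes> k z = w}"
      and eq: "T k = T l"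
    then have kl: "k \<in> ball_auts n" "l \<in> ball_auts n" by auto
    have W: "inv (k x) \<in> W a" "inv (l x) \<in> W a"
      using ball_auts_ball[OF _ x an] kl W_inv by auto
    then have "inv (k x) \<in> W (a + n)" "inv (l x) \<in> W (a + n)" using W_mono[of a "a + n"] by auto
    then have "h (inv (k x)) \<in> carrier \<Gamma>" "h (inv (l x)) \<in> carrier \<Gamma>"
      using ball_auts_W[OF h] W_carrier by blast+
    moreover have "inv (h (inv (k x))) = inv (h (inv (l x)))" using R(3) kl eq by metis
    ultimately have "h (inv (k x)) = h (inv (l x))" using inv_inv by metis
    then have y: "inv (k x) = inv (l x)" using ball_auts_inj[OF h] by blast
    have tw: "twist n h (inv (k x)) \<in> ball_auts n" by (rule twist_ball_auts[OF h W(1)]) simp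
    show "k = l"
    proof
      fix u
      have "twist n h (inv (k x)) (k u) = twist n h (inv (k x)) (l u)"
        using fun_cong[OF eq, of u] y by (simp add: T_def)
      then show "k u = l u" using ball_auts_inj[OF tw] by blast
    qed
  qed
qed auto

text \<open>Re-rooted at \<open>x\<close>, the map \<open>k\<close> is an automorphism of the ball
  of radius \<open>n - a\<close>, so all ratios lie in the stable orbit of
  \<open>inv x \<otimes> z\<close>. They are equidistributed there because
  \<open>card_ratio_le\<close> compares any two fibres in both directions.\<close>

lemma ratio_average:
  fixes F :: "'g \<Rightarrow> real"
  assumes x: "x \<in> W a" and z: "z \<in> W b" and ab: "a + b \<le> m" 
    and K0: "m \<le> K0" "\<And>g K. g \<in> W m \<Longrightarrow> K0 \<le> K \<Longrightarrow> orb K g = orb K0 g"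
    and n: "K0 + a \<le> n"
  shows "card (orb K0 (inv x \<otimes> z)) * (\<Sum>k\<in>ball_auts n. F (inv (k x) \<otimes> k z))
    = card (ball_auts n) * (\<Sum>w\<in>orb K0 (inv x \<otimes> z). F w)"
proof -
  define g where "g = inv x \<otimes> z"
  define O' where "O' = orb K0 g"
  define r where "r k = inv (k x) \<otimes> k z" for k
  have gm: "g \<in> W m" unfolding g_def using W_mult_le[OF W_inv[OF x] z ab] .
  have zn: "z \<in> W n" using z W_mono[of b n] ab K0(1) n by auto
  have c: "x \<in> carrier \<Gamma>" "z \<in> carrier \<Gamma>" using x z W_carrier by auto
  have rO: "r k \<in> O'" if k: "k \<in> ball_auts n" for k
  proof -
    have t: "twist (n - a) k x \<in> ball_auts (n - a)"
      using n by (intro twist_ball_auts[OF k x]) auto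
    have "g \<in> W (n - a)" by (rule subsetD[OF W_mono gm]) (use K0(1) n in arith)
    then have "twist (n - a) k x g = r k"
      using c by (simp add: twist_def r_def g_def m_assoc[symmetric])
    then have "r k \<in> orb (n - a) g" unfolding orb_def using t by (intro image_eqI[of _ _ "twist (n - a) k x"]) auto
    then show ?thesis using K0(2)[OF gm, of "n - a"] n by (simp add: O'_def)
  qed
  define N where "N w = card {k \<in> ball_auts n. r k = w}" for w
  have le: "N w \<le> N w'" if w: "w \<in> O'" "w' \<in> O'" for w w'
  proof -
    \<comment> \<open>Ratios arise from automorphisms of the smaller ball of radius
      \<open>n - a\<close>, but moving one ratio to another takes automorphisms of the larger ball
      of radius \<open>a + n\<close>. Stability of the orbit bridges the two.\<close>
    have "O' = orb (a + n) g" using K0(2)[OF gm, of "a + n"] n by (simp add: O'_def)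
    then obtain h1 h2 where h: "h1 \<in> ball_auts (a + n)" "w = h1 g" "h2 \<in> ball_auts (a + n)" "w' = h2 g"
      using w by (auto simp: orb_def)
    have "h2 \<circ> inv_into UNIV h1 \<in> ball_auts (a + n)" using h by (intro ball_auts_comp ball_auts_inverse)
    moreover have "(h2 \<circ> inv_into UNIV h1) w = w'"
      using h permutes_inverses(2)[OF ball_auts_permutes[OF h(1)]] by simp
    ultimately show ?thesis using card_ratio_le[OF _ x zn, of "h2 \<circ> inv_into UNIV h1" w] n
      by (simp add: N_def r_def)
  qed
  have g0: "g \<in> O'" unfolding O'_def orb_def using image_eqI[of g "\<lambda>h. h g" id] by auto
  have N: "N w = N g" if "w \<in> O'" for w using le[OF that g0] le[OF g0 that] by simp
  have grp: "(\<Sum>k\<in>ball_auts n. H (r k)) = (\<Sum>w\<in>O'. real (N g) * H w)" for H :: "'g \<Rightarrow> real"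
  proof -
    have "(\<Sum>k\<in>ball_auts n. H (r k)) = (\<Sum>w\<in>O'. \<Sum>k\<in>{k \<in> ball_auts n. r k = w}. H (r k))"
      using rO by (intro sum.group[symmetric]) (auto simp: O'_def)
    also have "\<dots> = (\<Sum>w\<in>O'. real (N g) * H w)"
      using N by (intro sum.cong refl) (simp add: N_def)
    finally show ?thesis .
  qed
  \<comment> \<open>The constant function 1 determines the common size \<open>N g\<close> of the
    fibres.\<close>
  have "real (card (ball_auts n)) = card O' * real (N g)" using grp[of "\<lambda>_. 1"] by simp
  then have "card (ball_auts n) * (\<Sum>w\<in>O'. F w) = card O' * (\<Sum>w\<in>O'. real (N g) * F w)"
    by (simp add: sum_distrib_left mult.assoc)
  then show ?thesis using grp[of F] by (simp add: O'_def g_def r_def)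
qed

text \<open>This replaces unimodularity of the full automorphism group of the Cayley graph: a uniformly
  random automorphism of a large ball stays uniformly random after re-rooting.\<close>

lemma ball_auts_reroot:
  "\<exists>n0\<ge>m. \<forall>n\<ge>n0. \<forall>x\<in>W m. \<forall>z\<in>W m. \<forall>F :: 'g \<Rightarrow> real.
    (\<Sum>k\<in>ball_auts n. F (inv (k x) \<otimes> k z)) = (\<Sum>k\<in>ball_auts n. F (k (inv x \<otimes> z)))"
proof -
  obtain K0 where K0: "2 * m \<le> K0" "\<And>g K. g \<in> W (2 * m) \<Longrightarrow> K0 \<le> K \<Longrightarrow> orb K g = orb K0 g"
    using orb_stable[of "2 * m"] by blast
  show ?thesis
  proof (intro exI[of _ "K0 + m"] conjI allI ballI impI)
    fix n x z and F :: "'g \<Rightarrow> real"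
    assume n: "K0 + m \<le> n" and x: "x \<in> W m" and z: "z \<in> W m"
    have g: "inv x \<otimes> z \<in> W (2 * m)" using W_mult[OF W_inv[OF x] z] by (simp add: mult_2)
    define g where "g = inv x \<otimes> z"
    have gm: "g \<in> W (2 * m)" using g by (simp add: g_def)
    define c where "c = real (card (orb K0 g))"
    have c0: "c \<noteq> 0" using ball_auts_id by (auto simp: c_def orb_def)
    \<comment> \<open>The pairs \<open>x\<close>, \<open>z\<close> and \<open>\<one>\<close>,
      \<open>g\<close> have the same quotient \<open>g\<close>, so both averages equal the average
      of \<open>F\<close> over one stable orbit.\<close>
    have "c * (\<Sum>k\<in>ball_auts n. F (inv (k x) \<otimes> k z)) = card (ball_auts n) * (\<Sum>w\<in>orb K0 g. F w)"
      unfolding c_def g_def by (rule ratio_average[OF x z _ K0 n]) simp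
    moreover have "real (card (orb K0 (inv \<one> \<otimes> g))) * (\<Sum>k\<in>ball_auts n. F (inv (k \<one>) \<otimes> k g))
        = card (ball_auts n) * (\<Sum>w\<in>orb K0 (inv \<one> \<otimes> g). F w)"
      by (rule ratio_average[OF one_W[of 0] gm _ K0]) (use n in auto)
    moreover have "inv \<one> \<otimes> g = g" using W_carrier[OF gm] by simp
    moreover have "(\<Sum>k\<in>ball_auts n. F (inv (k \<one>) \<otimes> k (g))) = (\<Sum>k\<in>ball_auts n. F (k (g)))"
    proof (rule sum.cong[OF refl])
      fix k assume k: "k \<in> ball_auts n"
      have "g \<in> W n" by (rule subsetD[OF W_mono gm]) (use K0(1) n in arith)
      then have "k (g) \<in> carrier \<Gamma>" using ball_auts_W[OF k] W_carrier by blast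
      then show "F (inv (k \<one>) \<otimes> k (g)) = F (k (g))"
        by (simp add: ball_auts_one[OF k])
    qed
    ultimately have "c * (\<Sum>k\<in>ball_auts n. F (inv (k x) \<otimes> k z)) = c * (\<Sum>k\<in>ball_auts n. F (k g))"
      by (simp add: c_def)
    then show "(\<Sum>k\<in>ball_auts n. F (inv (k x) \<otimes> k z)) = (\<Sum>k\<in>ball_auts n. F (k (inv x \<otimes> z)))"
      using c0 by (simp add: g_def)
  qed (use K0 in simp)
qed

end

section \<open>Charts of graphs that are locally the Cayley graph\<close>

context fg_group
begin

section \<open>Edges and balls of the Cayley graph\<close>

lemma cayley_emult:
  assumes "u \<in> carrier \<Gamma>" "w \<in> carrier \<Gamma>"
  shows "emult (cayley_graph \<Gamma> S) {u, w} = (if adj u w then 1 else 0)"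
proof -
  have "(\<exists>g\<in>carrier \<Gamma>. \<exists>s\<in>S. {u, w} = {g, g \<otimes> s}) \<longleftrightarrow> adj u w"
  proof
    assume "\<exists>g\<in>carrier \<Gamma>. \<exists>s\<in>S. {u, w} = {g, g \<otimes> s}"
    then obtain g s where gs: "g \<in> carrier \<Gamma>" "s \<in> S" "{u, w} = {g, g \<otimes> s}" by blast
    then have s: "s \<in> carrier \<Gamma>" using S_carrier by auto
    from gs(3) consider "u = g" "w = g \<otimes> s" | "w = g" "u = g \<otimes> s" by (auto simp: doubleton_eq_iff)
    then show "adj u w"
    proof cases
      case 1
      then have "inv u \<otimes> w = s" using gs(1) s by (simp add: m_assoc[symmetric])
      then show ?thesis using gs(2) by (simp add: adj_def sgens_def)
    next
      case 2
      then have "inv u \<otimes> w = inv s" using gs(1) s by (simp add: inv_mult_group m_assoc)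
      then show ?thesis using gs(2) by (simp add: adj_def sgens_def)
    qed
  next
    assume "adj u w"
    then consider "inv u \<otimes> w \<in> S" | s where "s \<in> S" "inv u \<otimes> w = inv s" by (auto simp: adj_def sgens_def)
    then show "\<exists>g\<in>carrier \<Gamma>. \<exists>s\<in>S. {u, w} = {g, g \<otimes> s}"
    proof cases
      case 1
      have "w = u \<otimes> (inv u \<otimes> w)" using assms by (simp add: m_assoc[symmetric])
      with 1 assms show ?thesis by metis
    next
      case 2
      have s: "s \<in> carrier \<Gamma>" using 2 S_carrier by auto
      have "inv w \<otimes> u = inv (inv u \<otimes> w)" using assms by (simp add: inv_mult_group)
      then have "inv w \<otimes> u = s" using 2 s by simp
      then have "u = w \<otimes> s" using assms s by (metis inv_solve_left)
      then have "{u, w} = {w, w \<otimes> s}" by auto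
      with 2 assms show ?thesis by blast
    qed
  qed
  then show ?thesis by (simp add: cayley_graph_def)
qed

lemma cayley_ball: "ball_verts (cayley_graph \<Gamma> S) \<one> j = W j"
proof (induction j)
  case (Suc j)
  have "{w \<in> carrier \<Gamma>. \<exists>u\<in>W j. emult (cayley_graph \<Gamma> S) {u, w} > 0} = (\<Union>u\<in>W j. (\<lambda>s. u \<otimes> s) ` sgens)"
  proof (intro equalityI subsetI)
    fix w assume "w \<in> {w \<in> carrier \<Gamma>. \<exists>u\<in>W j. emult (cayley_graph \<Gamma> S) {u, w} > 0}"
    then obtain u where u: "w \<in> carrier \<Gamma>" "u \<in> W j" "emult (cayley_graph \<Gamma> S) {u, w} > 0" by blast
    then have "adj u w" using W_carrier cayley_emult by (metis less_irrefl)
    moreover have "w = u \<otimes> (inv u \<otimes> w)" using u W_carrier by (simp add: m_assoc[symmetric])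
    ultimately show "w \<in> (\<Union>u\<in>W j. (\<lambda>s. u \<otimes> s) ` sgens)" using u unfolding adj_def by blast
  next
    fix w assume "w \<in> (\<Union>u\<in>W j. (\<lambda>s. u \<otimes> s) ` sgens)"
    then obtain u s where u: "u \<in> W j" "s \<in> sgens" "w = u \<otimes> s" by blast
    then have "u \<in> carrier \<Gamma>" "w \<in> carrier \<Gamma>" using W_carrier by auto
    moreover have "adj u w" using u W_carrier by (simp add: adj_def m_assoc[symmetric])
    ultimately have "emult (cayley_graph \<Gamma> S) {u, w} = 1" by (simp add: cayley_emult)
    then show "w \<in> {w \<in> carrier \<Gamma>. \<exists>u\<in>W j. emult (cayley_graph \<Gamma> S) {u, w} > 0}"
      using u(1) \<open>w \<in> carrier \<Gamma>\<close> by (auto intro!: bexI[of _ u])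
  qed
  then show ?case using Suc by (simp add: cayley_graph_def)
qed simp

text \<open>A chart of radius \<open>R\<close> at \<open>\<phi> \<one>\<close> is an isomorphism from the ball of the Cayley graph onto the
  ball of \<open>G\<close>; the last clause says that every edge leaving the interior is seen.\<close>

definition chart :: "'v graph \<Rightarrow> nat \<Rightarrow> ('g \<Rightarrow> 'v) \<Rightarrow> bool" where
  "chart G R \<phi> \<longleftrightarrow> inj_on \<phi> (W R) \<and> \<phi> ` W R \<subseteq> verts G \<and>
    (\<forall>u\<in>W R. \<forall>w\<in>W R. emult G {\<phi> u, \<phi> w} = (if adj u w then 1 else 0)) \<and>
    (\<forall>j<R. \<forall>u\<in>W j. \<forall>w\<in>verts G. 0 < emult G {\<phi> u, w} \<longrightarrow> (\<exists>s\<in>sgens. w = \<phi> (u \<otimes> s)))"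

lemma ball_verts_subset: "v \<in> verts G \<Longrightarrow> ball_verts G v r \<subseteq> verts G"
  by (induction r) auto

lemma ball_verts_mono: "i \<le> j \<Longrightarrow> ball_verts G v i \<subseteq> ball_verts G v j"
  by (induction j) (auto simp: le_Suc_eq)

lemma adj_step: "u \<in> carrier \<Gamma> \<Longrightarrow> s \<in> sgens \<Longrightarrow> adj u (u \<otimes> s)"
  by (simp add: adj_def m_assoc[symmetric])

lemma adjE:
  assumes "adj u w" "u \<in> carrier \<Gamma>" "w \<in> carrier \<Gamma>"
  obtains s where "s \<in> sgens" "w = u \<otimes> s"
proof
  show "inv u \<otimes> w \<in> sgens" using assms(1) by (simp add: adj_def)
  show "w = u \<otimes> (inv u \<otimes> w)" using assms by (simp add: m_assoc[symmetric])
qed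

text \<open>The chart is the inverse of \<open>f\<close>. A neighbor of \<open>\<phi> u\<close> with
  \<open>u\<close> in \<open>W j\<close> and \<open>j < R\<close> is still in the ball of radius
  \<open>R\<close>, hence in the domain of \<open>f\<close>; this gives the last clause of
  \<open>chart\<close>.\<close>

lemma rooted_iso_chart:
  assumes v: "v \<in> verts G"
    and iso: "rooted_iso f (ball_graph G v R) v (ball_graph (cayley_graph \<Gamma> S) \<one> R) \<one>"
  shows "\<exists>\<phi>. chart G R \<phi> \<and> \<phi> \<one> = v"
proof -
  let ?B = "ball_verts G v R"
  have bij: "bij_betw f ?B (W R)" and fv: "f v = \<one>"
    and em: "\<And>u w. u \<in> ?B \<Longrightarrow> w \<in> ?B \<Longrightarrow> emult (cayley_graph \<Gamma> S) {f u, f w} = emult G {u, w}"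
  proof -
    show "bij_betw f ?B (W R)" "f v = \<one>"
      using iso by (auto simp: rooted_iso_def ball_graph_def induced_subgraph_def cayley_ball)
    then have fW: "f u \<in> W R" if "u \<in> ?B" for u using that by (auto simp: bij_betw_def)
    fix u w assume uw: "u \<in> ?B" "w \<in> ?B"
    have "emult (ball_graph (cayley_graph \<Gamma> S) \<one> R) {f u, f w} = emult (ball_graph G v R) {u, w}"
      using iso uw unfolding rooted_iso_def by (auto simp: ball_graph_def induced_subgraph_def)
    then show "emult (cayley_graph \<Gamma> S) {f u, f w} = emult G {u, w}"
      using uw fW by (simp add: ball_graph_def induced_subgraph_def cayley_ball)
  qed
  define \<phi> where "\<phi> = inv_into ?B f"
  have \<phi>B: "\<phi> u \<in> ?B" if "u \<in> W R" for u
    using that bij unfolding \<phi>_def bij_betw_def by (metis inv_into_into)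
  have f\<phi>: "f (\<phi> u) = u" if "u \<in> W R" for u
    using that bij unfolding \<phi>_def bij_betw_def by (metis f_inv_into_f)
  have \<phi>f: "\<phi> (f u) = u" if "u \<in> ?B" for u
    using that bij unfolding \<phi>_def bij_betw_def by (metis inv_into_f_f)
  have fW: "f u \<in> W R" if "u \<in> ?B" for u using that bij by (auto simp: bij_betw_def)
  have vB: "v \<in> ?B" using ball_verts_mono[of 0 R G v] by auto
  have emW: "emult G {\<phi> u, \<phi> w} = (if adj u w then 1 else 0)" if "u \<in> W R" "w \<in> W R" for u w
    using em[of "\<phi> u" "\<phi> w"] that \<phi>B f\<phi> cayley_emult W_carrier by (metis (no_types, lifting))
  have ball: "u \<in> W j \<Longrightarrow> j \<le> R \<Longrightarrow> \<phi> u \<in> ball_verts G v j" for j u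
  proof (induction j arbitrary: u)
    case 0
    then show ?case using \<phi>f[OF vB] fv by simp
  next
    case (Suc j)
    show ?case
    proof (cases "u \<in> W j")
      case True then show ?thesis using Suc by auto
    next
      case False
      then obtain w s where ws: "w \<in> W j" "s \<in> sgens" "u = w \<otimes> s" using Suc.prems by auto
      have wR: "w \<in> W R" using ws W_mono[of j R] Suc.prems by auto
      have uR: "u \<in> W R" using Suc.prems W_mono by blast
      have "emult G {\<phi> w, \<phi> u} = 1"
        using emW[OF wR uR] adj_step[of w s] ws W_carrier by simp
      moreover have "\<phi> u \<in> verts G" using \<phi>B[OF uR] ball_verts_subset[OF v] by blast
      moreover have "\<phi> w \<in> ball_verts G v j" using Suc ws by simp
      ultimately show ?thesis by auto
    qed
  qed
  have "chart G R \<phi>"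
    unfolding chart_def
  proof (intro conjI allI impI ballI)
    show "inj_on \<phi> (W R)" by (rule inj_on_inverseI[of _ f]) (rule f\<phi>)
    show "\<phi> ` W R \<subseteq> verts G" using \<phi>B ball_verts_subset[OF v] by blast
    show "emult G {\<phi> u, \<phi> w} = (if adj u w then 1 else 0)" if "u \<in> W R" "w \<in> W R" for u w
      using emW that by blast
    fix j u w assume j: "j < R" and u: "u \<in> W j" and w: "w \<in> verts G" and e: "0 < emult G {\<phi> u, w}"
    have "w \<in> ball_verts G v (Suc j)" using ball[OF u] j w e by auto
    then have wB: "w \<in> ?B" using ball_verts_mono[of "Suc j" R G v] j by auto
    have uR: "u \<in> W R" using u W_mono[of j R] j by auto
    have "adj u (f w)" using emW[OF uR fW[OF wB]] e \<phi>f[OF wB] by (auto split: if_splits)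
    then obtain s where "s \<in> sgens" "f w = u \<otimes> s" using adjE uR fW[OF wB] W_carrier by metis
    then show "\<exists>s\<in>sgens. w = \<phi> (u \<otimes> s)" using \<phi>f[OF wB] by metis
  qed
  moreover have "\<phi> \<one> = v" using \<phi>f[OF vB] fv by simp
  ultimately show ?thesis by blast
qed

lemma chart_inj: "chart G R \<phi> \<Longrightarrow> u \<in> W R \<Longrightarrow> w \<in> W R \<Longrightarrow> \<phi> u = \<phi> w \<longleftrightarrow> u = w"
  by (auto simp: chart_def inj_on_def)

lemma chart_verts: "chart G R \<phi> \<Longrightarrow> u \<in> W R \<Longrightarrow> \<phi> u \<in> verts G"
  by (auto simp: chart_def)

lemma chart_emult: "chart G R \<phi> \<Longrightarrow> u \<in> W R \<Longrightarrow> w \<in> W R \<Longrightarrow> emult G {\<phi> u, \<phi> w} = (if adj u w then 1 else 0)"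
  by (simp add: chart_def)

lemma chart_nbr: "\<lbrakk>chart G R \<phi>; u \<in> W j; j < R; w \<in> verts G; 0 < emult G {\<phi> u, w}\<rbrakk> \<Longrightarrow> \<exists>s\<in>sgens. w = \<phi> (u \<otimes> s)"
  by (simp add: chart_def)

text \<open>Left translations are automorphisms of the Cayley graph, so a chart can be re-rooted at
  any interior point at the expense of radius.\<close>

lemma chart_translate:
  assumes c: "chart G R \<phi>" and x: "x \<in> W m" and le: "m + n \<le> R"
  shows "chart G n (\<lambda>u. \<phi> (x \<otimes> u))"
  unfolding chart_def
proof (intro conjI allI impI ballI)
  have xc: "x \<in> carrier \<Gamma>" using x W_carrier by blast
  have inR: "x \<otimes> u \<in> W R" if "u \<in> W n" for u using W_mult_le[OF x that le] .
  show "inj_on (\<lambda>u. \<phi> (x \<otimes> u)) (W n)"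
  proof (rule inj_onI)
    fix u w assume uw: "u \<in> W n" "w \<in> W n" "\<phi> (x \<otimes> u) = \<phi> (x \<otimes> w)"
    then have "x \<otimes> u = x \<otimes> w" using chart_inj[OF c inR inR] by blast
    moreover have "u \<in> carrier \<Gamma>" "w \<in> carrier \<Gamma>" using uw W_carrier by auto
    ultimately show "u = w" using xc by simp
  qed
  show "(\<lambda>u. \<phi> (x \<otimes> u)) ` W n \<subseteq> verts G" using chart_verts[OF c inR] by auto
  show "emult G {\<phi> (x \<otimes> u), \<phi> (x \<otimes> w)} = (if adj u w then 1 else 0)" if "u \<in> W n" "w \<in> W n" for u w
    using that chart_emult[OF c inR inR] adj_translate[OF xc] W_carrier by metis
  fix j u w assume a: "j < n" "u \<in> W j" "w \<in> verts G" "0 < emult G {\<phi> (x \<otimes> u), w}"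
  have "x \<otimes> u \<in> W (m + j)" using W_mult x a by blast
  moreover have "m + j < R" using a(1) le by simp
  ultimately obtain s where s: "s \<in> sgens" "w = \<phi> ((x \<otimes> u) \<otimes> s)" using chart_nbr[OF c _ _ a(3,4)] by blast
  have "(x \<otimes> u) \<otimes> s = x \<otimes> (u \<otimes> s)" using xc s a W_carrier by (simp add: m_assoc)
  then show "\<exists>s\<in>sgens. w = \<phi> (x \<otimes> (u \<otimes> s))" using s by auto
qed

lemma chart_cong:
  assumes "\<And>u. u \<in> W R \<Longrightarrow> \<phi> u = \<phi>' u" and c: "chart G R \<phi>"
  shows "chart G R \<phi>'"
  unfolding chart_def
proof (intro conjI allI impI ballI)
  show "inj_on \<phi>' (W R)" "\<phi>' ` W R \<subseteq> verts G" using c assms(1) by (auto simp: chart_def cong: inj_on_cong image_cong)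
  show "emult G {\<phi>' u, \<phi>' w} = (if adj u w then 1 else 0)" if "u \<in> W R" "w \<in> W R" for u w
    using that chart_emult[OF c] assms(1) by metis
  fix j u w assume a: "j < R" "u \<in> W j" "w \<in> verts G" "0 < emult G {\<phi>' u, w}"
  have u: "u \<in> W R" using a W_mono[of j R] by auto
  then have "0 < emult G {\<phi> u, w}" using a assms(1) by simp
  then obtain s where s: "s \<in> sgens" "w = \<phi> (u \<otimes> s)" using chart_nbr[OF c a(2,1,3)] by blast
  moreover have "u \<otimes> s \<in> W R" using W_SucI[OF a(2) s(1)] W_mono[of "Suc j" R] a(1) by auto
  ultimately show "\<exists>s\<in>sgens. w = \<phi>' (u \<otimes> s)" using assms(1) by auto
qed

lemma chart_mono:
  assumes c: "chart G R \<phi>" and le: "n \<le> R" shows "chart G n \<phi>"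
proof -
  have "chart G n (\<lambda>u. \<phi> (\<one> \<otimes> u))" by (rule chart_translate[OF c one_W[of 0]]) (use le in simp)
  then show ?thesis by (rule chart_cong[rotated]) (simp add: W_carrier)
qed

lemma chart_comp:
  assumes c: "chart G n \<phi>" and k: "k \<in> ball_auts n" shows "chart G n (\<phi> \<circ> k)"
  unfolding chart_def
proof (intro conjI allI impI ballI)
  show "inj_on (\<phi> \<circ> k) (W n)"
  proof (rule inj_onI)
    fix u w assume "u \<in> W n" "w \<in> W n" "(\<phi> \<circ> k) u = (\<phi> \<circ> k) w"
    then show "u = w" using chart_inj[OF c] ball_auts_W[OF k] ball_auts_inj[OF k] by auto
  qed
  show "(\<phi> \<circ> k) ` W n \<subseteq> verts G" using chart_verts[OF c] ball_auts_W[OF k] by auto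
  show "emult G {(\<phi> \<circ> k) u, (\<phi> \<circ> k) w} = (if adj u w then 1 else 0)" if "u \<in> W n" "w \<in> W n" for u w
    using that chart_emult[OF c] ball_auts_W[OF k] ball_auts_adj[OF k] by simp
  fix j u w assume a: "j < n" "u \<in> W j" "w \<in> verts G" "0 < emult G {(\<phi> \<circ> k) u, w}"
  have u: "u \<in> W n" using a W_mono[of j n] by auto
  have ku: "k u \<in> W j" using ball_auts_ball[OF k a(2)] a(1) by simp
  then obtain s where s: "s \<in> sgens" "w = \<phi> (k u \<otimes> s)" using chart_nbr[OF c _ a(1,3)] a(4) by auto
  have ks: "k u \<otimes> s \<in> W n" using W_SucI[OF ku s(1)] W_mono[of "Suc j" n] a(1) by auto
  then have "k u \<otimes> s \<in> k ` W n" using permutes_image[OF ball_auts_permutes[OF k]] by simp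
  then obtain u' where u': "u' \<in> W n" "k u \<otimes> s = k u'" by blast
  have "adj (k u) (k u \<otimes> s)" using s(1) ku W_carrier by (intro adj_step) auto
  then have "adj u u'" using ball_auts_adj[OF k u u'(1)] u'(2) by simp
  then obtain t where "t \<in> sgens" "u' = u \<otimes> t" using u u' W_carrier adjE by metis
  then show "\<exists>s\<in>sgens. w = (\<phi> \<circ> k) (u \<otimes> s)" using s u' by auto
qed

text \<open>By the last clause of \<open>chart\<close>, applied along paths from the common root,
  \<open>\<phi>'\<close> maps each ball into the image of that ball under \<open>\<phi>\<close>.
  Then \<open>\<phi>'\<close> followed by the inverse of \<open>\<phi>\<close> is an injective
  self-map of a finite ball that preserves adjacency both ways.\<close>

lemma chart_diff:
  assumes c: "chart G n \<phi>" and c': "chart G n \<phi>'" and root: "\<phi> \<one> = \<phi>' \<one>"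
  shows "\<exists>k\<in>ball_auts n. \<forall>u\<in>W n. \<phi>' u = \<phi> (k u)"
proof -
  have sub: "j \<le> n \<Longrightarrow> \<phi>' ` W j \<subseteq> \<phi> ` W j" for j
  proof (induction j)
    case 0 then show ?case using root by simp
  next
    case (Suc j)
    show ?case
    proof
      fix z assume "z \<in> \<phi>' ` W (Suc j)"
      then obtain u where u: "u \<in> W (Suc j)" "z = \<phi>' u" by blast
      show "z \<in> \<phi> ` W (Suc j)"
      proof (cases "u \<in> W j")
        case True then show ?thesis using Suc u by auto
      next
        case False
        then obtain w s where ws: "w \<in> W j" "s \<in> sgens" "u = w \<otimes> s" using u by auto
        obtain y where y: "y \<in> W j" "\<phi>' w = \<phi> y" using Suc ws by (auto simp: image_subset_iff)
        have W': "w \<in> W n" "u \<in> W n" using ws(1) u(1) W_mono[of j n] W_mono[of "Suc j" n] Suc.prems by auto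
        have "emult G {\<phi> y, z} = 1"
          using chart_emult[OF c' W'] adj_step[of w s] ws W_carrier y u by simp
        moreover have "z \<in> verts G" using chart_verts[OF c' W'(2)] u by simp
        ultimately obtain t where "t \<in> sgens" "z = \<phi> (y \<otimes> t)"
          using chart_nbr[OF c y(1), of z] Suc.prems by (metis Suc_le_lessD less_numeral_extra(1))
        then show ?thesis using W_SucI[OF y(1)] by blast
      qed
    qed
  qed
  define k where "k u = (if u \<in> W n then inv_into (W n) \<phi> (\<phi>' u) else u)" for u
  have kW: "k u \<in> W n" and \<phi>k: "\<phi> (k u) = \<phi>' u" if "u \<in> W n" for u
  proof -
    have "\<phi>' u \<in> \<phi> ` W n" using sub[of n] that by auto
    then show "k u \<in> W n" "\<phi> (k u) = \<phi>' u"
      using that by (auto simp: k_def inv_into_into f_inv_into_f)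
  qed
  have "inj_on k (W n)"
  proof (rule inj_onI)
    fix u w assume "u \<in> W n" "w \<in> W n" "k u = k w"
    then show "u = w" using \<phi>k chart_inj[OF c'] by metis
  qed
  moreover have "k ` W n \<subseteq> W n" using kW by auto
  ultimately have "bij_betw k (W n) (W n)" by (simp add: bij_betw_def endo_inj_surj)
  then have "k permutes W n" by (rule bij_imp_permutes) (simp add: k_def)
  moreover have "k \<one> = \<one>" using chart_inj[OF c kW[OF one_W] one_W] \<phi>k[OF one_W] root by simp
  moreover have "adj (k u) (k w) \<longleftrightarrow> adj u w" if "u \<in> W n" "w \<in> W n" for u w
  proof -
    have "emult G {\<phi>' u, \<phi>' w} = (if adj (k u) (k w) then 1 else 0)"
      using chart_emult[OF c kW[OF that(1)] kW[OF that(2)]] by (simp only: \<phi>k that)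
    then have "(if adj (k u) (k w) then 1 else 0 :: nat) = (if adj u w then 1 else 0)"
      by (rule trans[OF sym chart_emult[OF c' that]])
    then show ?thesis by (cases "adj u w"; cases "adj (k u) (k w)") simp_all
  qed
  ultimately have "k \<in> ball_auts n" by (simp add: ball_auts_def)
  then show ?thesis using \<phi>k by metis
qed

text \<open>The last clause of \<open>chart\<close> rules out neighbors of the root other than the
  images of generators.\<close>

lemma chart_sum_nbrs:
  fixes H :: "'v \<Rightarrow> real"
  assumes c: "chart G R \<phi>" and R: "1 \<le> R" and fin: "finite (verts G)"
  shows "(\<Sum>w\<in>verts G. emult G {\<phi> \<one>, w} * H w) = (\<Sum>s\<in>sgens. H (\<phi> s))"
proof -
  have sR: "s \<in> W R" if "s \<in> sgens" for s using sgens_W[OF that] W_mono[of 1 R] R by auto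
  have "(\<Sum>w\<in>verts G. emult G {\<phi> \<one>, w} * H w) = (\<Sum>w\<in>\<phi> ` sgens. emult G {\<phi> \<one>, w} * H w)"
  proof (rule sum.mono_neutral_right[OF fin])
    show "\<phi> ` sgens \<subseteq> verts G" using chart_verts[OF c] sR by auto
    show "\<forall>w\<in>verts G - \<phi> ` sgens. emult G {\<phi> \<one>, w} * H w = 0"
    proof
      fix w assume w: "w \<in> verts G - \<phi> ` sgens"
      have "emult G {\<phi> \<one>, w} = 0"
      proof (rule ccontr)
        assume "emult G {\<phi> \<one>, w} \<noteq> 0"
        then obtain s where "s \<in> sgens" "w = \<phi> (\<one> \<otimes> s)" using chart_nbr[OF c one_W[of 0]] w R by auto
        then show False using w by auto
      qed
      then show "emult G {\<phi> \<one>, w} * H w = 0" by simp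
    qed
  qed
  also have "\<dots> = (\<Sum>s\<in>sgens. emult G {\<phi> \<one>, \<phi> s} * H (\<phi> s))"
    by (rule sum.reindex[unfolded comp_def]) (use chart_inj[OF c] sR in \<open>auto simp: inj_on_def\<close>)
  also have "\<dots> = (\<Sum>s\<in>sgens. H (\<phi> s))"
    using chart_emult[OF c one_W sR] by (intro sum.cong refl) (simp add: adj_def)
  finally show ?thesis .
qed

text \<open>The lazy walk operator of \<open>G\<close>. The divisor is the degree of the Cayley
  graph at every vertex, whatever its own degree, which keeps the operator symmetric on all of
  \<open>G\<close> (\<open>inner_PG_sym\<close>).\<close>

definition PG :: "'v graph \<Rightarrow> ('v \<Rightarrow> real) \<Rightarrow> 'v \<Rightarrow> real" where
  "PG G f v = f v / 2 + (\<Sum>w\<in>verts G. real (emult G {v, w}) * f w) / (2 * d)"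

text \<open>Removing one step re-roots the chart at a generator and costs one unit of radius, so
  radius \<open>j\<close> is enough for \<open>j\<close> steps.\<close>

lemma PG_pow_chart:
  assumes fin: "finite (verts G)"
  shows "chart G R \<phi> \<Longrightarrow> j \<le> R \<Longrightarrow> (PG G ^^ j) f (\<phi> \<one>) = (\<Sum>x\<in>W j. walk j x * f (\<phi> x))"
proof (induction j arbitrary: R \<phi>)
  case (Suc j)
  note c = Suc.prems(1)
  have IHs: "(PG G ^^ j) f (\<phi> s) = (\<Sum>x\<in>W (Suc j). walk j (inv s \<otimes> x) * f (\<phi> x))" if s: "s \<in> sgens" for s
  proof -
    have sc: "s \<in> carrier \<Gamma>" using s by simp
    have "chart G (R - 1) (\<lambda>u. \<phi> (s \<otimes> u))"
      by (rule chart_translate[OF c sgens_W[OF s]]) (use Suc.prems in simp)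
    then have "(PG G ^^ j) f (\<phi> (s \<otimes> \<one>)) = (\<Sum>x\<in>W j. walk j x * f (\<phi> (s \<otimes> x)))"
      using Suc.prems by (intro Suc.IH) auto
    also have "\<dots> = (\<Sum>x\<in>(\<lambda>x. s \<otimes> x) ` W j. walk j (inv s \<otimes> x) * f (\<phi> x))"
    proof (subst sum.reindex)
      show "inj_on ((\<otimes>) s) (W j)" using W_subset[of j] inj_on_cmult[OF sc] inj_on_subset by blast
    qed (use sc W_carrier in \<open>auto simp: m_assoc[symmetric] intro!: sum.cong\<close>)
    also have "\<dots> = (\<Sum>x\<in>W (Suc j). walk j (inv s \<otimes> x) * f (\<phi> x))"
    proof (rule sum.mono_neutral_left)
      show "(\<lambda>x. s \<otimes> x) ` W j \<subseteq> W (Suc j)" using W_mult[OF sgens_W[OF s]] by auto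
      show "\<forall>x\<in>W (Suc j) - (\<lambda>x. s \<otimes> x) ` W j. walk j (inv s \<otimes> x) * f (\<phi> x) = 0"
      proof
        fix x assume x: "x \<in> W (Suc j) - (\<lambda>x. s \<otimes> x) ` W j"
        have xc: "x \<in> carrier \<Gamma>" using x W_carrier by blast
        have "x = s \<otimes> (inv s \<otimes> x)" using sc xc by (simp add: m_assoc[symmetric])
        then have "inv s \<otimes> x \<notin> W j" using x by blast
        then have "walk j (inv s \<otimes> x) = 0" using walk_support by blast
        then show "walk j (inv s \<otimes> x) * f (\<phi> x) = 0" by simp
      qed
    qed simp
    finally show ?thesis using sc by simp
  qed
  have IH0: "(PG G ^^ j) f (\<phi> \<one>) = (\<Sum>x\<in>W (Suc j). walk j x * f (\<phi> x))"
  proof -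
    have "(PG G ^^ j) f (\<phi> \<one>) = (\<Sum>x\<in>W j. walk j x * f (\<phi> x))" using Suc by simp
    also have "\<dots> = (\<Sum>x\<in>W (Suc j). walk j x * f (\<phi> x))"
      using walk_support by (intro sum.mono_neutral_left) auto
    finally show ?thesis .
  qed
  have "(PG G ^^ Suc j) f (\<phi> \<one>) = (PG G ^^ j) f (\<phi> \<one>) / 2 + (\<Sum>s\<in>sgens. (PG G ^^ j) f (\<phi> s)) / (2 * d)"
    using chart_sum_nbrs[OF c _ fin, of "(PG G ^^ j) f"] Suc.prems by (simp add: PG_def)
  also have "(\<Sum>s\<in>sgens. (PG G ^^ j) f (\<phi> s)) = (\<Sum>s\<in>sgens. \<Sum>x\<in>W (Suc j). walk j (inv s \<otimes> x) * f (\<phi> x))"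
    by (intro sum.cong refl IHs)
  also have "\<dots> = (\<Sum>x\<in>W (Suc j). (\<Sum>s\<in>sgens. walk j (inv s \<otimes> x)) * f (\<phi> x))"
    by (subst sum.swap) (simp only: sum_distrib_right)
  also have "(PG G ^^ j) f (\<phi> \<one>) / 2 + (\<Sum>x\<in>W (Suc j). (\<Sum>s\<in>sgens. walk j (inv s \<otimes> x)) * f (\<phi> x)) / (2 * d)
      = (\<Sum>x\<in>W (Suc j). walk j x * f (\<phi> x) / 2 + (\<Sum>s\<in>sgens. walk j (inv s \<otimes> x)) * f (\<phi> x) / (2 * d))"
    unfolding IH0 sum.distrib sum_divide_distrib ..
  also have "\<dots> = (\<Sum>x\<in>W (Suc j). walk (Suc j) x * f (\<phi> x))"
  proof (rule sum.cong[OF refl])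
    fix x assume "x \<in> W (Suc j)"
    then have "x \<in> carrier \<Gamma>" by (rule W_carrier)
    then show "walk j x * f (\<phi> x) / 2 + (\<Sum>s\<in>sgens. walk j (inv s \<otimes> x)) * f (\<phi> x) / (2 * d)
      = walk (Suc j) x * f (\<phi> x)" by (simp add: algebra_simps)
  qed
  finally show ?case .
qed simp

text \<open>Extensionality makes the set finite and counts each chart once in the averages.\<close>

definition charts :: "'v graph \<Rightarrow> nat \<Rightarrow> ('g \<Rightarrow> 'v) set" where
  "charts G n = {k \<in> extensional (W n). chart G n k}"

lemma charts_finite: "finite (verts G) \<Longrightarrow> finite (charts G n)"
  by (rule finite_subset[OF _ finite_PiE[OF W_finite[of n], of "\<lambda>_. verts G"]])
    (auto simp: charts_def PiE_def chart_def)

text \<open>Charts that send \<open>x\<close> to the root of \<open>\<phi>\<close> are parametrized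
  by \<open>ball_auts n\<close>: read such a chart in the coordinates given by \<open>\<phi>\<close>
  and translate it so that it fixes \<open>\<one>\<close>. This turns a sum over charts into a sum
  over automorphisms, where re-rooting is understood.\<close>

lemma charts_through:
  fixes H :: "'v \<Rightarrow> real"
  assumes c: "chart G R \<phi>" and R: "n + m \<le> R" "2 * m \<le> n" and x: "x \<in> W m" and y: "y \<in> W m"
  shows "(\<Sum>k\<in>{k \<in> charts G n. k x = \<phi> \<one>}. H (k y)) = (\<Sum>k\<in>ball_auts n. H (\<phi> (inv (k x) \<otimes> k y)))"
proof -
  define T where "T k = restrict (\<lambda>u. \<phi> (inv (k x) \<otimes> k u)) (W n)" for k
  have xn: "x \<in> W n" and yn: "y \<in> W n" using x y W_mono[of m n] R by auto
  have xc: "x \<in> carrier \<Gamma>" using x W_carrier by blast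
  have kx: "k x \<in> W m" "inv (k x) \<in> W m" if "k \<in> ball_auts n" for k
    using ball_auts_ball[OF that x] W_inv R by auto
  have inR: "inv (k x) \<otimes> k u \<in> W R" if "k \<in> ball_auts n" "u \<in> W n" for k u
    using W_mult_le[OF kx(2)[OF that(1)] ball_auts_W[OF that]] R by simp
  have "bij_betw T (ball_auts n) {k \<in> charts G n. k x = \<phi> \<one>}"
    unfolding bij_betw_def
  proof (intro conjI equalityI subsetI)
    show "inj_on T (ball_auts n)"
    proof (rule inj_onI)
      fix k l assume k: "k \<in> ball_auts n" and l: "l \<in> ball_auts n" and eq: "T k = T l"
      have e: "inv (k x) \<otimes> k u = inv (l x) \<otimes> l u" if u: "u \<in> W n" for u
        using fun_cong[OF eq, of u] u chart_inj[OF c inR[OF k u] inR[OF l u]] by (simp add: T_def)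
      have i: "inv (k x) = inv (l x)"
        using e[OF one_W] kx(2)[OF k] kx(2)[OF l] W_carrier by (simp add: ball_auts_one[OF k] ball_auts_one[OF l])
      show "k = l"
      proof
        fix u show "k u = l u"
        proof (cases "u \<in> W n")
          case True
          have "inv (k x) \<in> carrier \<Gamma>" "k u \<in> carrier \<Gamma>" "l u \<in> carrier \<Gamma>"
            using kx(2)[OF k] ball_auts_W[OF k True] ball_auts_W[OF l True] W_carrier by auto
          then show ?thesis using e[OF True] i by simp
        next
          case False
          then show ?thesis using permutes_not_in ball_auts_permutes k l by metis
        qed
      qed
    qed
  next
    fix t assume "t \<in> T ` ball_auts n"
    then obtain k where k: "k \<in> ball_auts n" "t = T k" by blast
    have "chart G n (\<lambda>u. \<phi> (inv (k x) \<otimes> u))"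
      by (rule chart_translate[OF c kx(2)[OF k(1)]]) (use R in simp)
    then have "chart G n ((\<lambda>u. \<phi> (inv (k x) \<otimes> u)) \<circ> k)" using k(1) by (rule chart_comp)
    then have "chart G n t" by (rule chart_cong[rotated]) (simp add: k(2) T_def)
    moreover have "t x = \<phi> \<one>" using xn kx(1)[OF k(1)] W_carrier by (simp add: k(2) T_def)
    ultimately show "t \<in> {k \<in> charts G n. k x = \<phi> \<one>}" by (simp add: charts_def k(2) T_def)
  next
    fix \<kappa> assume "\<kappa> \<in> {k \<in> charts G n. k x = \<phi> \<one>}"
    then have \<kappa>: "chart G n \<kappa>" "\<kappa> \<in> extensional (W n)" "\<kappa> x = \<phi> \<one>" by (auto simp: charts_def)
    \<comment> \<open>The two charts are known to agree only in that
      \<open>\<kappa> x = \<phi> \<one>\<close>. Comparing them from this point, at the smaller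
      radius \<open>n - m\<close>, locates \<open>\<kappa> \<one>\<close> as
      \<open>\<phi> z\<close>; now \<open>\<kappa>\<close> and the translate of
      \<open>\<phi>\<close> by \<open>z\<close> share a root and can be compared at full
      radius.\<close>
    have t: "chart G (n - m) (\<lambda>u. \<kappa> (x \<otimes> u))" by (rule chart_translate[OF \<kappa>(1) x]) (use R in simp)
    have cm: "chart G (n - m) \<phi>" by (rule chart_mono[OF c]) (use R in simp)
    obtain \<alpha> where \<alpha>: "\<alpha> \<in> ball_auts (n - m)" "\<forall>u\<in>W (n - m). \<kappa> (x \<otimes> u) = \<phi> (\<alpha> u)"
      using chart_diff[OF cm t] \<kappa>(3) xc by auto
    have ix: "inv x \<in> W m" using W_inv[OF x] .
    define z where "z = \<alpha> (inv x)"
    have zm: "z \<in> W m" unfolding z_def by (rule ball_auts_ball[OF \<alpha>(1) ix]) (use R in simp)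
    have "inv x \<in> W (n - m)" by (rule subsetD[OF W_mono ix]) (use R in simp)
    then have \<kappa>1: "\<kappa> \<one> = \<phi> z" using \<alpha>(2) xc by (auto simp: z_def)
    have tz: "chart G n (\<lambda>u. \<phi> (z \<otimes> u))" by (rule chart_translate[OF c zm]) (use R in simp)
    have zc: "z \<in> carrier \<Gamma>" using zm W_carrier by blast
    obtain k where k: "k \<in> ball_auts n" "\<forall>u\<in>W n. \<kappa> u = \<phi> (z \<otimes> k u)"
      using chart_diff[OF tz \<kappa>(1)] \<kappa>1 zc by auto
    have "\<phi> (z \<otimes> k x) = \<phi> \<one>" using k(2) xn \<kappa>(3) by simp
    moreover have "z \<otimes> k x \<in> W R" using W_mult_le[OF zm kx(1)[OF k(1)]] R by simp
    ultimately have "z \<otimes> k x = \<one>" using chart_inj[OF c _ one_W] by blast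
    then have "z = inv (k x)" using zc kx(1)[OF k(1)] W_carrier by (metis inv_equality)
    then have "\<kappa> = T k" using k(2) \<kappa>(2) by (auto simp: T_def fun_eq_iff extensional_def)
    then show "\<kappa> \<in> T ` ball_auts n" using k(1) by blast
  qed
  then have "(\<Sum>k\<in>{k \<in> charts G n. k x = \<phi> \<one>}. H (k y)) = (\<Sum>k\<in>ball_auts n. H (T k y))"
    by (rule sum.reindex_bij_betw[symmetric])
  then show ?thesis using yn by (simp add: T_def)
qed

end

context fg_group
begin

text \<open>Here \<open>\<psi> (inv x \<otimes> y)\<close> is the autocorrelation of
  \<open>f\<close>, the sum of \<open>f (k x) * f (k y)\<close> over all charts \<open>k\<close>,
  scaled to be 1 at \<open>\<one>\<close>. Positivity is that of a Gram kernel; that it depends on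
  \<open>inv x \<otimes> y\<close> only is \<open>reroot\<close>.\<close>

lemma local_pd_of_function:
  fixes f :: "'v \<Rightarrow> real"
  assumes fin: "finite (verts G)" and A: "A \<subseteq> verts G" and f0: "\<And>v. v \<notin> A \<Longrightarrow> f v = 0"
    and chA: "\<And>v. v \<in> A \<Longrightarrow> \<exists>\<phi>. chart G (n + m) \<phi> \<and> \<phi> \<one> = v"
    and n: "2 * m \<le> n" "3 * m \<le> n"
    and reroot: "\<And>x z (F :: 'g \<Rightarrow> real). x \<in> W m \<Longrightarrow> z \<in> W m \<Longrightarrow>
      (\<Sum>k\<in>ball_auts n. F (inv (k x) \<otimes> k z)) = (\<Sum>k\<in>ball_auts n. F (k (inv x \<otimes> z)))"
    and pos: "0 < (\<Sum>v\<in>A. (f v)\<^sup>2)"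
  shows "\<exists>\<psi>. local_pd m \<psi> \<and>
    (\<forall>j\<le>m. moment \<psi> j * (\<Sum>v\<in>A. (f v)\<^sup>2) = (\<Sum>v\<in>A. f v * (PG G ^^ j) f v))"
proof -
  have finA: "finite A" using A fin finite_subset by blast
  obtain \<phi> where \<phi>: "\<And>v. v \<in> A \<Longrightarrow> chart G (n + m) (\<phi> v)" "\<And>v. v \<in> A \<Longrightarrow> \<phi> v \<one> = v"
    using chA by metis
  define a where "a = real (card (ball_auts n))"
  have a: "a > 0" using ball_auts_id by (auto simp: a_def card_gt_0_iff)
  define Z where "Z = (\<Sum>v\<in>A. (f v)\<^sup>2)"
  define \<psi>0 where "\<psi>0 g = (\<Sum>v\<in>A. f v * (\<Sum>k\<in>ball_auts n. f (\<phi> v (k g)))) / a" for g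
  define \<psi> where "\<psi> g = \<psi>0 g / Z" for g
  have Z: "Z > 0" using pos by (simp add: Z_def)
  have K: "(\<Sum>k\<in>charts G n. f (k x) * f (k y)) / a = \<psi>0 (inv x \<otimes> y)" if x: "x \<in> W m" and y: "y \<in> W m" for x y
  proof -
    have xn: "x \<in> W n" using x W_mono[of m n] n by auto
    have "(\<Sum>k\<in>charts G n. f (k x) * f (k y)) = (\<Sum>v\<in>verts G. \<Sum>k\<in>{k \<in> charts G n. k x = v}. f (k x) * f (k y))"
      using xn by (intro sum.group[symmetric] charts_finite fin) (auto simp: charts_def chart_def)
    \<comment> \<open>Charts with \<open>k x\<close> outside \<open>A\<close> contribute 0, which is
      why good neighborhoods are required around the support of \<open>f\<close> only.\<close>
    also have "\<dots> = (\<Sum>v\<in>A. \<Sum>k\<in>{k \<in> charts G n. k x = v}. f (k x) * f (k y))"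
      using A f0 by (intro sum.mono_neutral_right fin) (auto intro!: sum.neutral)
    also have "\<dots> = (\<Sum>v\<in>A. f v * (\<Sum>k\<in>ball_auts n. f (\<phi> v (k (inv x \<otimes> y)))))"
    proof (rule sum.cong[OF refl])
      fix v assume v: "v \<in> A"
      have "(\<Sum>k\<in>{k \<in> charts G n. k x = v}. f (k x) * f (k y)) = f v * (\<Sum>k\<in>{k \<in> charts G n. k x = v}. f (k y))"
        by (simp add: sum_distrib_left)
      also have "(\<Sum>k\<in>{k \<in> charts G n. k x = v}. f (k y)) = (\<Sum>k\<in>ball_auts n. f (\<phi> v (inv (k x) \<otimes> k y)))"
        using charts_through[OF \<phi>(1)[OF v] _ n(1) x y, of f] \<phi>(2)[OF v] by simp
      also have "\<dots> = (\<Sum>k\<in>ball_auts n. f (\<phi> v (k (inv x \<otimes> y))))"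
        by (rule reroot[OF x y])
      finally show "(\<Sum>k\<in>{k \<in> charts G n. k x = v}. f (k x) * f (k y))
        = f v * (\<Sum>k\<in>ball_auts n. f (\<phi> v (k (inv x \<otimes> y))))" .
    qed
    finally show ?thesis by (simp add: \<psi>0_def)
  qed
  have "local_pd m \<psi>"
    unfolding local_pd_def
  proof (intro conjI ballI allI)
    have "\<psi>0 \<one> = (\<Sum>v\<in>A. f v * (\<Sum>k\<in>ball_auts n. f v)) / a"
      unfolding \<psi>0_def using \<phi>(2) by (simp add: ball_auts_one cong: sum.cong)
    also have "\<dots> = (\<Sum>v\<in>A. (f v)\<^sup>2 * a) / a" by (simp add: a_def power2_eq_square algebra_simps)
    also have "\<dots> = Z" using a by (simp add: Z_def sum_distrib_right[symmetric])
    finally show "\<psi> \<one> = 1" using Z by (simp add: \<psi>_def)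
  next
    fix x assume x: "x \<in> W m"
    have "x \<in> carrier \<Gamma>" using x W_carrier by blast
    then show "\<psi> (inv x) = \<psi> x"
      using K[OF x one_W] K[OF one_W x] by (simp add: \<psi>_def mult.commute)
  next
    fix c :: "'g \<Rightarrow> real"
    have "(\<Sum>x\<in>W m. \<Sum>y\<in>W m. c x * c y * \<psi> (inv x \<otimes> y))
      = (\<Sum>x\<in>W m. \<Sum>y\<in>W m. \<Sum>k\<in>charts G n. (c x * f (k x)) * (c y * f (k y)) / (a * Z))"
    proof (intro sum.cong refl)
      fix x y assume "x \<in> W m" "y \<in> W m"
      then show "c x * c y * \<psi> (inv x \<otimes> y) = (\<Sum>k\<in>charts G n. (c x * f (k x)) * (c y * f (k y)) / (a * Z))"
        by (simp add: \<psi>_def K[symmetric] sum_distrib_left sum_divide_distrib algebra_simps)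
    qed
    also have "\<dots> = (\<Sum>x\<in>W m. \<Sum>k\<in>charts G n. \<Sum>y\<in>W m. (c x * f (k x)) * (c y * f (k y)) / (a * Z))"
      by (intro sum.cong refl sum.swap)
    also have "\<dots> = (\<Sum>k\<in>charts G n. \<Sum>x\<in>W m. \<Sum>y\<in>W m. (c x * f (k x)) * (c y * f (k y)) / (a * Z))"
      by (rule sum.swap)
    also have "\<dots> = (\<Sum>k\<in>charts G n. (\<Sum>x\<in>W m. c x * f (k x))\<^sup>2 / (a * Z))"
      by (simp add: power2_eq_square sum_product sum_divide_distrib)
    also have "\<dots> \<ge> 0" using a Z by (intro sum_nonneg) auto
    finally show "0 \<le> (\<Sum>x\<in>W m. \<Sum>y\<in>W m. c x * c y * \<psi> (inv x \<otimes> y))" .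
  qed
  moreover have "moment \<psi> j * Z = (\<Sum>v\<in>A. f v * (PG G ^^ j) f v)" if j: "j \<le> m" for j
  proof -
    have "(PG G ^^ j) f v = (\<Sum>x\<in>W j. walk j x * (\<Sum>k\<in>ball_auts n. f (\<phi> v (k x)))) / a" if v: "v \<in> A" for v
    proof -
      have "(PG G ^^ j) f v = (\<Sum>x\<in>W j. walk j x * f (\<phi> v x))"
        using PG_pow_chart[OF fin \<phi>(1)[OF v], of j f] \<phi>(2)[OF v] j by simp
      \<comment> \<open>Since \<open>walk j\<close> is invariant under \<open>k\<close>, composing
        the chart with \<open>k\<close> leaves the sum unchanged; averaging over \<open>k\<close>
        brings in \<open>\<psi>0\<close>.\<close>
      moreover have "(\<Sum>x\<in>W j. walk j x * f (\<phi> v x)) = (\<Sum>x\<in>W j. walk j x * f (\<phi> v (k x)))"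
        if k: "k \<in> ball_auts n" for k
      proof -
        have "k ` W j \<subseteq> W j" using ball_auts_ball[OF k] j n by auto
        moreover have "inj_on k (W j)" using ball_auts_inj[OF k] by (auto simp: inj_on_def)
        ultimately have "bij_betw k (W j) (W j)" by (simp add: bij_betw_def endo_inj_surj)
        then have "(\<Sum>x\<in>W j. walk j x * f (\<phi> v x)) = (\<Sum>x\<in>W j. walk j (k x) * f (\<phi> v (k x)))"
          by (rule sum.reindex_bij_betw[symmetric])
        also have "\<dots> = (\<Sum>x\<in>W j. walk j x * f (\<phi> v (k x)))"
          using walk_ball_auts[OF k, of _ j j] j n by (intro sum.cong refl) auto
        finally show ?thesis .
      qed
      ultimately have "(\<Sum>k\<in>ball_auts n. (PG G ^^ j) f v) = (\<Sum>k\<in>ball_auts n. \<Sum>x\<in>W j. walk j x * f (\<phi> v (k x)))"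
        by (intro sum.cong refl) simp
      then have "a * (PG G ^^ j) f v = (\<Sum>k\<in>ball_auts n. \<Sum>x\<in>W j. walk j x * f (\<phi> v (k x)))"
        by (simp add: a_def)
      also have "\<dots> = (\<Sum>x\<in>W j. walk j x * (\<Sum>k\<in>ball_auts n. f (\<phi> v (k x))))"
        by (subst sum.swap) (simp add: sum_distrib_left)
      finally show ?thesis using a by (simp add: field_simps)
    qed
    then have "(\<Sum>v\<in>A. f v * (PG G ^^ j) f v)
        = (\<Sum>v\<in>A. \<Sum>x\<in>W j. walk j x * (f v * (\<Sum>k\<in>ball_auts n. f (\<phi> v (k x)))) / a)"
      by (intro sum.cong refl) (simp add: sum_distrib_left sum_divide_distrib algebra_simps)
    also have "\<dots> = (\<Sum>x\<in>W j. walk j x * \<psi>0 x)"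
      by (subst sum.swap) (simp add: \<psi>0_def sum_distrib_left sum_divide_distrib)
    also have "\<dots> = moment \<psi> j * Z"
      using Z by (simp add: moment_def \<psi>_def sum_distrib_right)
    finally show ?thesis by simp
  qed
  ultimately show ?thesis unfolding Z_def by blast
qed

lemma graph_moments:
  obtains R where "\<And>(G :: 'v graph) A f. \<lbrakk>finite (verts G); A \<subseteq> verts G; \<And>v. v \<notin> A \<Longrightarrow> f v = 0;
      \<And>v. v \<in> A \<Longrightarrow> \<exists>\<phi>. chart G R \<phi> \<and> \<phi> \<one> = v; 0 < (\<Sum>v\<in>A. (f v)\<^sup>2)\<rbrakk> \<Longrightarrow>
    \<exists>\<psi>. local_pd m \<psi> \<and>
      (\<forall>j\<le>m. moment \<psi> j * (\<Sum>v\<in>A. (f v)\<^sup>2) = (\<Sum>v\<in>A. f v * (PG G ^^ j) f v))"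
    "m \<le> R"
proof -
  obtain n0 where n0: "\<forall>n\<ge>n0. \<forall>x\<in>W m. \<forall>z\<in>W m. \<forall>F :: 'g \<Rightarrow> real.
    (\<Sum>k\<in>ball_auts n. F (inv (k x) \<otimes> k z)) = (\<Sum>k\<in>ball_auts n. F (k (inv x \<otimes> z)))"
    using ball_auts_reroot[of m] by blast
  \<comment> \<open>Moving points of \<open>W j\<close> under \<open>walk j\<close> takes radius
    \<open>j + 2 * j\<close>, and \<open>j\<close> goes up to \<open>m\<close>.\<close>
  define n where "n = n0 + 3 * m"
  show ?thesis
  proof (rule that[of "n + m"])
    fix G :: "'v graph" and A f
    assume "finite (verts G)" "A \<subseteq> verts G" "\<And>v. v \<notin> A \<Longrightarrow> f v = (0 :: real)"
      "\<And>v. v \<in> A \<Longrightarrow> \<exists>\<phi>. chart G (n + m) \<phi> \<and> \<phi> \<one> = v" "0 < (\<Sum>v\<in>A. (f v)\<^sup>2)"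
    then show "\<exists>\<psi>. local_pd m \<psi> \<and>
      (\<forall>j\<le>m. moment \<psi> j * (\<Sum>v\<in>A. (f v)\<^sup>2) = (\<Sum>v\<in>A. f v * (PG G ^^ j) f v))"
      using n0 by (intro local_pd_of_function[of G A f n m]) (auto simp: n_def)
  qed simp
qed

end

section \<open>Smoothing a set with small boundary\<close>

text \<open>If two thresholds are crossed, \<open>b - a\<close> is at least their spacing
  \<open>1 / (2 * N)\<close>, and the quadratic term alone reaches \<open>N\<close>, the number of
  all thresholds.\<close>

lemma thresholds_crossed:
  fixes a b :: real and N :: nat
  assumes N: "0 < N"
  shows "card {i. i < N \<and> a < 1 / 4 + i / (2 * N) \<and> 1 / 4 + i / (2 * N) \<le> b} \<le> 1 + 4 * real N ^ 3 * (a - b)\<^sup>2"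
    (is "real (card ?X) \<le> _")
proof (cases "card ?X \<le> 1")
  case True
  then have "real (card ?X) \<le> 1" by simp
  moreover have "0 \<le> 4 * real N ^ 3 * (a - b)\<^sup>2" by simp
  ultimately show ?thesis by linarith
next
  case False
  have fin: "finite ?X" by simp
  have "\<exists>i\<in>?X. \<exists>j\<in>?X. i < j"
  proof (rule ccontr)
    assume "\<not> (\<exists>i\<in>?X. \<exists>j\<in>?X. i < j)"
    then have "\<forall>i\<in>?X. \<forall>j\<in>?X. i = j" by (meson linorder_neqE_nat)
    then show False using False card_le_Suc0_iff_eq[OF fin] by simp
  qed
  then obtain i j where ij: "i \<in> ?X" "j \<in> ?X" "i < j" by blast
  have "1 / (2 * N) \<le> (real j - i) / (2 * N)" using ij(3) by (intro divide_right_mono) auto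
  also have "\<dots> \<le> b - a" using ij(1,2) by (simp add: diff_divide_distrib)
  finally have "(1 / (2 * N))\<^sup>2 \<le> (b - a)\<^sup>2" by (intro power_mono) auto
  then have "4 * real N ^ 3 * (1 / (2 * N))\<^sup>2 \<le> 4 * real N ^ 3 * (b - a)\<^sup>2" by (intro mult_left_mono) auto
  moreover have "4 * real N ^ 3 * (1 / (2 * N))\<^sup>2 = real N"
    using N by (simp add: field_simps power2_eq_square power3_eq_cube)
  moreover have "card ?X \<le> N" using card_mono[of "{..<N}" ?X] by auto
  ultimately show ?thesis by (simp add: power2_commute)
qed

context fg_group
begin

section \<open>Inner product and Dirichlet form on a finite graph\<close>

definition inner :: "'v graph \<Rightarrow> ('v \<Rightarrow> real) \<Rightarrow> ('v \<Rightarrow> real) \<Rightarrow> real" where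
  "inner G f g = (\<Sum>v\<in>verts G. f v * g v)"

definition form :: "'v graph \<Rightarrow> ('v \<Rightarrow> real) \<Rightarrow> ('v \<Rightarrow> real) \<Rightarrow> real" where
  "form G f g = (\<Sum>u\<in>verts G. \<Sum>w\<in>verts G. real (emult G {u, w}) * f u * g w)"

lemma inner_sym: "inner G f g = inner G g f"
  by (simp add: inner_def mult.commute)

lemma form_sym: "form G f g = form G g f"
  unfolding form_def by (subst sum.swap) (simp add: insert_commute mult.commute mult.left_commute)

lemma inner_PG: "inner G (PG G f) g = inner G f g / 2 + form G f g / (2 * d)"
proof -
  have "inner G (PG G f) g = (\<Sum>v\<in>verts G. f v * g v / 2 + (\<Sum>w\<in>verts G. real (emult G {v, w}) * g v * f w) / (2 * d))"
    unfolding inner_def PG_def by (intro sum.cong refl) (simp add: sum_distrib_left algebra_simps)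
  also have "\<dots> = inner G f g / 2 + form G g f / (2 * d)"
    by (simp add: sum.distrib inner_def form_def sum_divide_distrib)
  finally show ?thesis by (simp only: form_sym[of G g])
qed

lemma inner_PG_sym: "inner G (PG G f) g = inner G f (PG G g)"
  by (metis inner_PG inner_sym form_sym)

lemma inner_PG_pow: "inner G ((PG G ^^ i) f) ((PG G ^^ j) f) = inner G f ((PG G ^^ (i + j)) f)"
proof (induction i arbitrary: j)
  case (Suc i)
  have "inner G ((PG G ^^ Suc i) f) ((PG G ^^ j) f) = inner G ((PG G ^^ i) f) ((PG G ^^ Suc j) f)"
    by (simp add: inner_PG_sym)
  then show ?case using Suc[of "Suc j"] by simp
qed simp

lemma chart_degree:
  assumes c: "chart G R \<phi>" and x: "x \<in> W j" "j < R" and fin: "finite (verts G)"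
  shows "(\<Sum>w\<in>verts G. real (emult G {\<phi> x, w})) = d"
proof -
  have "chart G 1 (\<lambda>u. \<phi> (x \<otimes> u))" by (rule chart_translate[OF c x(1)]) (use x in simp)
  then show ?thesis using chart_sum_nbrs[of G 1 "\<lambda>u. \<phi> (x \<otimes> u)" "\<lambda>_. 1"] fin x W_carrier
    by (simp add: d_def)
qed

text \<open>Each application of \<open>PG\<close> spreads the support by one edge, which the last
  clause of \<open>chart\<close> follows inside a chart. So the smoothed function lives where the
  degree is known to be \<open>d\<close>.\<close>

lemma PG_pow_support:
  assumes fin: "finite (verts G)" and f0: "\<And>v. v \<notin> A \<Longrightarrow> f v = 0"
    and ch: "\<And>v. v \<in> A \<Longrightarrow> \<exists>\<phi>. chart G R \<phi> \<and> \<phi> \<one> = v"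
  shows "j \<le> R \<Longrightarrow> v \<in> verts G \<Longrightarrow> (PG G ^^ j) f v \<noteq> 0 \<Longrightarrow> \<exists>\<phi>. chart G R \<phi> \<and> v \<in> \<phi> ` W j"
proof (induction j arbitrary: v)
  case 0
  then show ?case using f0 ch[of v] by auto
next
  case (Suc j)
  have e: "(PG G ^^ Suc j) f v = (PG G ^^ j) f v / 2 + (\<Sum>w\<in>verts G. real (emult G {v, w}) * (PG G ^^ j) f w) / (2 * d)"
    by (simp add: PG_def)
  have "(PG G ^^ j) f v \<noteq> 0 \<or> (\<Sum>w\<in>verts G. real (emult G {v, w}) * (PG G ^^ j) f w) \<noteq> 0"
  proof (rule ccontr)
    assume "\<not> ?thesis"
    then have "(PG G ^^ Suc j) f v = 0" unfolding e by simp
    then show False using Suc.prems(3) by blast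
  qed
  then consider "(PG G ^^ j) f v \<noteq> 0" | "(\<Sum>w\<in>verts G. real (emult G {v, w}) * (PG G ^^ j) f w) \<noteq> 0"
    by blast
  then show ?case
  proof cases
    case 1
    then show ?thesis using Suc.IH[of v] Suc.prems by fastforce
  next
    case 2
    then obtain w where w: "w \<in> verts G" "real (emult G {v, w}) * (PG G ^^ j) f w \<noteq> 0"
      by (meson sum.neutral)
    then obtain \<phi> x where \<phi>: "chart G R \<phi>" "x \<in> W j" "w = \<phi> x" using Suc.IH[of w] Suc.prems by auto
    have "0 < emult G {\<phi> x, v}" using w \<phi> by (simp add: insert_commute)
    then obtain s where "s \<in> sgens" "v = \<phi> (x \<otimes> s)"
      using chart_nbr[OF \<phi>(1,2) _ Suc.prems(2)] Suc.prems(1) by auto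
    then show ?thesis using \<phi> W_SucI by blast
  qed
qed

text \<open>The degree enters only as a factor of \<open>(g v)\<^sup>2\<close>, so it matters only
  where \<open>g\<close> is nonzero. The factor 4 instead of 2 is due to laziness.\<close>

lemma dirichlet_form:
  assumes deg: "\<And>v. v \<in> verts G \<Longrightarrow> g v \<noteq> 0 \<Longrightarrow> (\<Sum>w\<in>verts G. real (emult G {v, w})) = d"
  shows "(\<Sum>u\<in>verts G. \<Sum>w\<in>verts G. real (emult G {u, w}) * (g u - g w)\<^sup>2)
    = 4 * d * (inner G g g - inner G (PG G g) g)"
proof -
  have sq: "(\<Sum>u\<in>verts G. \<Sum>w\<in>verts G. real (emult G {u, w}) * (g u)\<^sup>2) = d * inner G g g"
  proof -
    have "(\<Sum>w\<in>verts G. real (emult G {u, w}) * (g u)\<^sup>2) = d * (g u * g u)" if u: "u \<in> verts G" for u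
      using deg[OF u] by (cases "g u = 0") (simp_all add: sum_distrib_right[symmetric] power2_eq_square)
    then show ?thesis by (simp add: inner_def sum_distrib_left)
  qed
  have sq': "(\<Sum>u\<in>verts G. \<Sum>w\<in>verts G. real (emult G {u, w}) * (g w)\<^sup>2) = d * inner G g g"
    by (subst sum.swap) (simp add: sq[symmetric] insert_commute)
  have "(\<Sum>u\<in>verts G. \<Sum>w\<in>verts G. real (emult G {u, w}) * (g u - g w)\<^sup>2)
    = (\<Sum>u\<in>verts G. \<Sum>w\<in>verts G. real (emult G {u, w}) * (g u)\<^sup>2 + real (emult G {u, w}) * (g w)\<^sup>2
        - 2 * (real (emult G {u, w}) * g u * g w))"
    by (intro sum.cong refl) (simp add: power2_eq_square algebra_simps)
  also have "\<dots> = 2 * d * inner G g g - 2 * form G g g"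
    unfolding sum.distrib sum_subtractf sq sq' by (simp add: form_def sum_distrib_left)
  also have "\<dots> = 4 * d * (inner G g g - inner G (PG G g) g)"
    using d_pos by (simp add: inner_PG field_simps)
  finally show ?thesis .
qed

text \<open>The \<open>N\<close> candidate thresholds are spaced by \<open>1 / (2 N)\<close>: an edge of smaller gradient crosses at most
  one of them, and the steeper edges are few because the Dirichlet form is small.\<close>

lemma exists_level_set:
  fixes X :: real
  assumes fin: "finite (verts G)" and N: "0 < N"
    and deg: "\<And>v. v \<in> verts G \<Longrightarrow> g v \<noteq> 0 \<Longrightarrow> (\<Sum>w\<in>verts G. real (emult G {v, w})) = d"
    and A0: "real (card {v \<in> verts G. 1 / 4 \<le> g v}) \<le> X"
  shows "\<exists>t\<ge>1 / 4. t \<le> 3 / 4 \<and>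
    real (edges_between G {v \<in> verts G. t \<le> g v} (verts G - {v \<in> verts G. t \<le> g v}))
      \<le> d * X / N + 16 * d * N\<^sup>2 * (inner G g g - inner G (PG G g) g)"
proof (rule ccontr)
  assume neg: "\<not> ?thesis"
  define V where "V = verts G"
  define e where "e u w = real (emult G {u, w})" for u w
  define E where "E = inner G g g - inner G (PG G g) g"
  define t where "t i = 1 / 4 + real i / (2 * N)" for i :: nat
  define cr where "cr u w i = (if g w < t i \<and> t i \<le> g u then 1 else 0 :: real)" for u w and i :: nat
  define bd where "bd i = real (edges_between G {v \<in> V. t i \<le> g v} (V - {v \<in> V. t i \<le> g v}))" for i
  have finV: "finite V" using fin by (simp add: V_def)
  have big: "d * X / N + 16 * d * N\<^sup>2 * E < bd i" if i: "i < N" for i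
  proof -
    have "t i \<le> 3 / 4" "1 / 4 \<le> t i" using i by (auto simp: t_def field_simps)
    then show ?thesis using neg unfolding bd_def E_def V_def by (meson not_le)
  qed
  have bd: "bd i = (\<Sum>u\<in>V. \<Sum>w\<in>V. e u w * cr u w i)" for i
  proof -
    have "bd i = (\<Sum>u\<in>{v \<in> V. t i \<le> g v}. \<Sum>w\<in>V - {v \<in> V. t i \<le> g v}. e u w * cr u w i)"
      unfolding bd_def edges_between_def of_nat_sum by (intro sum.cong refl) (auto simp: e_def cr_def)
    also have "\<dots> = (\<Sum>u\<in>{v \<in> V. t i \<le> g v}. \<Sum>w\<in>V. e u w * cr u w i)"
      using finV by (intro sum.cong refl sum.mono_neutral_left) (auto simp: cr_def)
    also have "\<dots> = (\<Sum>u\<in>V. \<Sum>w\<in>V. e u w * cr u w i)"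
      using finV by (intro sum.mono_neutral_left) (auto simp: cr_def)
    finally show ?thesis .
  qed
  \<comment> \<open>All thresholds are at least 1/4, so an edge starting at \<open>u\<close> with
    \<open>g u < 1 / 4\<close> is never counted, and the term 1 is charged only to the vertices
    bounded by \<open>X\<close>.\<close>
  have crs: "(\<Sum>i<N. cr u w i) \<le> (if 1 / 4 \<le> g u then 1 + 4 * real N ^ 3 * (g u - g w)\<^sup>2 else 0)" for u w
  proof (cases "1 / 4 \<le> g u")
    case True
    have "(\<Sum>i<N. cr u w i) = card {i. i < N \<and> g w < t i \<and> t i \<le> g u}"
      by (simp add: cr_def sum.If_cases Int_def lessThan_def conj_ac)
    also have "\<dots> \<le> 1 + 4 * real N ^ 3 * (g w - g u)\<^sup>2"
      using thresholds_crossed[OF N, of "g w" "g u"] by (simp add: t_def)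
    finally show ?thesis using True by (simp add: power2_commute)
  next
    case False
    have "1 / 4 \<le> t i" for i by (simp add: t_def)
    then have "\<not> t i \<le> g u" for i using False order_trans by blast
    then have "cr u w i = 0" for i by (simp add: cr_def)
    then show ?thesis using False by simp
  qed
  \<comment> \<open>Average over the thresholds: if all \<open>N\<close> boundaries exceeded the
    bound, so would their sum, which is estimated edge by edge. The coefficient
    \<open>16 * d * N\<^sup>2\<close> is \<open>4 * N ^ 3\<close> times the \<open>4 * d\<close> of
    \<open>dirichlet_form\<close>, divided by \<open>N\<close>.\<close>
  have "N * (d * X / N + 16 * d * N\<^sup>2 * E) = (\<Sum>i<N. d * X / N + 16 * d * N\<^sup>2 * E)" by simp
  also have "\<dots> < (\<Sum>i<N. bd i)"
    using N big by (intro sum_strict_mono) auto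
  also have "\<dots> = (\<Sum>u\<in>V. \<Sum>w\<in>V. e u w * (\<Sum>i<N. cr u w i))"
  proof -
    have "(\<Sum>i<N. bd i) = (\<Sum>u\<in>V. \<Sum>i<N. \<Sum>w\<in>V. e u w * cr u w i)"
      unfolding bd by (rule sum.swap)
    also have "\<dots> = (\<Sum>u\<in>V. \<Sum>w\<in>V. \<Sum>i<N. e u w * cr u w i)"
      by (intro sum.cong refl sum.swap)
    finally show ?thesis by (simp add: sum_distrib_left)
  qed
  also have "\<dots> \<le> (\<Sum>u\<in>V. \<Sum>w\<in>V. e u w * (if 1 / 4 \<le> g u then 1 else 0) + 4 * real N ^ 3 * (e u w * (g u - g w)\<^sup>2))"
  proof (intro sum_mono)
    fix u w
    have e0: "0 \<le> e u w" by (simp add: e_def)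
    have "(\<Sum>i<N. cr u w i) \<le> (if 1 / 4 \<le> g u then 1 else 0) + 4 * real N ^ 3 * (g u - g w)\<^sup>2"
      by (rule order_trans[OF crs]) auto
    then have "e u w * (\<Sum>i<N. cr u w i) \<le> e u w * ((if 1 / 4 \<le> g u then 1 else 0) + 4 * real N ^ 3 * (g u - g w)\<^sup>2)"
      using e0 by (rule mult_left_mono)
    then show "e u w * (\<Sum>i<N. cr u w i) \<le> e u w * (if 1 / 4 \<le> g u then 1 else 0) + 4 * real N ^ 3 * (e u w * (g u - g w)\<^sup>2)"
      by (simp add: algebra_simps)
  qed
  also have "\<dots> = (\<Sum>u\<in>V. \<Sum>w\<in>V. e u w * (if 1 / 4 \<le> g u then 1 else 0)) + 4 * real N ^ 3 * (\<Sum>u\<in>V. \<Sum>w\<in>V. e u w * (g u - g w)\<^sup>2)"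
    by (simp add: sum.distrib sum_distrib_left)
  also have "(\<Sum>u\<in>V. \<Sum>w\<in>V. e u w * (g u - g w)\<^sup>2) = 4 * d * E"
    unfolding V_def e_def E_def by (rule dirichlet_form[OF deg])
  also have "(\<Sum>u\<in>V. \<Sum>w\<in>V. e u w * (if 1 / 4 \<le> g u then 1 else 0)) = (\<Sum>u\<in>V. if 1 / 4 \<le> g u then real d else 0)"
  proof (rule sum.cong[OF refl])
    fix u assume "u \<in> V"
    then show "(\<Sum>w\<in>V. e u w * (if 1 / 4 \<le> g u then 1 else 0)) = (if 1 / 4 \<le> g u then real d else 0)"
      using deg[of u] by (auto simp: V_def e_def)
  qed
  also have "\<dots> = real d * real (card {v \<in> V. 1 / 4 \<le> g v})"
    using finV by (simp add: sum.If_cases Int_def)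
  also have "real d * real (card {v \<in> V. 1 / 4 \<le> g v}) + 4 * real N ^ 3 * (4 * d * E) \<le> d * X + 4 * real N ^ 3 * (4 * d * E)"
    using A0 by (intro add_right_mono mult_left_mono) (auto simp: V_def)
  also have "\<dots> = N * (d * X / N + 16 * d * N\<^sup>2 * E)"
    using N by (simp add: field_simps power2_eq_square power3_eq_cube)
  finally show False by simp
qed

text \<open>The set \<open>A'\<close> is a level set of \<open>g = (PG G ^^ k) f\<close> for the
  indicator \<open>f\<close> of \<open>A\<close>. The second moment inequality bounds the distance
  of \<open>f\<close> and \<open>g\<close> uniformly in \<open>k\<close>, so \<open>\<gamma>\<close>
  can precede \<open>\<eta>\<close>; the first makes the Dirichlet form of \<open>g\<close> tiny for
  large \<open>k\<close>.\<close>

lemma property_T_smoothing: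
  assumes "property_T \<Gamma>"
  obtains \<gamma> :: real where "0 < \<gamma>"
    "\<And>\<eta> :: real. 0 < \<eta> \<Longrightarrow> \<exists>R\<ge>1. \<forall>(G :: 'v graph) A. finite (verts G) \<longrightarrow> A \<subseteq> verts G \<longrightarrow> A \<noteq> {} \<longrightarrow>
      (\<forall>v\<in>A. \<exists>\<phi>. chart G R \<phi> \<and> \<phi> \<one> = v) \<longrightarrow>
      real (edges_between G A (verts G - A)) \<le> \<gamma> * card A \<longrightarrow>
      (\<exists>A'\<subseteq>verts G. real (card (A - A')) \<le> card A / 4 \<and> real (card (A' - A)) \<le> card A / 4 \<and>
        real (edges_between G A' (verts G - A')) \<le> \<eta> * card A)"
proof -
  obtain c where c: "0 < c" "c < 1" and T: "\<And>k \<beta>. 0 < \<beta> \<Longrightarrow> \<exists>M. \<forall>\<psi>. local_pd M \<psi> \<longrightarrow>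
      moment \<psi> (2 * k) - moment \<psi> (Suc (2 * k)) \<le> (1 - c) ^ k + \<beta> \<and>
      c\<^sup>2 * (moment \<psi> 0 - 2 * moment \<psi> k + moment \<psi> (2 * k)) \<le> moment \<psi> 0 - moment \<psi> 1 + \<beta>"
    using property_T_local_moments[OF assms] by blast
  \<comment> \<open>With \<open>\<beta> \<le> c\<^sup>2 / 128\<close>, the sum
    \<open>\<gamma> / (2 * d) + \<beta>\<close> is at most \<open>c\<^sup>2 / 64\<close>. Hence
    \<open>D \<le> card A / 64\<close>, and the factor 16 lost in passing to level sets still leaves
    \<open>card A / 4\<close>.\<close>
  define \<gamma> where "\<gamma> = d * c\<^sup>2 / 64"
  have \<gamma>: "0 < \<gamma>" using c d_pos by (simp add: \<gamma>_def)
  show ?thesis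
  proof (rule that[OF \<gamma>])
    fix \<eta> :: real assume \<eta>: "0 < \<eta>"
    \<comment> \<open>So many thresholds push the first term of \<open>exists_level_set\<close>,
      with \<open>X = 5 / 4 * card A\<close>, below \<open>\<eta> / 2 * card A\<close>.\<close>
    obtain N :: nat where N': "5 * d / (2 * \<eta>) < N" using reals_Archimedean2 by blast
    have "0 < 5 * d / (2 * \<eta>)" using \<eta> d_pos by simp
    then have N: "0 < N" using N' by (metis less_trans of_nat_0_less_iff)
    \<comment> \<open>Chosen so that \<open>16 * d * N\<^sup>2 * \<epsilon> = \<eta> / 2\<close>,
      the other half of the allowed boundary.\<close>
    define \<epsilon> where "\<epsilon> = \<eta> / (32 * d * N\<^sup>2)"
    have \<epsilon>: "0 < \<epsilon>" using \<eta> d_pos N by (simp add: \<epsilon>_def)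
    obtain k where k: "(1 - c) ^ k < \<epsilon> / 2" using real_arch_pow_inv[of "\<epsilon> / 2" "1 - c"] \<epsilon> c by auto
    define \<beta> where "\<beta> = min (\<epsilon> / 2) (c\<^sup>2 / 128)"
    have \<beta>: "0 < \<beta>" using \<epsilon> c by (simp add: \<beta>_def)
    obtain M where M: "\<And>\<psi>. local_pd M \<psi> \<Longrightarrow>
      moment \<psi> (2 * k) - moment \<psi> (Suc (2 * k)) \<le> (1 - c) ^ k + \<beta> \<and>
      c\<^sup>2 * (moment \<psi> 0 - 2 * moment \<psi> k + moment \<psi> (2 * k)) \<le> moment \<psi> 0 - moment \<psi> 1 + \<beta>"
      using T[OF \<beta>] by blast
    \<comment> \<open>Large enough for positivity at radius \<open>M\<close> and for the moments up
      to \<open>2 * k + 1\<close>; it also leaves \<open>k < R\<close>.\<close>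
    define m where "m = M + 2 * k + 1"
    obtain R where R: "\<And>(G :: 'v graph) A f. \<lbrakk>finite (verts G); A \<subseteq> verts G; \<And>v. v \<notin> A \<Longrightarrow> f v = 0;
      \<And>v. v \<in> A \<Longrightarrow> \<exists>\<phi>. chart G R \<phi> \<and> \<phi> \<one> = v; 0 < (\<Sum>v\<in>A. (f v)\<^sup>2)\<rbrakk> \<Longrightarrow>
      \<exists>\<psi>. local_pd m \<psi> \<and>
        (\<forall>j\<le>m. moment \<psi> j * (\<Sum>v\<in>A. (f v)\<^sup>2) = (\<Sum>v\<in>A. f v * (PG G ^^ j) f v))" and mR: "m \<le> R"
      using graph_moments[of m] by blast
    show "\<exists>R\<ge>1. \<forall>(G :: 'v graph) A. finite (verts G) \<longrightarrow> A \<subseteq> verts G \<longrightarrow> A \<noteq> {} \<longrightarrow>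
      (\<forall>v\<in>A. \<exists>\<phi>. chart G R \<phi> \<and> \<phi> \<one> = v) \<longrightarrow>
      real (edges_between G A (verts G - A)) \<le> \<gamma> * card A \<longrightarrow>
      (\<exists>A'\<subseteq>verts G. real (card (A - A')) \<le> card A / 4 \<and> real (card (A' - A)) \<le> card A / 4 \<and>
        real (edges_between G A' (verts G - A')) \<le> \<eta> * card A)"
    proof (intro exI[of _ R] conjI allI impI)
      show "1 \<le> R" using mR by (simp add: m_def)
      fix G :: "'v graph" and A
      assume fin: "finite (verts G)" and A: "A \<subseteq> verts G" and ne: "A \<noteq> {}"
        and ch: "\<forall>v\<in>A. \<exists>\<phi>. chart G R \<phi> \<and> \<phi> \<one> = v"
        and bdA: "real (edges_between G A (verts G - A)) \<le> \<gamma> * card A"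
      define V where "V = verts G"
      define f where "f v = (if v \<in> A then 1 else 0 :: real)" for v
      define g where "g = (PG G ^^ k) f"
      have finV: "finite V" and AV: "A \<subseteq> V" using fin A by (auto simp: V_def)
      have finA: "finite A" using finV AV finite_subset by blast
      have cA: "0 < real (card A)" using finA ne by (simp add: card_gt_0_iff)
      have Z: "(\<Sum>v\<in>A. (f v)\<^sup>2) = card A" by (simp add: f_def)
      have "\<exists>\<psi>. local_pd m \<psi> \<and>
        (\<forall>j\<le>m. moment \<psi> j * (\<Sum>v\<in>A. (f v)\<^sup>2) = (\<Sum>v\<in>A. f v * (PG G ^^ j) f v))"
        using fin A ch cA by (intro R) (auto simp: f_def)
      then obtain \<psi> where \<psi>: "local_pd m \<psi>"
        and mom0: "\<And>j. j \<le> m \<Longrightarrow> moment \<psi> j * card A = (\<Sum>v\<in>A. f v * (PG G ^^ j) f v)"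
        using Z by auto
      have mom: "moment \<psi> j * card A = inner G f ((PG G ^^ j) f)" if "j \<le> m" for j
      proof -
        have "(\<Sum>v\<in>A. f v * (PG G ^^ j) f v) = inner G f ((PG G ^^ j) f)"
          unfolding inner_def using fin A by (intro sum.mono_neutral_left) (auto simp: f_def)
        then show ?thesis using mom0[OF that] by simp
      qed
      have "local_pd M \<psi>" by (rule local_pd_mono[OF \<psi>]) (simp add: m_def)
      note M' = M[OF this]
      \<comment> \<open>As \<open>k < R\<close>, the support of \<open>g\<close> lies in the
        interior of charts, where all edges are seen.\<close>
      have deg: "(\<Sum>w\<in>verts G. real (emult G {v, w})) = d" if v: "v \<in> verts G" "g v \<noteq> 0" for v
      proof -
        have "k \<le> R" "k < R" using mR by (auto simp: m_def)
        then obtain \<phi> x where "chart G R \<phi>" "x \<in> W k" "v = \<phi> x"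
          using PG_pow_support[OF fin, of A f R k v] ch v unfolding g_def f_def by auto
        then show ?thesis using chart_degree \<open>k < R\<close> fin by blast
      qed
      have degA: "(\<Sum>w\<in>verts G. real (emult G {v, w})) = d" if v: "v \<in> A" for v
      proof -
        obtain \<phi> where "chart G R \<phi>" "\<phi> \<one> = v" using ch v by blast
        then show ?thesis using chart_degree[of G R \<phi> \<one> 0] fin mR by (auto simp: m_def)
      qed
      \<comment> \<open>The pairing of \<open>f - PG G f\<close> with \<open>f\<close> gives each
        edge leaving \<open>A\<close> the weight \<open>1 / (2 * d)\<close>.\<close>
      have m01: "(moment \<psi> 0 - moment \<psi> 1) * card A = real (edges_between G A (verts G - A)) / (2 * d)"
      proof -
        have "form G f f = (\<Sum>u\<in>V. \<Sum>w\<in>V. if u \<in> A \<and> w \<in> A then real (emult G {u, w}) else 0)"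
          unfolding form_def V_def by (intro sum.cong refl) (auto simp: f_def)
        also have "\<dots> = (\<Sum>u\<in>A. \<Sum>w\<in>V. if u \<in> A \<and> w \<in> A then real (emult G {u, w}) else 0)"
          using finV AV by (intro sum.mono_neutral_right) auto
        also have "\<dots> = (\<Sum>u\<in>A. \<Sum>w\<in>A. real (emult G {u, w}))"
        proof (rule sum.cong[OF refl])
          fix u assume u: "u \<in> A"
          have "(\<Sum>w\<in>V. if u \<in> A \<and> w \<in> A then real (emult G {u, w}) else 0)
            = (\<Sum>w\<in>A. if u \<in> A \<and> w \<in> A then real (emult G {u, w}) else 0)"
            using finV AV by (intro sum.mono_neutral_right) auto
          then show "(\<Sum>w\<in>V. if u \<in> A \<and> w \<in> A then real (emult G {u, w}) else 0) = (\<Sum>w\<in>A. real (emult G {u, w}))"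
            using u by simp
        qed
        finally have ff: "form G f f = (\<Sum>u\<in>A. \<Sum>w\<in>A. real (emult G {u, w}))" .
        have "real d * card A = (\<Sum>u\<in>A. \<Sum>w\<in>V. real (emult G {u, w}))"
          using degA by (simp add: V_def)
        also have "\<dots> = (\<Sum>u\<in>A. (\<Sum>w\<in>V - A. real (emult G {u, w})) + (\<Sum>w\<in>A. real (emult G {u, w})))"
          using finV AV by (intro sum.cong refl sum.subset_diff) auto
        also have "\<dots> = real (edges_between G A (V - A)) + form G f f"
          by (simp add: sum.distrib edges_between_def ff)
        finally have e: "real d * card A = real (edges_between G A (V - A)) + form G f f" .
        have "(moment \<psi> 0 - moment \<psi> 1) * card A = inner G f f - inner G f (PG G f)"
          using mom[of 0] mom[of 1] by (simp add: m_def algebra_simps)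
        also have "\<dots> = inner G f f / 2 - form G f f / (2 * d)"
          by (simp add: inner_PG_sym[symmetric] inner_PG)
        also have "inner G f f = card A" using mom[of 0] \<psi> by (simp add: moment_def local_pd_def)
        finally show ?thesis using e d_pos by (simp add: V_def field_simps)
      qed
      define D where "D = (\<Sum>v\<in>V. (f v - g v)\<^sup>2)"
      have Deq: "D = (moment \<psi> 0 - 2 * moment \<psi> k + moment \<psi> (2 * k)) * card A"
      proof -
        have "D = inner G f f - 2 * inner G f g + inner G g g"
          unfolding D_def inner_def V_def
          by (simp add: power2_eq_square algebra_simps sum.distrib sum_subtractf sum_distrib_left)
        also have "inner G g g = inner G f ((PG G ^^ (k + k)) f)" unfolding g_def by (rule inner_PG_pow)
        also have "inner G f f = moment \<psi> 0 * card A" using mom[of 0] by simp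
        also have "inner G f g = moment \<psi> k * card A" using mom[of k] by (simp add: m_def g_def)
        also have "inner G f ((PG G ^^ (k + k)) f) = moment \<psi> (2 * k) * card A"
          using mom[of "k + k"] by (simp add: m_def mult_2)
        finally show ?thesis by (simp add: distrib_right left_diff_distrib)
      qed
      have "c\<^sup>2 * D = (c\<^sup>2 * (moment \<psi> 0 - 2 * moment \<psi> k + moment \<psi> (2 * k))) * card A"
        by (simp add: Deq)
      also have "\<dots> \<le> (moment \<psi> 0 - moment \<psi> 1 + \<beta>) * card A"
        using M' by (intro mult_right_mono) auto
      also have "\<dots> = real (edges_between G A (verts G - A)) / (2 * d) + \<beta> * card A"
        using m01 by (simp add: algebra_simps)
      also have "\<dots> \<le> (\<gamma> * card A) / (2 * d) + c\<^sup>2 / 128 * card A"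
        using bdA by (intro add_mono divide_right_mono mult_right_mono) (auto simp: \<beta>_def)
      also have "\<dots> = c\<^sup>2 * (card A / 64)" using d_pos by (simp add: \<gamma>_def field_simps)
      finally have D: "16 * D \<le> card A / 4" using c by simp
      \<comment> \<open>Where membership in \<open>A\<close> and in the level set disagree,
        \<open>f\<close> is 0 or 1 and \<open>g\<close> lies on the other side of \<open>t\<close>,
        at distance at least 1/4; the factor 16 is the inverse square.\<close>
      have sym: "card ((A - {v \<in> V. t \<le> g v}) \<union> ({v \<in> V. t \<le> g v} - A)) \<le> 16 * D" (is "real (card ?Y) \<le> _")
        if t: "1 / 4 \<le> t" "t \<le> 3 / 4" for t
      proof -
        have "1 / 16 \<le> (f v - g v)\<^sup>2" if v: "v \<in> ?Y" for v
        proof -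
          have "1 / 4 \<le> \<bar>f v - g v\<bar>" using v t AV by (auto simp: f_def)
          then have "(1 / 4)\<^sup>2 \<le> \<bar>f v - g v\<bar>\<^sup>2" by (intro power_mono) auto
          then show ?thesis by (simp add: power2_eq_square)
        qed
        then have "(\<Sum>v\<in>?Y. 1 / 16) \<le> (\<Sum>v\<in>?Y. (f v - g v)\<^sup>2)" by (intro sum_mono) auto
        also have "\<dots> \<le> D" unfolding D_def using finV AV by (intro sum_mono2) auto
        finally show ?thesis by simp
      qed
      have A0: "real (card {v \<in> verts G. 1 / 4 \<le> g v}) \<le> 5 / 4 * card A"
      proof -
        have "{v \<in> V. 1 / 4 \<le> g v} \<subseteq> A \<union> ((A - {v \<in> V. 1 / 4 \<le> g v}) \<union> ({v \<in> V. 1 / 4 \<le> g v} - A))" by blast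
        then have "card {v \<in> V. 1 / 4 \<le> g v} \<le> card (A \<union> ((A - {v \<in> V. 1 / 4 \<le> g v}) \<union> ({v \<in> V. 1 / 4 \<le> g v} - A)))"
          using finV finA by (intro card_mono) auto
        also have "\<dots> \<le> card A + card ((A - {v \<in> V. 1 / 4 \<le> g v}) \<union> ({v \<in> V. 1 / 4 \<le> g v} - A))"
          by (rule card_Un_le)
        finally show ?thesis using sym[of "1 / 4"] D by (simp add: V_def)
      qed
      obtain t where t: "1 / 4 \<le> t" "t \<le> 3 / 4"
        and bdt: "real (edges_between G {v \<in> V. t \<le> g v} (V - {v \<in> V. t \<le> g v}))
          \<le> d * (5 / 4 * card A) / N + 16 * d * N\<^sup>2 * (inner G g g - inner G (PG G g) g)"
        using exists_level_set[OF fin N deg A0] unfolding V_def by blast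
      have "inner G g g - inner G (PG G g) g = (moment \<psi> (2 * k) - moment \<psi> (Suc (2 * k))) * card A"
      proof -
        have "inner G g g = inner G f ((PG G ^^ (k + k)) f)" unfolding g_def by (rule inner_PG_pow)
        moreover have "inner G (PG G g) g = inner G f ((PG G ^^ (Suc k + k)) f)"
          using inner_PG_pow[of G "Suc k" f k] by (simp add: g_def)
        moreover have "inner G f ((PG G ^^ (k + k)) f) = moment \<psi> (2 * k) * card A"
          using mom[of "k + k"] by (simp add: m_def mult_2)
        moreover have "inner G f ((PG G ^^ (Suc k + k)) f) = moment \<psi> (Suc (2 * k)) * card A"
          using mom[of "Suc k + k"] by (simp add: m_def mult_2)
        ultimately show ?thesis by (simp only: left_diff_distrib)
      qed
      also have "\<dots> \<le> \<epsilon> * card A"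
        using M' k by (intro mult_right_mono) (auto simp: \<beta>_def)
      finally have "16 * d * N\<^sup>2 * (inner G g g - inner G (PG G g) g) \<le> 16 * d * N\<^sup>2 * (\<epsilon> * card A)"
        by (intro mult_left_mono) auto
      also have "\<dots> = \<eta> / 2 * card A" using d_pos N by (simp add: \<epsilon>_def field_simps)
      finally have b1: "16 * d * N\<^sup>2 * (inner G g g - inner G (PG G g) g) \<le> \<eta> / 2 * card A" .
      have "5 * d \<le> N * (2 * \<eta>)" using N' \<eta> by (simp add: field_simps)
      then have "(5 * d) / (4 * N) \<le> \<eta> / 2" using N by (simp add: field_simps)
      then have "(5 * d) / (4 * N) * card A \<le> \<eta> / 2 * card A" by (intro mult_right_mono) auto
      then have b2: "d * (5 / 4 * card A) / N \<le> \<eta> / 2 * card A" by (simp add: field_simps)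
      show "\<exists>A'\<subseteq>verts G. real (card (A - A')) \<le> card A / 4 \<and> real (card (A' - A)) \<le> card A / 4 \<and>
        real (edges_between G A' (verts G - A')) \<le> \<eta> * card A"
      proof (intro exI[of _ "{v \<in> V. t \<le> g v}"] conjI)
        let ?A' = "{v \<in> V. t \<le> g v}"
        have "card (A - ?A') \<le> card ((A - ?A') \<union> (?A' - A))" "card (?A' - A) \<le> card ((A - ?A') \<union> (?A' - A))"
          using finV finA by (auto intro!: card_mono)
        then show "real (card (A - ?A')) \<le> card A / 4" "real (card (?A' - A)) \<le> card A / 4"
          using sym[OF t] D by linarith+
        show "real (edges_between G ?A' (verts G - ?A')) \<le> \<eta> * card A"
          using bdt b1 b2 unfolding V_def by linarith
      qed (simp add: V_def)
    qed
  qed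
qed

end

section \<open>Decomposition into expanding sets\<close>

lemma edges_between_sym: "edges_between G A B = edges_between G B A"
  unfolding edges_between_def by (subst sum.swap) (simp add: insert_commute)

lemma edges_between_mono:
  assumes "A \<subseteq> A'" "B \<subseteq> B'" "finite A'" "finite B'"
  shows "edges_between G A B \<le> edges_between G A' B'"
proof -
  have "edges_between G A B \<le> (\<Sum>u\<in>A. \<Sum>v\<in>B'. emult G {u, v})"
    unfolding edges_between_def using assms by (intro sum_mono sum_mono2) auto
  also have "\<dots> \<le> edges_between G A' B'"
    unfolding edges_between_def using assms by (intro sum_mono2) auto
  finally show ?thesis .
qed

lemma edges_between_Un_left:
  "\<lbrakk>finite A; finite A'; A \<inter> A' = {}\<rbrakk> \<Longrightarrow> edges_between G (A \<union> A') B = edges_between G A B + edges_between G A' B"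
  by (simp add: edges_between_def sum.union_disjoint)

lemma edges_between_Un_right:
  "\<lbrakk>finite B; finite B'; B \<inter> B' = {}\<rbrakk> \<Longrightarrow> edges_between G A (B \<union> B') = edges_between G A B + edges_between G A B'"
  by (simp add: edges_between_def sum.union_disjoint sum.distrib)

lemma edges_between_empty [simp]: "edges_between G {} B = 0" "edges_between G A {} = 0"
  by (simp_all add: edges_between_def)

lemma edges_between_le_degree:
  assumes "finite (verts G)" "A \<subseteq> verts G" "B \<subseteq> verts G" "\<And>v. v \<in> A \<Longrightarrow> vertex_degree G v \<le> D"
  shows "edges_between G A B \<le> D * card A"
proof -
  have "edges_between G A B \<le> (\<Sum>u\<in>A. D)"
    unfolding edges_between_def
  proof (rule sum_mono)
    fix u assume u: "u \<in> A"
    have "(\<Sum>v\<in>B. emult G {u, v}) \<le> vertex_degree G u"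
      unfolding vertex_degree_def using assms by (intro sum_mono2) auto
    then show "(\<Sum>v\<in>B. emult G {u, v}) \<le> D" using assms(4)[OF u] by simp
  qed
  then show ?thesis by (simp add: mult.commute)
qed

definition expanding :: "'v graph \<Rightarrow> real \<Rightarrow> 'v set \<Rightarrow> bool" where
  "expanding G g U \<longleftrightarrow> (\<forall>A\<subseteq>U. real (card A) \<le> real (card U) / 2 \<longrightarrow> g * real (card A) \<le> real (edges_between G A (U - A)))"

text \<open>Remove a largest set \<open>X\<close> of at most half of \<open>B\<close> with boundary
  at most \<open>g * card X\<close>. A set \<open>Y\<close> violating expansion of
  \<open>B - X\<close> could be added to \<open>X\<close> unless the union passes half of
  \<open>B\<close>. Then \<open>Y\<close> has more than a quarter of \<open>B\<close>, but it is
  sparse in \<open>B\<close>, and \<open>small\<close> leaves it less than a quarter.\<close>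

lemma expanding_core:
  fixes g W :: real
  assumes fin: "finite B" and g: "0 < g" and W: "0 \<le> W"
    and small: "\<And>A. \<lbrakk>A \<subseteq> B; A \<noteq> {}; real (card A) \<le> real (card B) / 2;
      edges_between G A (B - A) < 2 * g * card A\<rbrakk> \<Longrightarrow> 2 * g * card A < W"
  shows "\<exists>U\<subseteq>B. expanding G g U \<and> g * card (B - U) \<le> 2 * W"
\<comment> \<open>When \<open>W\<close> is this large, dropping all of \<open>B\<close> stays within
  the allowance \<open>2 * W\<close>.\<close>
proof (cases "g * card B / 2 \<le> W")
  case True
  show ?thesis by (rule exI[of _ "{}"]) (use True in \<open>auto simp: expanding_def\<close>)
next
  case False
  define \<X> where "\<X> = {X. X \<subseteq> B \<and> real (card X) \<le> real (card B) / 2 \<and> edges_between G X (B - X) \<le> g * card X}"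
  have finX': "finite \<X>"
    by (rule finite_subset[of _ "Pow B"]) (use fin in \<open>auto simp: \<X>_def\<close>)
  have "{} \<in> \<X>" by (simp add: \<X>_def)
  then have "Max (card ` \<X>) \<in> card ` \<X>" using finX' by (intro Max_in finite_imageI) blast+
  then obtain X where X: "X \<in> \<X>" and Xmax: "card X = Max (card ` \<X>)" by (metis imageE)
  have mx: "card Y \<le> card X" if "Y \<in> \<X>" for Y
    unfolding Xmax using finX' that by (intro Max_ge) auto
  have XB: "X \<subseteq> B" and Xc: "real (card X) \<le> real (card B) / 2" and Xe: "edges_between G X (B - X) \<le> g * card X"
    using X by (auto simp: \<X>_def)
  have finX: "finite X" using XB fin finite_subset by blast
  have gX: "2 * g * card X \<le> W"
  proof (cases "X = {}")
    case False
    then have "0 < g * card X" using g finX by (simp add: card_gt_0_iff)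
    then have "edges_between G X (B - X) < 2 * g * card X" using Xe by linarith
    then show ?thesis using small[OF XB False Xc] by simp
  qed (use W in simp)
  have Xsmall: "real (card X) < card B / 4"
  proof -
    have "g * (2 * card X) < g * (card B / 2)" using gX False by (simp add: algebra_simps)
    then show ?thesis using g by simp
  qed
  have "expanding G g (B - X)"
    unfolding expanding_def
  proof (intro allI impI, rule ccontr)
    fix Y assume Y: "Y \<subseteq> B - X" "real (card Y) \<le> real (card (B - X)) / 2"
      and "\<not> g * card Y \<le> edges_between G Y ((B - X) - Y)"
    then have Ye: "edges_between G Y ((B - X) - Y) < g * card Y" by simp
    have finY: "finite Y" using Y fin finite_subset by blast
    have Y0: "Y \<noteq> {}" using Ye by auto
    have disj: "X \<inter> Y = {}" using Y by blast
    have cXY: "card (X \<union> Y) = card X + card Y" using finX finY disj by (rule card_Un_disjoint)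
    have XYe: "edges_between G (X \<union> Y) (B - (X \<union> Y)) \<le> g * card (X \<union> Y)"
    proof -
      have "B - (X \<union> Y) = (B - X) - Y" by blast
      then have "edges_between G (X \<union> Y) (B - (X \<union> Y)) = edges_between G X ((B - X) - Y) + edges_between G Y ((B - X) - Y)"
        using finX finY disj by (simp add: edges_between_Un_left)
      moreover have "edges_between G X ((B - X) - Y) \<le> edges_between G X (B - X)"
        using fin finX by (intro edges_between_mono) auto
      ultimately show ?thesis using Xe Ye by (simp add: cXY algebra_simps)
    qed
    have "\<not> X \<union> Y \<in> \<X>"
    proof
      assume "X \<union> Y \<in> \<X>"
      then have "card X + card Y \<le> card X" using mx[of "X \<union> Y"] cXY by simp
      then show False using Y0 finY by simp
    qed
    then have "real (card X) + card Y > card B / 2" using XYe XB Y cXY by (auto simp: \<X>_def)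
    then have Ybig: "card B / 4 < real (card Y)" using Xsmall by linarith
    \<comment> \<open>Inside \<open>B\<close> the set \<open>Y\<close> gains only its edges to
      \<open>X\<close>, at most \<open>g * card X \<le> g * card Y\<close> of them. This is why
      \<open>small\<close> is assumed at \<open>2 * g\<close>.\<close>
    have "edges_between G Y (B - Y) = edges_between G Y ((B - X) - Y) + edges_between G Y X"
    proof -
      have "B - Y = ((B - X) - Y) \<union> X" using XB Y by blast
      then show ?thesis using fin finX by (subst edges_between_Un_right[symmetric]) auto
    qed
    moreover have "edges_between G Y X \<le> edges_between G X (B - X)"
      using Y fin finX by (subst edges_between_sym) (auto intro!: edges_between_mono)
    ultimately have "edges_between G Y (B - Y) < g * card Y + g * card X" using Xe Ye by linarith
    moreover have "g * card X \<le> g * card Y" using g Xsmall Ybig by (intro mult_left_mono) auto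
    ultimately have "edges_between G Y (B - Y) < 2 * g * card Y" by linarith
    moreover have "card (B - X) \<le> card B" using fin by (intro card_mono) auto
    then have "real (card Y) \<le> card B / 2" using Y by linarith
    ultimately have "2 * g * card Y < W" using small[of Y] Y Y0 by blast
    then have "g * (2 * card Y) < g * (card B / 2)" using False by (simp add: algebra_simps)
    then have "2 * card Y < real (card B) / 2" using g by simp
    then show False using Ybig by simp
  qed
  moreover have "B - (B - X) = X" using XB by blast
  then have "g * card (B - (B - X)) \<le> 2 * W" using gX W by simp
  ultimately show ?thesis by (intro exI[of _ "B - X"]) auto
qed

text \<open>Each part is split off as a set of minimum size among the sets with few edges to what is left;
  edges to earlier parts do not count, so intersecting with what is left never creates boundary.\<close>

definition min_sparse :: "'v graph \<Rightarrow> real \<Rightarrow> 'v set \<Rightarrow> 'v set \<Rightarrow> bool" where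
  "min_sparse G \<eta> R B \<longleftrightarrow> B \<subseteq> R \<and>
    (\<forall>B'\<subseteq>R. B' \<noteq> {} \<longrightarrow> real (edges_between G B' (R - B')) \<le> \<eta> * real (card B') \<longrightarrow> card B \<le> card B')"

lemma min_sparse_subset: "min_sparse G \<eta> R B \<Longrightarrow> B \<subseteq> R"
  by (simp add: min_sparse_def)

lemma min_sparse_card_le:
  "\<lbrakk>min_sparse G \<eta> R B; B' \<subseteq> R; B' \<noteq> {}; real (edges_between G B' (R - B')) \<le> \<eta> * real (card B')\<rbrakk>
    \<Longrightarrow> card B \<le> card B'"
  by (simp add: min_sparse_def)

text \<open>A part \<open>B\<close> is split off with at most \<open>\<eta> * card B\<close> edges
  to the remainder. In the sum over all parts each of these edges is seen from both of its ends,
  hence the factor 2.\<close>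

lemma min_sparse_partition:
  assumes "finite T" "0 \<le> \<eta>"
  shows "\<exists>\<P>. partition_on T \<P> \<and> (\<forall>B\<in>\<P>. \<exists>R\<subseteq>T. min_sparse G \<eta> R B) \<and>
    real (\<Sum>B\<in>\<P>. edges_between G B (T - B)) \<le> 2 * \<eta> * card T"
  using assms(1)
proof (induction "card T" arbitrary: T rule: less_induct)
  case less
  show ?case
  proof (cases "T = {}")
    case True
    then show ?thesis by (intro exI[of _ "{}"]) (auto simp: partition_on_def)
  next
    case False
    define \<S> where "\<S> = {B. B \<subseteq> T \<and> B \<noteq> {} \<and> edges_between G B (T - B) \<le> \<eta> * card B}"
    \<comment> \<open>No edge leaves \<open>T\<close> within \<open>T\<close>, so \<open>T\<close>
      itself is a candidate and one of least size exists.\<close>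
    have "T \<in> \<S>" using False assms(2) by (simp add: \<S>_def)
    then obtain B where B: "B \<in> \<S>" and mn: "\<And>B'. B' \<in> \<S> \<Longrightarrow> card B \<le> card B'"
      using ex_has_least_nat[of "\<lambda>B. B \<in> \<S>" T card] by blast
    have BT: "B \<subseteq> T" and B0: "B \<noteq> {}" and Be: "edges_between G B (T - B) \<le> \<eta> * card B"
      using B by (auto simp: \<S>_def)
    have finB: "finite B" using BT less.prems finite_subset by blast
    define T' where "T' = T - B"
    have "card T' < card T" unfolding T'_def using BT B0 less.prems by (intro psubset_card_mono) auto
    moreover have finT': "finite T'" using less.prems by (simp add: T'_def)
    ultimately obtain \<P> where P: "partition_on T' \<P>" "\<forall>B\<in>\<P>. \<exists>R\<subseteq>T'. min_sparse G \<eta> R B"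
      "real (\<Sum>B\<in>\<P>. edges_between G B (T' - B)) \<le> 2 * \<eta> * card T'"
      using less.hyps by blast
    have part: "partition_on T (insert B \<P>)"
    proof -
      have "disjnt B (\<Union>\<P>)" using P(1) by (auto simp: partition_on_def T'_def disjnt_def)
      then show ?thesis using P(1) BT B0 by (simp add: partition_on_insert T'_def)
    qed
    have BP: "B \<notin> \<P>" using P(1) B0 by (auto simp: partition_on_def T'_def)
    have finP: "finite \<P>" using P(1) finT' by (metis finite_elements)
    have PT': "C \<subseteq> T'" if "C \<in> \<P>" for C using P(1) that by (auto simp: partition_on_def)
    have "(\<Sum>C\<in>\<P>. edges_between G C (T - C)) = (\<Sum>C\<in>\<P>. edges_between G C (T' - C)) + (\<Sum>C\<in>\<P>. edges_between G C B)"
      unfolding sum.distrib[symmetric]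
    proof (rule sum.cong[OF refl])
      fix C assume C: "C \<in> \<P>"
      have "T - C = (T' - C) \<union> B" using PT'[OF C] BT by (auto simp: T'_def)
      then show "edges_between G C (T - C) = edges_between G C (T' - C) + edges_between G C B"
        using finT' finB by (auto simp: T'_def intro!: edges_between_Un_right)
    qed
    also have "(\<Sum>C\<in>\<P>. edges_between G C B) = edges_between G T' B"
    proof -
      have "edges_between G T' B = (\<Sum>u\<in>\<Union>\<P>. \<Sum>v\<in>B. emult G {u, v})"
        using P(1) by (simp add: partition_on_def edges_between_def)
      also have "\<dots> = (\<Sum>C\<in>\<P>. edges_between G C B)"
        unfolding edges_between_def using P(1) PT' finT'
        by (subst sum.Union_disjoint) (auto simp: partition_on_def disjoint_def intro: finite_subset)
      finally show ?thesis by simp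
    qed
    also have "edges_between G T' B = edges_between G B (T - B)"
      by (simp add: T'_def edges_between_sym)
    finally have "real (\<Sum>C\<in>insert B \<P>. edges_between G C (T - C))
      = 2 * real (edges_between G B (T - B)) + real (\<Sum>C\<in>\<P>. edges_between G C (T' - C))"
      using finP BP by simp
    also have "\<dots> \<le> 2 * (\<eta> * card B) + 2 * \<eta> * card T'"
      using Be P(3) by linarith
    also have "\<dots> = 2 * \<eta> * card T"
      using BT finB less.prems by (simp add: T'_def card_Diff_subset card_mono of_nat_diff algebra_simps)
    finally have sum: "real (\<Sum>C\<in>insert B \<P>. edges_between G C (T - C)) \<le> 2 * \<eta> * card T" .
    have msB: "min_sparse G \<eta> T B"
      using BT mn by (auto simp: min_sparse_def \<S>_def)
    have "\<exists>R\<subseteq>T. min_sparse G \<eta> R C" if "C \<in> insert B \<P>" for C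
    proof (cases "C = B")
      case True
      then show ?thesis using msB by blast
    next
      case False
      then have "C \<in> \<P>" using that by simp
      then obtain R where R: "R \<subseteq> T'" "min_sparse G \<eta> R C" using bspec[OF P(2)] by metis
      have "R \<subseteq> T" using R(1) by (auto simp: T'_def)
      then show ?thesis using R(2) by (intro exI[of _ R] conjI)
    qed
    then have all: "\<forall>C\<in>insert B \<P>. \<exists>R\<subseteq>T. min_sparse G \<eta> R C" by (intro ballI)
    show ?thesis by (intro exI[of _ "insert B \<P>"] conjI part all sum)
  qed
qed

text \<open>\<open>expanding_core\<close> runs in each part \<open>B\<close> with the edges leaving
  \<open>B\<close> anywhere in \<open>G\<close> as its \<open>W\<close>. These add up to at most
  \<open>2 * \<eta> * card (verts G)\<close> for edges between parts, plus \<open>D\<close> for each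
  vertex outside \<open>T\<close>.\<close>

lemma expander_decomposition:
  fixes G :: "'v graph" and g \<eta> :: real
  assumes fin: "finite (verts G)" and T: "T \<subseteq> verts G"
    and D: "\<And>v. v \<in> verts G \<Longrightarrow> vertex_degree G v \<le> D"
    and g: "0 < g" and \<eta>: "0 < \<eta>"
    and smooth: "\<And>A. \<lbrakk>A \<subseteq> T; A \<noteq> {}; real (edges_between G A (verts G - A)) \<le> 4 * g * card A\<rbrakk> \<Longrightarrow>
      \<exists>A'\<subseteq>verts G. real (card (A - A')) \<le> card A / 4 \<and> real (card (A' - A)) \<le> card A / 4 \<and>
        real (edges_between G A' (verts G - A')) \<le> 3 / 4 * \<eta> * card A"
  shows "\<exists>\<U>. finite \<U> \<and> disjoint \<U> \<and> {} \<notin> \<U> \<and> \<Union>\<U> \<subseteq> T \<and> (\<forall>U\<in>\<U>. expanding G g U) \<and>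
    real (\<Sum>U\<in>\<U>. edges_between G U (verts G - U)) \<le> (1 + 2 * D / g) * (2 * \<eta> * card (verts G) + D * card (verts G - T)) \<and>
    real (card (verts G - \<Union>\<U>)) \<le> card (verts G - T) + 2 / g * (2 * \<eta> * card (verts G) + D * card (verts G - T))"
proof -
  let ?V = "verts G"
  have finT: "finite T" using T fin finite_subset by blast
  obtain \<P> where P: "partition_on T \<P>" "\<forall>B\<in>\<P>. \<exists>R\<subseteq>T. min_sparse G \<eta> R B"
    "real (\<Sum>B\<in>\<P>. edges_between G B (T - B)) \<le> 2 * \<eta> * card T"
    using min_sparse_partition[OF finT, of \<eta> G] \<eta> by auto
  have finP: "finite \<P>" using P(1) finT by (metis finite_elements)
  have BT: "B \<subseteq> T" and finB: "finite B" if "B \<in> \<P>" for B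
    using P(1) that finT by (auto simp: partition_on_def intro: finite_subset)
  define w where "w B = real (edges_between G B (?V - B))" for B
  have "\<exists>U\<subseteq>B. expanding G g U \<and> g * card (B - U) \<le> 2 * w B" if B: "B \<in> \<P>" for B
  proof (rule expanding_core[OF finB[OF B] g])
    show "0 \<le> w B" by (simp add: w_def)
    fix A assume A: "A \<subseteq> B" "A \<noteq> {}" "real (card A) \<le> real (card B) / 2"
      and Ae: "real (edges_between G A (B - A)) < 2 * g * card A"
    have finA: "finite A" using A finB[OF B] finite_subset by blast
    have cA: "0 < card A" using A finA by (simp add: card_gt_0_iff)
    obtain R where R0: "R \<subseteq> T" "min_sparse G \<eta> R B" using bspec[OF P(2) B] by metis
    have R: "R \<subseteq> T" "B \<subseteq> R" using R0(1) min_sparse_subset[OF R0(2)] by auto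
    note mn = min_sparse_card_le[OF R0(2)]
    show "2 * g * card A < w B"
    proof (rule ccontr)
      assume "\<not> ?thesis"
      then have wB: "w B \<le> 2 * g * card A" by simp
      have "?V - A = (B - A) \<union> (?V - B)" using A BT[OF B] T by blast
      then have "edges_between G A (?V - A) = edges_between G A (B - A) + edges_between G A (?V - B)"
        using fin finB[OF B] by (auto intro!: edges_between_Un_right)
      moreover have "edges_between G A (?V - B) \<le> edges_between G B (?V - B)"
        using A fin finB[OF B] by (intro edges_between_mono) auto
      \<comment> \<open>Half of the \<open>4 * g\<close> bounds the edges from \<open>A\<close>
        inside \<open>B\<close>, the other half those leaving \<open>B\<close>.\<close>
      ultimately have "real (edges_between G A (?V - A)) \<le> 4 * g * card A"
        using Ae wB by (simp add: w_def)
      then obtain A' where A': "A' \<subseteq> ?V" "real (card (A - A')) \<le> card A / 4" "real (card (A' - A)) \<le> card A / 4"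
        "real (edges_between G A' (?V - A')) \<le> 3 / 4 * \<eta> * card A"
        using smooth[of A] A BT[OF B] by blast
      have finA': "finite A'" using A' fin finite_subset by blast
      have AR: "A \<subseteq> R" using A R by blast
      have "card A = card (A - A') + card (A \<inter> A')"
        using finA by (metis card_Int_Diff add.commute)
      then have "3 / 4 * real (card A) \<le> card (A \<inter> A')" using A'(2) by linarith
      also have "card (A \<inter> A') \<le> card (A' \<inter> R)" using AR finA' by (intro card_mono) auto
      \<comment> \<open>The intersection with \<open>R\<close> keeps three quarters of
        \<open>A\<close>, which matches the factor 3/4 in the boundary bound of
        \<open>smooth\<close>.\<close>
      finally have lower: "3 / 4 * real (card A) \<le> card (A' \<inter> R)" by simp
      then have ne: "A' \<inter> R \<noteq> {}" using cA by auto
      have "edges_between G (A' \<inter> R) (R - A' \<inter> R) \<le> edges_between G A' (?V - A')"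
        using R T fin finA' by (intro edges_between_mono) auto
      then have "real (edges_between G (A' \<inter> R) (R - A' \<inter> R)) \<le> \<eta> * (3 / 4 * card A)" using A'(4) by simp
      also have "\<dots> \<le> \<eta> * card (A' \<inter> R)" using \<eta> lower by (intro mult_left_mono) auto
      finally have "card B \<le> card (A' \<inter> R)" using ne by (intro mn) auto
      also have "\<dots> \<le> card A'" using finA' by (intro card_mono) auto
      also have "card A' \<le> card ((A' - A) \<union> A)" using finA finA' by (intro card_mono) auto
      also have "\<dots> \<le> card (A' - A) + card A" by (rule card_Un_le)
      \<comment> \<open>As \<open>A\<close> has at most half of \<open>B\<close>, this would give
        \<open>card B \<le> 5 / 8 * card B\<close>.\<close>
      finally have "real (card B) \<le> 5 / 4 * card A" using A'(3) by simp
      then show False using A(3) cA by simp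
    qed
  qed
  then obtain u where u: "\<And>B. B \<in> \<P> \<Longrightarrow> u B \<subseteq> B" "\<And>B. B \<in> \<P> \<Longrightarrow> expanding G g (u B)"
    "\<And>B. B \<in> \<P> \<Longrightarrow> g * card (B - u B) \<le> 2 * w B"
    by metis
  define X where "X = 2 * \<eta> * card ?V + D * card (?V - T)"
  have wX: "(\<Sum>B\<in>\<P>. w B) \<le> X"
  proof -
    have "(\<Sum>B\<in>\<P>. edges_between G B (?V - B)) = (\<Sum>B\<in>\<P>. edges_between G B (T - B)) + (\<Sum>B\<in>\<P>. edges_between G B (?V - T))"
      unfolding sum.distrib[symmetric]
    proof (rule sum.cong[OF refl])
      fix B assume B: "B \<in> \<P>"
      have "?V - B = (T - B) \<union> (?V - T)" using BT[OF B] T by blast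
      then show "edges_between G B (?V - B) = edges_between G B (T - B) + edges_between G B (?V - T)"
        using fin finT by (auto intro!: edges_between_Un_right)
    qed
    also have "(\<Sum>B\<in>\<P>. edges_between G B (?V - T)) = edges_between G T (?V - T)"
    proof -
      have "edges_between G T (?V - T) = (\<Sum>u\<in>\<Union>\<P>. \<Sum>v\<in>?V - T. emult G {u, v})"
        using P(1) by (simp add: partition_on_def edges_between_def)
      also have "\<dots> = (\<Sum>B\<in>\<P>. edges_between G B (?V - T))"
        unfolding edges_between_def using P(1) finB
        by (subst sum.Union_disjoint) (auto simp: partition_on_def disjoint_def)
      finally show ?thesis by simp
    qed
    also have "edges_between G T (?V - T) = edges_between G (?V - T) T" by (rule edges_between_sym)
    also have "edges_between G (?V - T) T \<le> D * card (?V - T)"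
      using fin T D by (intro edges_between_le_degree) auto
    finally have "real (\<Sum>B\<in>\<P>. edges_between G B (?V - B)) \<le> real (\<Sum>B\<in>\<P>. edges_between G B (T - B)) + real (D * card (?V - T))"
      by linarith
    also have "\<dots> \<le> 2 * \<eta> * card T + D * card (?V - T)" using P(3) by simp
    also have "\<dots> \<le> X"
      unfolding X_def using \<eta> T fin by (intro add_right_mono mult_left_mono) (auto simp: card_mono)
    finally show ?thesis by (simp add: w_def)
  qed
  define \<U> where "\<U> = u ` \<P> - {{}}"
  have finU: "finite \<U>" using finP by (simp add: \<U>_def)
  have disjP: "B \<inter> B' = {}" if "B \<in> \<P>" "B' \<in> \<P>" "B \<noteq> B'" for B B'
    using P(1) that by (auto simp: partition_on_def disjoint_def)
  have "disjoint \<U>"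
    unfolding disjoint_def
  proof (intro ballI impI)
    fix U U' assume "U \<in> \<U>" "U' \<in> \<U>" "U \<noteq> U'"
    then obtain B B' where "B \<in> \<P>" "B' \<in> \<P>" "U = u B" "U' = u B'" "B \<noteq> B'" by (auto simp: \<U>_def)
    then show "U \<inter> U' = {}" using u(1) disjP by blast
  qed
  moreover have UT: "\<Union>\<U> \<subseteq> T" using u(1) BT by (fastforce simp: \<U>_def)
  moreover have "\<forall>U\<in>\<U>. expanding G g U" using u(2) by (auto simp: \<U>_def)
  moreover have "real (\<Sum>U\<in>\<U>. edges_between G U (?V - U)) \<le> (1 + 2 * D / g) * X"
  proof -
    have "(\<Sum>U\<in>\<U>. edges_between G U (?V - U)) \<le> (\<Sum>U\<in>u ` \<P>. edges_between G U (?V - U))"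
      unfolding \<U>_def using finP by (intro sum_mono2) auto
    also have "\<dots> \<le> (\<Sum>B\<in>\<P>. edges_between G (u B) (?V - u B))"
      using sum_image_le[OF finP, of "\<lambda>U. edges_between G U (?V - U)" u] by (simp add: comp_def)
    finally have "real (\<Sum>U\<in>\<U>. edges_between G U (?V - U)) \<le> (\<Sum>B\<in>\<P>. real (edges_between G (u B) (?V - u B)))"
      by (metis of_nat_mono of_nat_sum)
    also have "\<dots> \<le> (\<Sum>B\<in>\<P>. (1 + 2 * D / g) * w B)"
    proof (rule sum_mono)
      fix B assume B: "B \<in> \<P>"
      have "?V - u B = (?V - B) \<union> (B - u B)" using u(1)[OF B] BT[OF B] T by blast
      then have "edges_between G (u B) (?V - u B) = edges_between G (u B) (?V - B) + edges_between G (u B) (B - u B)"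
        using fin finB[OF B] by (auto intro!: edges_between_Un_right)
      moreover have "edges_between G (u B) (?V - B) \<le> edges_between G B (?V - B)"
        using u(1)[OF B] fin finB[OF B] by (intro edges_between_mono) auto
      moreover have "edges_between G (u B) (B - u B) = edges_between G (B - u B) (u B)" by (rule edges_between_sym)
      moreover have "edges_between G (B - u B) (u B) \<le> D * card (B - u B)"
        using fin T D u(1)[OF B] BT[OF B] by (intro edges_between_le_degree) auto
      ultimately have "real (edges_between G (u B) (?V - u B)) \<le> w B + real (D * card (B - u B))"
        unfolding w_def by linarith
      \<comment> \<open>Each vertex dropped from \<open>B\<close> exposes at most \<open>D\<close>
        new boundary edges; this is the origin of the factor \<open>1 + 2 * D / g\<close>.\<close>
      also have "real (D * card (B - u B)) \<le> D * (2 * w B / g)"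
      proof -
        have "real (card (B - u B)) \<le> 2 * w B / g" using u(3)[OF B] g by (simp add: field_simps)
        then have "real D * card (B - u B) \<le> real D * (2 * w B / g)" by (rule mult_left_mono) simp
        then show ?thesis by simp
      qed
      finally show "real (edges_between G (u B) (?V - u B)) \<le> (1 + 2 * D / g) * w B" by (simp add: algebra_simps)
    qed
    also have "\<dots> = (1 + 2 * D / g) * (\<Sum>B\<in>\<P>. w B)" by (simp add: sum_distrib_left)
    also have "\<dots> \<le> (1 + 2 * D / g) * X" using wX g by (intro mult_left_mono) auto
    finally show ?thesis .
  qed
  moreover have "real (card (?V - \<Union>\<U>)) \<le> card (?V - T) + 2 / g * X"
  proof -
    have "?V - \<Union>\<U> \<subseteq> (?V - T) \<union> (\<Union>B\<in>\<P>. B - u B)"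
      using P(1) by (auto simp: partition_on_def \<U>_def)
    then have "card (?V - \<Union>\<U>) \<le> card ((?V - T) \<union> (\<Union>B\<in>\<P>. B - u B))"
      using fin finP finB by (intro card_mono) auto
    also have "\<dots> \<le> card (?V - T) + card (\<Union>B\<in>\<P>. B - u B)" by (rule card_Un_le)
    also have "card (\<Union>B\<in>\<P>. B - u B) \<le> (\<Sum>B\<in>\<P>. card (B - u B))" by (rule card_UN_le[OF finP])
    finally have "real (card (?V - \<Union>\<U>)) \<le> card (?V - T) + (\<Sum>B\<in>\<P>. real (card (B - u B)))"
      by (simp flip: of_nat_sum of_nat_add)
    also have "(\<Sum>B\<in>\<P>. real (card (B - u B))) \<le> (\<Sum>B\<in>\<P>. 2 / g * w B)"
      using u(3) g by (intro sum_mono) (simp add: field_simps)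
    also have "\<dots> = 2 / g * (\<Sum>B\<in>\<P>. w B)" by (simp add: sum_distrib_left)
    also have "\<dots> \<le> 2 / g * X" using wX g by (intro mult_left_mono) auto
    finally show ?thesis by simp
  qed
  ultimately show ?thesis unfolding X_def using finU by (intro exI[of _ \<U>]) (auto simp: \<U>_def)
qed

section \<open>Reassembly into a regular graph\<close>

text \<open>Loops make up for the deleted edges: a loop counts once in the degree and never crosses a cut.\<close>

definition regular_part :: "'v graph \<Rightarrow> nat \<Rightarrow> 'v set \<Rightarrow> 'v graph" where
  "regular_part G d U =
    \<lparr>verts = U,
     emult = (\<lambda>e. if \<exists>v\<in>U. e = {v} then d - (\<Sum>w\<in>U - {the_elem e}. emult G {the_elem e, w})
       else if e \<subseteq> U then emult G e else 0)\<rparr>"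

lemma regular_part_simps:
  "verts (regular_part G d U) = U"
  "v \<in> U \<Longrightarrow> emult (regular_part G d U) {v} = d - (\<Sum>w\<in>U - {v}. emult G {v, w})"
  "u \<in> U \<Longrightarrow> w \<in> U \<Longrightarrow> u \<noteq> w \<Longrightarrow> emult (regular_part G d U) {u, w} = emult G {u, w}"
  "\<not> e \<subseteq> U \<Longrightarrow> emult (regular_part G d U) e = 0"
  by (auto simp: regular_part_def)

lemma regular_part_finite_graph:
  assumes "wf_graph G" "finite U" shows "finite_graph (regular_part G d U)"
proof -
  have "\<exists>u\<in>U. \<exists>v\<in>U. e = {u, v}" if "emult (regular_part G d U) e > 0" for e
  proof (cases "\<exists>v\<in>U. e = {v}")
    case False
    then have "e \<subseteq> U" "emult G e > 0" using that by (auto simp: regular_part_def split: if_splits)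
    moreover then obtain u v where "e = {u, v}" using assms(1) unfolding wf_graph_def by blast
    ultimately show ?thesis by blast
  qed auto
  then show ?thesis using assms(2) by (simp add: finite_graph_def wf_graph_def regular_part_simps)
qed

lemma regular_part_regular:
  assumes fin: "finite U" and deg: "\<And>v. v \<in> U \<Longrightarrow> (\<Sum>w\<in>U - {v}. emult G {v, w}) \<le> d"
  shows "regular_graph d (regular_part G d U)"
  unfolding regular_graph_def
proof
  fix v assume "v \<in> verts (regular_part G d U)"
  then have v: "v \<in> U" by (simp add: regular_part_simps)
  have "vertex_degree (regular_part G d U) v
      = emult (regular_part G d U) {v} + (\<Sum>w\<in>U - {v}. emult (regular_part G d U) {v, w})"
    unfolding vertex_degree_def regular_part_simps(1) using fin v
    by (subst sum.remove[of U v]) auto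
  also have "(\<Sum>w\<in>U - {v}. emult (regular_part G d U) {v, w}) = (\<Sum>w\<in>U - {v}. emult G {v, w})"
    using v by (intro sum.cong refl regular_part_simps) auto
  finally show "vertex_degree (regular_part G d U) v = d"
    using deg[OF v] v by (simp add: regular_part_simps)
qed

lemma regular_part_expander:
  assumes wf: "wf_graph G" and fin: "finite U"
    and deg: "\<And>v. v \<in> U \<Longrightarrow> (\<Sum>w\<in>U - {v}. emult G {v, w}) \<le> d"
    and ex: "expanding G g U" and d: "0 < d"
  shows "expander (g / d) d (regular_part G d U)"
  unfolding expander_def
proof (intro conjI allI impI regular_part_finite_graph regular_part_regular assms)
  fix A assume A: "A \<subseteq> verts (regular_part G d U)"
    "real (card A) \<le> real (card (verts (regular_part G d U))) / 2"
  then have AU: "A \<subseteq> U" "real (card A) \<le> real (card U) / 2" by (auto simp: regular_part_simps)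
  have "edges_between (regular_part G d U) A (U - A) = edges_between G A (U - A)"
    unfolding edges_between_def using AU by (intro sum.cong refl regular_part_simps) auto
  moreover have "g * real (card A) \<le> real (edges_between G A (U - A))"
    using ex AU unfolding expanding_def by simp
  ultimately show "g / real d * real d * real (card A)
      \<le> real (edges_between (regular_part G d U) A (verts (regular_part G d U) - A))"
    using d by (simp add: regular_part_simps)
qed

definition reassemble :: "'v graph \<Rightarrow> nat \<Rightarrow> 'v set set \<Rightarrow> 'v graph" where
  "reassemble G d \<Q> = \<lparr>verts = \<Union>\<Q>, emult = (\<lambda>e. \<Sum>U\<in>\<Q>. emult (regular_part G d U) e)\<rparr>"

lemma reassemble_emult_in:
  assumes "finite \<Q>" "disjoint \<Q>" "U \<in> \<Q>" "v \<in> U" "v \<in> e"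
  shows "emult (reassemble G d \<Q>) e = emult (regular_part G d U) e"
proof -
  have "emult (regular_part G d U') e = 0" if U': "U' \<in> \<Q> - {U}" for U'
  proof -
    have "U \<inter> U' = {}" using assms U' unfolding disjoint_def by blast
    then have "\<not> e \<subseteq> U'" using assms(4,5) by blast
    then show ?thesis by (rule regular_part_simps(4))
  qed
  then show ?thesis
    unfolding reassemble_def using assms by (simp add: sum.remove[of \<Q> U])
qed

lemma reassemble_disjoint_union:
  assumes "finite \<Q>" "disjoint \<Q>"
  shows "vertex_disjoint_union (reassemble G d \<Q>) (regular_part G d ` \<Q>)"
proof -
  have inj: "inj_on (regular_part G d) \<Q>"
    by (rule inj_on_inverseI[of _ verts]) (simp add: regular_part_simps)
  show ?thesis
    unfolding vertex_disjoint_union_def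
  proof (intro conjI allI)
    show "disjoint_family_on verts (regular_part G d ` \<Q>)"
      unfolding disjoint_family_on_def
    proof (intro ballI impI)
      fix H H' assume "H \<in> regular_part G d ` \<Q>" "H' \<in> regular_part G d ` \<Q>" "H \<noteq> H'"
      then obtain U U' where "U \<in> \<Q>" "U' \<in> \<Q>" "U \<noteq> U'" "H = regular_part G d U" "H' = regular_part G d U'"
        by blast
      then show "verts H \<inter> verts H' = {}"
        using assms(2) by (simp add: disjoint_def regular_part_simps)
    qed
    show "emult (reassemble G d \<Q>) e = (\<Sum>H\<in>regular_part G d ` \<Q>. emult H e)" for e
      by (simp add: reassemble_def sum.reindex[OF inj])
  qed (use assms in \<open>auto simp: reassemble_def regular_part_simps\<close>)
qed

lemma reassemble_finite_graph:
  assumes "wf_graph G" "finite \<Q>" "\<And>U. U \<in> \<Q> \<Longrightarrow> finite U"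
  shows "finite_graph (reassemble G d \<Q>)"
proof -
  have "\<exists>u\<in>\<Union>\<Q>. \<exists>v\<in>\<Union>\<Q>. e = {u, v}" if "emult (reassemble G d \<Q>) e > 0" for e
  proof -
    obtain U where U: "U \<in> \<Q>" "emult (regular_part G d U) e > 0"
      using \<open>emult (reassemble G d \<Q>) e > 0\<close> by (auto simp: reassemble_def elim!: sum.not_neutral_contains_not_neutral[OF less_imp_neq[THEN not_sym]])
    then obtain u v where "u \<in> U" "v \<in> U" "e = {u, v}"
      using regular_part_finite_graph[OF assms(1) assms(3)[OF U(1)], of d]
      unfolding finite_graph_def wf_graph_def regular_part_simps by blast
    then show ?thesis using U(1) by blast
  qed
  then show ?thesis
    using assms by (auto simp: finite_graph_def wf_graph_def reassemble_def)
qed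

lemma reassemble_degree:
  assumes "finite \<Q>" "disjoint \<Q>" "\<And>U. U \<in> \<Q> \<Longrightarrow> finite U" "U \<in> \<Q>" "v \<in> U"
  shows "vertex_degree (reassemble G d \<Q>) v = vertex_degree (regular_part G d U) v"
proof -
  have "vertex_degree (reassemble G d \<Q>) v = (\<Sum>w\<in>\<Union>\<Q>. emult (regular_part G d U) {v, w})"
    unfolding vertex_degree_def using assms
    by (intro sum.cong reassemble_emult_in) (auto simp: reassemble_def)
  also have "\<dots> = (\<Sum>w\<in>U. emult (regular_part G d U) {v, w})"
    using assms by (intro sum.mono_neutral_right) (auto intro!: regular_part_simps)
  finally show ?thesis by (simp add: vertex_degree_def regular_part_simps)
qed

text \<open>Ordered pairs reach every edge, those that are not loops twice; the overcount is
  harmless and turns the sum into row sums.\<close>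

lemma card_edge_sym_diff_le:
  assumes "finite_graph G" "finite_graph H" "verts H = verts G"
  shows "card_edge_sym_diff G H
    \<le> (\<Sum>u\<in>verts G. \<Sum>w\<in>verts G. (emult G {u, w} - emult H {u, w}) + (emult H {u, w} - emult G {u, w}))"
proof -
  define h where "h e = (emult G e - emult H e) + (emult H e - emult G e)" for e
  let ?V = "verts G" and ?p = "\<lambda>(u, w). {u, w}"
  have fin: "finite ?V" using assms by (simp add: finite_graph_def)
  have "card_edge_sym_diff G H = (\<Sum>e\<in>Pow ?V. h e)"
    using assms(3) by (simp add: card_edge_sym_diff_def h_def)
  also have "\<dots> = (\<Sum>e\<in>?p ` (?V \<times> ?V). h e)"
  proof (rule sum.mono_neutral_right)
    show "?p ` (?V \<times> ?V) \<subseteq> Pow ?V" by auto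
    show "\<forall>e\<in>Pow ?V - ?p ` (?V \<times> ?V). h e = 0"
    proof
      fix e assume e: "e \<in> Pow ?V - ?p ` (?V \<times> ?V)"
      then have "\<not> (\<exists>u\<in>?V. \<exists>w\<in>?V. e = {u, w})" by auto
      then have "\<not> emult G e > 0" "\<not> emult H e > 0"
        using assms unfolding finite_graph_def wf_graph_def by metis+
      then show "h e = 0" by (simp add: h_def)
    qed
  qed (use fin in simp)
  also have "\<dots> \<le> (\<Sum>z\<in>?V \<times> ?V. h (?p z))"
    using sum_image_le[of "?V \<times> ?V" h ?p] fin by (simp add: comp_def)
  also have "\<dots> = (\<Sum>u\<in>?V. \<Sum>w\<in>?V. h {u, w})"
    by (simp add: sum.cartesian_product split_def)
  finally show ?thesis by (simp add: h_def)
qed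

text \<open>At a covered vertex the degree is already \<open>d\<close>, so the added loops equal in
  number the edges that leave its part. Each such edge is paid for as a deleted edge and as a new
  loop, hence the factor 2. An uncovered vertex changes at most \<open>D + d\<close> edges.\<close>

lemma expander_reassembly:
  fixes G :: "'v graph"
  assumes G: "finite_graph G" and d: "0 < d"
    and U: "finite \<U>" "disjoint \<U>" "{} \<notin> \<U>" "\<Union>\<U> \<subseteq> verts G"
    and deg: "\<And>v. v \<in> \<Union>\<U> \<Longrightarrow> vertex_degree G v = d"
    and D: "\<And>v. v \<in> verts G \<Longrightarrow> vertex_degree G v \<le> D"
    and ex: "\<And>U. U \<in> \<U> \<Longrightarrow> expanding G g U"
  shows "\<exists>G'. finite_graph G' \<and> regular_graph d G' \<and> verts G' = verts G \<and>
    (\<exists>\<H>. vertex_disjoint_union G' \<H> \<and> (\<forall>H\<in>\<H>. expander (g / d) d H)) \<and>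
    card_edge_sym_diff G G' \<le> 2 * (\<Sum>U\<in>\<U>. edges_between G U (verts G - U)) + (D + d) * card (verts G - \<Union>\<U>)"
proof -
  let ?V = "verts G"
  have fin: "finite ?V" and wf: "wf_graph G" using G by (auto simp: finite_graph_def)
  define Z where "Z = ?V - \<Union>\<U>"
  \<comment> \<open>Uncovered vertices become parts of one vertex carrying \<open>d\<close> loops.
    They expand trivially: only the empty set has at most half their size.\<close>
  define \<Q> where "\<Q> = \<U> \<union> (\<lambda>v. {v}) ` Z"
  have finZ: "finite Z" using fin by (simp add: Z_def)
  have finQ: "finite \<Q>" using U(1) finZ by (simp add: \<Q>_def)
  have disjQ: "disjoint \<Q>"
    using U(2) unfolding disjoint_def \<Q>_def Z_def by blast
  have UQ: "\<Union>\<Q> = ?V" using U(4) by (auto simp: \<Q>_def Z_def)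
  have finU: "finite U" if "U \<in> \<Q>" for U using that UQ fin by (metis Union_upper finite_subset)
  have nd: "(\<Sum>w\<in>U - {v}. emult G {v, w}) \<le> d" if Uv: "U \<in> \<Q>" "v \<in> U" for U v
  proof (cases "U \<in> \<U>")
    case True
    have "(\<Sum>w\<in>U - {v}. emult G {v, w}) \<le> vertex_degree G v"
      unfolding vertex_degree_def using fin U(4) True by (intro sum_mono2) auto
    then show ?thesis using deg[of v] True Uv(2) by auto
  next
    case False
    then have "U - {v} = {}" using Uv by (auto simp: \<Q>_def)
    then show ?thesis by (metis sum.empty le0)
  qed
  have exQ: "expanding G g U" if UQ': "U \<in> \<Q>" for U
  proof (cases "U \<in> \<U>")
    case False
    then obtain v where v: "U = {v}" using UQ' by (auto simp: \<Q>_def)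
    then show ?thesis by (auto simp: expanding_def subset_singleton_iff)
  qed (rule ex)
  define G' where "G' = reassemble G d \<Q>"
  have vG': "verts G' = ?V" by (simp add: G'_def reassemble_def UQ)
  have fg: "finite_graph G'" unfolding G'_def using wf finQ finU by (rule reassemble_finite_graph)
  have degQ: "vertex_degree G' v = d" if v: "v \<in> ?V" for v
  proof -
    obtain U where U': "U \<in> \<Q>" "v \<in> U" using v UQ by blast
    have "vertex_degree G' v = vertex_degree (regular_part G d U) v"
      unfolding G'_def using finQ disjQ finU U' by (rule reassemble_degree)
    also have "\<dots> = d"
      using regular_part_regular[OF finU[OF U'(1)] nd[OF U'(1)]] U'(2)
      by (simp add: regular_graph_def regular_part_simps)
    finally show ?thesis .
  qed
  have "regular_graph d G'" using degQ by (simp add: regular_graph_def vG')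
  moreover have "\<exists>\<H>. vertex_disjoint_union G' \<H> \<and> (\<forall>H\<in>\<H>. expander (g / d) d H)"
  proof (intro exI conjI)
    show "vertex_disjoint_union G' (regular_part G d ` \<Q>)"
      unfolding G'_def using finQ disjQ by (rule reassemble_disjoint_union)
    show "\<forall>H\<in>regular_part G d ` \<Q>. expander (g / d) d H"
      using regular_part_expander[OF wf finU nd exQ d] by blast
  qed
  moreover have "card_edge_sym_diff G G' \<le> 2 * (\<Sum>U\<in>\<U>. edges_between G U (?V - U)) + (D + d) * card Z"
  proof -
    define h where "h u w = (emult G {u, w} - emult G' {u, w}) + (emult G' {u, w} - emult G {u, w})" for u w
    have hZ: "(\<Sum>w\<in>?V. h v w) \<le> D + d" if v: "v \<in> Z" for v
    proof -
      have "(\<Sum>w\<in>?V. h v w) \<le> (\<Sum>w\<in>?V. emult G {v, w} + emult G' {v, w})"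
        by (intro sum_mono) (simp add: h_def)
      also have "\<dots> = vertex_degree G v + vertex_degree G' v"
        by (simp add: sum.distrib vertex_degree_def vG')
      also have "\<dots> \<le> D + d" using D[of v] degQ[of v] v by (auto simp: Z_def)
      finally show ?thesis .
    qed
    have hU: "(\<Sum>w\<in>?V. h v w) \<le> 2 * (\<Sum>w\<in>?V - U. emult G {v, w})" if Uv: "U \<in> \<U>" "v \<in> U" for U v
    proof -
      have UQ': "U \<in> \<Q>" using Uv by (simp add: \<Q>_def)
      have UV: "U \<subseteq> ?V" using U(4) Uv by blast
      have G'v: "emult G' {v, w} = emult (regular_part G d U) {v, w}" for w
        unfolding G'_def using finQ disjQ UQ' Uv(2) by (rule reassemble_emult_in) simp
      let ?nd = "\<Sum>w\<in>U - {v}. emult G {v, w}" and ?out = "\<Sum>w\<in>?V - U. emult G {v, w}"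
      have split: "(\<Sum>w\<in>?V. k w) = k v + (\<Sum>w\<in>U - {v}. k w) + (\<Sum>w\<in>?V - U. k w)" for k :: "'v \<Rightarrow> nat"
      proof -
        have "(\<Sum>w\<in>?V. k w) = (\<Sum>w\<in>?V - U. k w) + (\<Sum>w\<in>U. k w)"
          using fin UV by (intro sum.subset_diff) auto
        also have "(\<Sum>w\<in>U. k w) = k v + (\<Sum>w\<in>U - {v}. k w)"
          using finU[OF UQ'] Uv(2) by (intro sum.remove) auto
        finally show ?thesis by simp
      qed
      have "d = emult G {v, v} + ?nd + ?out"
        using deg[of v] Uv split[of "\<lambda>w. emult G {v, w}"] by (auto simp: vertex_degree_def)
      moreover have "emult G' {v, v} = d - ?nd"
        using G'v[of v] Uv(2) by (simp add: regular_part_simps)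
      ultimately have hv: "h v v = ?out" by (simp add: h_def)
      have "(\<Sum>w\<in>U - {v}. h v w) = 0"
      proof (rule sum.neutral, rule ballI)
        fix w assume w: "w \<in> U - {v}"
        then have "emult G' {v, w} = emult G {v, w}"
          unfolding G'v using Uv(2) by (intro regular_part_simps) auto
        then show "h v w = 0" by (simp add: h_def)
      qed
      moreover have "(\<Sum>w\<in>?V - U. h v w) = ?out"
      proof (rule sum.cong[OF refl])
        fix w assume w: "w \<in> ?V - U"
        then have "emult G' {v, w} = 0" unfolding G'v by (intro regular_part_simps(4)) auto
        then show "h v w = emult G {v, w}" by (simp add: h_def)
      qed
      ultimately show ?thesis using split[of "h v"] hv by simp
    qed
    have "card_edge_sym_diff G G' \<le> (\<Sum>v\<in>?V. \<Sum>w\<in>?V. h v w)"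
      unfolding h_def by (rule card_edge_sym_diff_le[OF G fg vG'])
    also have "\<dots> = (\<Sum>v\<in>Z. \<Sum>w\<in>?V. h v w) + (\<Sum>v\<in>\<Union>\<U>. \<Sum>w\<in>?V. h v w)"
      unfolding Z_def using fin U(4) by (intro sum.subset_diff) auto
    also have "(\<Sum>v\<in>\<Union>\<U>. \<Sum>w\<in>?V. h v w) = (\<Sum>U\<in>\<U>. \<Sum>v\<in>U. \<Sum>w\<in>?V. h v w)"
    proof -
      have "\<forall>A\<in>\<U>. finite A" using finU by (simp add: \<Q>_def)
      moreover have "\<forall>A\<in>\<U>. \<forall>B\<in>\<U>. A \<noteq> B \<longrightarrow> A \<inter> B = {}" using U(2) by (auto simp: disjoint_def)
      ultimately show ?thesis by (subst sum.Union_disjoint) auto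
    qed
    also have "\<dots> \<le> (\<Sum>U\<in>\<U>. \<Sum>v\<in>U. 2 * (\<Sum>w\<in>?V - U. emult G {v, w}))"
      by (intro sum_mono hU)
    also have "\<dots> = 2 * (\<Sum>U\<in>\<U>. edges_between G U (?V - U))"
      by (simp add: edges_between_def sum_distrib_left)
    also have "(\<Sum>v\<in>Z. \<Sum>w\<in>?V. h v w) \<le> (\<Sum>v\<in>Z. D + d)" by (intro sum_mono hZ)
    finally show ?thesis by (simp add: mult.commute)
  qed
  ultimately show ?thesis using fg vG' unfolding Z_def by blast
qed

lemma (in fg_group) chart_vertex_degree:
  assumes "chart G R \<phi>" "1 \<le> R" "finite (verts G)"
  shows "vertex_degree G (\<phi> \<one>) = d"
proof -
  have "real (vertex_degree G (\<phi> \<one>)) = real d"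
    using chart_degree[OF assms(1) one_W[of 0] _ assms(3)] assms(2) by (simp add: vertex_degree_def)
  then show ?thesis by simp
qed

text \<open>Choosing \<open>G'\<^sub>n\<close> with the fewest changes makes any approximation scheme with fixed parameters
  apply to it, so no diagonal sequence of parameters is needed.\<close>

lemma (in fg_group) expander_approximation:
  fixes G :: "nat \<Rightarrow> 'v graph"
  assumes T: "property_T \<Gamma>" and fg: "\<And>n. finite_graph (G n)" and "bounded_degree G"
    and conv: "locally_converges_to_cayley G \<Gamma> S"
  shows "\<exists>\<gamma>>0. \<exists>G' :: nat \<Rightarrow> 'v graph.
           (\<forall>n. finite_graph (G' n) \<and> regular_graph d (G' n)) \<and>
           (\<forall>n. verts (G' n) = verts (G n)) \<and>
           (\<lambda>n. real (card_edge_sym_diff (G n) (G' n)) / real (card (verts (G n)))) \<longlonglongrightarrow> 0 \<and>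
           (\<forall>n. \<exists>\<H>. vertex_disjoint_union (G' n) \<H> \<and> (\<forall>H\<in>\<H>. expander \<gamma> d H))"
proof -
  obtain D where D: "\<And>n v. v \<in> verts (G n) \<Longrightarrow> vertex_degree (G n) v \<le> D"
    using assms(3) unfolding bounded_degree_def by blast
  have fin: "finite (verts (G n))" for n using fg by (simp add: finite_graph_def)
  obtain \<gamma>0 :: real where \<gamma>0: "0 < \<gamma>0" and smooth: "\<And>\<eta> :: real. 0 < \<eta> \<Longrightarrow> \<exists>R\<ge>1. \<forall>(G :: 'v graph) A.
      finite (verts G) \<longrightarrow> A \<subseteq> verts G \<longrightarrow> A \<noteq> {} \<longrightarrow>
      (\<forall>v\<in>A. \<exists>\<phi>. chart G R \<phi> \<and> \<phi> \<one> = v) \<longrightarrow>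
      real (edges_between G A (verts G - A)) \<le> \<gamma>0 * card A \<longrightarrow>
      (\<exists>A'\<subseteq>verts G. real (card (A - A')) \<le> card A / 4 \<and> real (card (A' - A)) \<le> card A / 4 \<and>
        real (edges_between G A' (verts G - A')) \<le> \<eta> * card A)"
    using property_T_smoothing[OF T] by metis
  \<comment> \<open>Matches the \<open>4 * g\<close> up to which
    \<open>expander_decomposition\<close> asks for smoothing.\<close>
  define g where "g = \<gamma>0 / 4"
  have g: "0 < g" using \<gamma>0 by (simp add: g_def)
  define ok where "ok n H \<longleftrightarrow> finite_graph H \<and> regular_graph d H \<and> verts H = verts (G n) \<and>
    (\<exists>\<H>. vertex_disjoint_union H \<H> \<and> (\<forall>H\<in>\<H>. expander (g / d) d H))" for n H
  have approx: "\<exists>n0. \<forall>n\<ge>n0. \<exists>H. ok n H \<and> real (card_edge_sym_diff (G n) H) \<le> \<epsilon> * card (verts (G n))"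
    if \<epsilon>: "0 < \<epsilon>" for \<epsilon> :: real
  proof -
    \<comment> \<open>The coefficient of \<open>X\<close> in the final count: cut edges count twice,
      and each of the \<open>2 / g * X\<close> dropped vertices changes at most \<open>D + d\<close>
      edges.\<close>
    define K where "K = 2 * (1 + 2 * real D / g) + real (D + d) * (2 / g)"
    have K: "0 < K" using g by (simp add: K_def add_pos_nonneg)
    \<comment> \<open>Makes \<open>K * (2 * \<eta>) = \<epsilon> / 2\<close>; the other half is left
      for the bad vertices.\<close>
    define \<eta> where "\<eta> = \<epsilon> / (4 * K)"
    have \<eta>: "0 < \<eta>" using \<epsilon> K by (simp add: \<eta>_def)
    obtain R where R: "R \<ge> 1" and sm: "\<And>(G :: 'v graph) A. \<lbrakk>finite (verts G); A \<subseteq> verts G; A \<noteq> {};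
      \<forall>v\<in>A. \<exists>\<phi>. chart G R \<phi> \<and> \<phi> \<one> = v; real (edges_between G A (verts G - A)) \<le> \<gamma>0 * card A\<rbrakk> \<Longrightarrow>
      \<exists>A'\<subseteq>verts G. real (card (A - A')) \<le> card A / 4 \<and> real (card (A' - A)) \<le> card A / 4 \<and>
        real (edges_between G A' (verts G - A')) \<le> 3 / 4 * \<eta> * card A"
      using smooth[of "3 / 4 * \<eta>"] \<eta> by auto
    define L where "L = K * D + (D + d)"
    define good where "good n = {v \<in> verts (G n). \<exists>f. rooted_iso f (ball_graph (G n) v R) v
                       (ball_graph (cayley_graph \<Gamma> S) \<one> R) \<one>}" for n
    have lim: "(\<lambda>n. real (card (good n)) / real (card (verts (G n)))) \<longlonglongrightarrow> 1"
      using conv unfolding locally_converges_to_cayley_def good_def by blast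
    \<comment> \<open>\<open>L + 1\<close> in place of \<open>L\<close> keeps the divisor
      positive.\<close>
    define \<delta> where "\<delta> = \<epsilon> / (2 * (L + 1))"
    have L: "0 \<le> L" using K by (simp add: L_def)
    have \<delta>: "0 < \<delta>" using \<epsilon> L by (simp add: \<delta>_def)
    obtain n0 where n0: "\<And>n. n \<ge> n0 \<Longrightarrow> \<bar>real (card (good n)) / real (card (verts (G n))) - 1\<bar> < \<delta>"
      using LIMSEQ_D[OF lim \<delta>] by auto
    show ?thesis
    proof (intro exI[of _ n0] allI impI)
      fix n assume n: "n \<ge> n0"
      let ?V = "verts (G n)"
      have goodV: "good n \<subseteq> ?V" by (auto simp: good_def)
      have ch: "\<exists>\<phi>. chart (G n) R \<phi> \<and> \<phi> \<one> = v" if "v \<in> good n" for v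
        using that rooted_iso_chart by (auto simp: good_def)
      have bad: "real (card (?V - good n)) \<le> \<delta> * card ?V"
      proof (cases "card ?V = 0")
        case True
        then show ?thesis using fin by simp
      next
        case False
        have "1 - \<delta> < real (card (good n)) / card ?V" using n0[OF n] by linarith
        then have "(1 - \<delta>) * card ?V < card (good n)" using False by (simp add: field_simps)
        moreover have "real (card (?V - good n)) = real (card ?V) - card (good n)"
          using goodV fin by (simp add: card_Diff_subset finite_subset card_mono of_nat_diff)
        ultimately show ?thesis by (simp add: algebra_simps)
      qed
      have sm': "\<exists>A'\<subseteq>?V. real (card (A - A')) \<le> card A / 4 \<and> real (card (A' - A)) \<le> card A / 4 \<and>
          real (edges_between (G n) A' (?V - A')) \<le> 3 / 4 * \<eta> * card A"
        if "A \<subseteq> good n" "A \<noteq> {}" "real (edges_between (G n) A (?V - A)) \<le> 4 * g * card A" for A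
        using that goodV ch by (intro sm fin) (auto simp: g_def)
      define X where "X = 2 * \<eta> * card ?V + D * card (?V - good n)"
      have "\<exists>\<U>. finite \<U> \<and> disjoint \<U> \<and> {} \<notin> \<U> \<and> \<Union>\<U> \<subseteq> good n \<and> (\<forall>U\<in>\<U>. expanding (G n) g U) \<and>
          real (\<Sum>U\<in>\<U>. edges_between (G n) U (?V - U)) \<le> (1 + 2 * real D / g) * X \<and>
          real (card (?V - \<Union>\<U>)) \<le> card (?V - good n) + 2 / g * X"
        unfolding X_def by (rule expander_decomposition[OF fin goodV _ g \<eta>]) (rule D sm'; assumption)+
      then obtain \<U> where U: "finite \<U>" "disjoint \<U>" "{} \<notin> \<U>" "\<Union>\<U> \<subseteq> good n" "\<forall>U\<in>\<U>. expanding (G n) g U"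
        and U1: "real (\<Sum>U\<in>\<U>. edges_between (G n) U (?V - U)) \<le> (1 + 2 * real D / g) * X"
        and U2: "real (card (?V - \<Union>\<U>)) \<le> card (?V - good n) + 2 / g * X"
        by (elim exE conjE) (rule that; assumption)
      have "\<exists>H. finite_graph H \<and> regular_graph d H \<and> verts H = ?V \<and>
        (\<exists>\<H>. vertex_disjoint_union H \<H> \<and> (\<forall>H\<in>\<H>. expander (g / d) d H)) \<and>
        card_edge_sym_diff (G n) H \<le> 2 * (\<Sum>U\<in>\<U>. edges_between (G n) U (?V - U)) + (D + d) * card (?V - \<Union>\<U>)"
      proof (rule expander_reassembly[OF fg d_pos U(1-3)])
        show "\<Union>\<U> \<subseteq> ?V" using U(4) goodV by blast
        show "vertex_degree (G n) v = d" if "v \<in> \<Union>\<U>" for v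
        proof -
          have "v \<in> good n" using that U(4) by blast
          then obtain \<phi> where "chart (G n) R \<phi>" "\<phi> \<one> = v" using ch by blast
          then show ?thesis using chart_vertex_degree R fin by blast
        qed
        show "expanding (G n) g U" if "U \<in> \<U>" for U using U(5) that by blast
      qed (rule D)
      then obtain H where H: "ok n H"
        and Hd: "card_edge_sym_diff (G n) H \<le> 2 * (\<Sum>U\<in>\<U>. edges_between (G n) U (?V - U)) + (D + d) * card (?V - \<Union>\<U>)"
        unfolding ok_def by blast
      have "real (card_edge_sym_diff (G n) H)
          \<le> 2 * real (\<Sum>U\<in>\<U>. edges_between (G n) U (?V - U)) + real (D + d) * real (card (?V - \<Union>\<U>))"
        using Hd by (simp only: of_nat_le_iff[symmetric, where 'a = real] of_nat_add of_nat_mult of_nat_numeral)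
      also have "\<dots> \<le> 2 * ((1 + 2 * real D / g) * X) + real (D + d) * (card (?V - good n) + 2 / g * X)"
        using U1 U2 by (intro add_mono mult_left_mono) auto
      also have "\<dots> = K * X + real (D + d) * card (?V - good n)"
      proof -
        have "2 * (a * x) + c * (y + b * x) = (2 * a + c * b) * x + c * y" for a b c x y :: real
          by (simp add: algebra_simps)
        then show ?thesis unfolding K_def .
      qed
      also have "\<dots> = K * (2 * \<eta> * card ?V) + L * card (?V - good n)"
        by (simp add: L_def X_def algebra_simps)
      also have "\<dots> \<le> \<epsilon> / 2 * card ?V + L * (\<delta> * card ?V)"
      proof (rule add_mono)
        show "K * (2 * \<eta> * card ?V) \<le> \<epsilon> / 2 * card ?V" using K by (simp add: \<eta>_def)
        show "L * card (?V - good n) \<le> L * (\<delta> * card ?V)" using bad L by (rule mult_left_mono)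
      qed
      also have "L * (\<delta> * card ?V) \<le> \<epsilon> / 2 * card ?V"
      proof -
        have "L * \<delta> \<le> (L + 1) * \<delta>" using \<delta> by simp
        also have "\<dots> = \<epsilon> / 2"
        proof -
          have "L + 1 \<noteq> 0" using L by linarith
          then show ?thesis unfolding \<delta>_def by (simp add: divide_simps)
        qed
        finally have "L * \<delta> * card ?V \<le> \<epsilon> / 2 * card ?V" by (rule mult_right_mono) simp
        then show ?thesis by (simp add: mult.assoc)
      qed
      finally have "real (card_edge_sym_diff (G n) H) \<le> \<epsilon> * card ?V" by simp
      then show "\<exists>H. ok n H \<and> real (card_edge_sym_diff (G n) H) \<le> \<epsilon> * card ?V" using H by blast
    qed
  qed
  \<comment> \<open>With no parts at all, every vertex is isolated with \<open>d\<close> loops. So a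
    candidate exists for every \<open>n\<close>, also where \<open>G n\<close> is still far from the
    Cayley graph, and a best one can be chosen.\<close>
  have ex: "\<exists>H. ok n H" for n
  proof -
    have "\<exists>H. finite_graph H \<and> regular_graph d H \<and> verts H = verts (G n) \<and>
      (\<exists>\<H>. vertex_disjoint_union H \<H> \<and> (\<forall>H\<in>\<H>. expander (g / d) d H)) \<and>
      card_edge_sym_diff (G n) H \<le> 2 * (\<Sum>U\<in>{}. edges_between (G n) U (verts (G n) - U)) + (D + d) * card (verts (G n) - \<Union>{})"
      by (rule expander_reassembly[OF fg d_pos]) (auto simp: D disjoint_def)
    then show ?thesis unfolding ok_def by blast
  qed
  have "\<exists>H. ok n H \<and> (\<forall>H'. ok n H' \<longrightarrow> card_edge_sym_diff (G n) H \<le> card_edge_sym_diff (G n) H')" for n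
    using ex_has_least_nat[of "ok n" _ "card_edge_sym_diff (G n)"] ex[of n] by blast
  then obtain G' where G': "\<And>n. ok n (G' n)"
    and least: "\<And>n H. ok n H \<Longrightarrow> card_edge_sym_diff (G n) (G' n) \<le> card_edge_sym_diff (G n) H"
    by metis
  have "(\<lambda>n. real (card_edge_sym_diff (G n) (G' n)) / real (card (verts (G n)))) \<longlonglongrightarrow> 0"
    unfolding LIMSEQ_iff
  proof (intro allI impI)
    fix r :: real assume r: "0 < r"
    obtain n0 where n0: "\<And>n. n \<ge> n0 \<Longrightarrow> \<exists>H. ok n H \<and> real (card_edge_sym_diff (G n) H) \<le> r / 2 * card (verts (G n))"
      using approx[of "r / 2"] r by auto
    show "\<exists>n0. \<forall>n\<ge>n0. norm (real (card_edge_sym_diff (G n) (G' n)) / real (card (verts (G n))) - 0) < r"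
    proof (intro exI[of _ n0] allI impI)
      fix n assume "n \<ge> n0"
      then obtain H where "ok n H" and H: "real (card_edge_sym_diff (G n) H) \<le> r / 2 * card (verts (G n))"
        using n0 by blast
      then have "real (card_edge_sym_diff (G n) (G' n)) \<le> r / 2 * card (verts (G n))"
        using least[of n H] by (meson of_nat_mono order_trans)
      then have "real (card_edge_sym_diff (G n) (G' n)) / real (card (verts (G n))) \<le> r / 2"
        using r by (cases "card (verts (G n)) = 0") (simp_all add: field_simps)
      then have "real (card_edge_sym_diff (G n) (G' n)) / real (card (verts (G n))) < r"
        using r by linarith
      then show "norm (real (card_edge_sym_diff (G n) (G' n)) / real (card (verts (G n))) - 0) < r"
        by simp
    qed
  qed
  moreover have "0 < g / d" using g d_pos by simp
  ultimately show ?thesis using G' unfolding ok_def by (intro exI[of _ "g / d"] conjI exI[of _ G']) blast+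
qed

theorem theorem1:
  fixes \<Gamma> :: "('g, 'm) monoid_scheme" and S :: "'g set" and G :: "nat \<Rightarrow> 'v graph"
  assumes "group \<Gamma>" and "countable (carrier \<Gamma>)" and "infinite (carrier \<Gamma>)"
    and "property_T \<Gamma>"
    and "finite S" and "S \<subseteq> carrier \<Gamma>" and "generate \<Gamma> S = carrier \<Gamma>"
    and "\<And>n. finite_graph (G n)"
    and "bounded_degree G"
    and "locally_converges_to_cayley G \<Gamma> S"
  shows "\<exists>\<gamma>>0. \<exists>d. \<exists>G' :: nat \<Rightarrow> 'v graph.
           (\<forall>n. finite_graph (G' n) \<and> regular_graph d (G' n)) \<and>
           (\<forall>n. verts (G' n) = verts (G n)) \<and>
           (\<lambda>n. real (card_edge_sym_diff (G n) (G' n)) / real (card (verts (G n)))) \<longlonglongrightarrow> 0 \<and>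
           (\<forall>n. \<exists>\<H>. vertex_disjoint_union (G' n) \<H> \<and> (\<forall>H\<in>\<H>. expander \<gamma> d H))"
proof -
  interpret fg_group \<Gamma> S
    using assms by (simp add: fg_group_def fg_group_axioms_def)
  show ?thesis
    using expander_approximation[OF assms(4,8,9,10)] by blast
qed

end
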